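(* Let $(X,J)$ be an $\mathbb F$-MAP on $\mathbb R\times S$ and suppose that $\mathbb E_j[|X_1|^2]<\infty$ for all $j\in S$. Then for all $j\in S$, $t>0$ $$\mathbb E_j[X_t^2\boldsymbol\Lambda_t]=\bigg(2\int_0^te^{\mathbf Q^\top(t-s)}\boldsymbol\epsilon[X]\int_0^se^{\mathbf Q^\top(s-u)}\boldsymbol\epsilon[X]e^{\mathbf Q^\top u}\,\mathrm du\,\mathrm ds+\int_0^te^{\mathbf Q^\top(t-s)}\boldsymbol\epsilon\big[[X,X]\big]e^{\mathbf Q^\top s}\,\mathrm ds\bigg)\cdot\mathbf e_j ,$$ where $$\boldsymbol\epsilon[X]=\operatorname{diag}\big(\mathbb E[X_1^{(j)}]\big)+\mathbf Q^\top\circ\big(\mathbb E[Z^{ij}_{X,1}]\big)^\top_{i,j\in S},\qquad \boldsymbol\epsilon\big[[X,X]\big]=\operatorname{diag}\big(\mathbb V\mathrm{ar}(X_1^{(j)})\big)+\mathbf Q^\top\circ\big(\mathbb E[(Z^{ij}_{X,1})^2]\big)^\top_{i,j\in S}.$$ In particular this implies $$\begin{aligned}\mathbb V\mathrm{ar}_j[X_t]&=\mathbf 1^\top\boldsymbol\epsilon[X]\bigg(2\int_0^t\int_0^se^{\mathbf Q^\top(s-u)}\boldsymbol\epsilon[X]e^{\mathbf Q^\top u}\,\mathrm du\,\mathrm ds-\int_0^te^{\mathbf Q^\top s}\,\mathrm ds\cdot\mathbf e_j\cdot\mathbf 1^\top\boldsymbol\epsilon[X]\int_0^te^{\mathbf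 Q^\top s}\,\mathrm ds\bigg)\mathbf e_j\\&\quad+\mathbf 1^\top\boldsymbol\epsilon\big[[X,X]\big]\int_0^te^{\mathbf Q^\top s}\,\mathrm ds\cdot\mathbf e_j .\end{aligned}$$
   Context: $S=\{1,\dots,|S|\}$ is a finite set, and $(\Omega,\mathcal F,\mathbb F=(\mathcal F_t)_{t\ge0},\mathbb P)$ is a filtered probability space satisfying the usual conditions. An $\mathbb F$-Markov additive process ($\mathbb F$-MAP) on $\mathbb R^d\times S$ is an $\mathbb F$-adapted càdlàg Markov process $(X,J)=(X_t,J_t)_{t\ge0}$ with values in $\mathbb R^d\times S$ and $X_0=0$ such that for all $s,t\ge0$ and all bounded measurable $f:\mathbb R^d\to\mathbb R$, $g:S\to\mathbb R$, $$\mathbb E[f(X_{s+t}-X_s)g(J_{s+t})\mid\mathcal F_s]=\mathbb E_{J_s}[f(X_t-X_0)g(J_t)].$$ Here $\mathbb P_j=\mathbb P(\cdot\mid J_0=j)$, with expectation $\mathbb E_j$ and variance $\mathbb V\mathrm{ar}_j$, and $\mathbb P(J_0=j)>0$ for every $j\in S$ is assumed. The continuous-time Markov chain $J$ is assumed irreducible (hence ergodic) with intensity matrix $\mathbf Q=(q_{ij})_{i,j\in S}$ ($q_{ij}\ge0$ for $i\ne j$, $q_{ii}=-\sum_{j\ne i}q_{ij}$). Path structure: let $T_0=0$ and $T_1<T_2<\cdots$ be the jump times of $J$. There are independent $\mathbb F$-Lévy processes $X^{(j)}$, $j\in S$, and random variables $Z^{ij}_{X,n}$ ($i\ne j$, $n\ge1$),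 whose law $F_X^{ij}$ depends only on $(i,j)$ and which are independent of all other random elements, with $J$ independent of the $X^{(j)}$, such that $$X_t=\sum_{i\in S}\int_{(0,t]}\mathbf 1_{\{J_{s-}=i\}}\,\mathrm dX^{(i)}_s+\sum_{n\ge1}\sum_{i\ne j}Z^{ij}_{X,n}\mathbf 1_{\{J_{T_{n-1}}=i,\,J_{T_n}=j,\,T_n\le t\}} .$$ Notation: $Z^{jj}_{X,1}:=0$, and entries with $q_{ij}=0$ in an elementwise product with $\mathbf Q$ are $0$; $\circ$ is the elementwise matrix product; $\operatorname{diag}(a_j)$ is the diagonal matrix with entries $a_j$; $\mathbf e_j$ is the $j$-th unit column vector; $\mathbf 1$ is the column vector of ones; $\boldsymbol\Lambda_t:=\mathbf e_{J_t}=(\mathbf 1_{\{J_t=j\}})_{j\in S}$. Integrals of matrices are componentwise. *)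

theory Defs
  imports "HOL-Probability.Probability"
begin

section \<open>Filtered probability spaces and paths\<close>

text \<open>Time is \<open>[0, \<infinity>)\<close>; processes and filtrations are indexed by \<open>real\<close>, and only their values
  at nonnegative times are constrained.\<close>

locale usual_filtered_prob_space = prob_space M + complete_measure M
  for M :: "'w measure" +
  fixes F :: "real \<Rightarrow> 'w measure"
  assumes subalg: "0 \<le> t \<Longrightarrow> subalgebra M (F t)"
    and filtration_mono: "\<lbrakk>0 \<le> s; s \<le> t\<rbrakk> \<Longrightarrow> sets (F s) \<subseteq> sets (F t)"
    and right_continuous: "0 \<le> t \<Longrightarrow> sets (F t) = (\<Inter>u\<in>{t<..}. sets (F u))"
    and null_sets_initial: "null_sets M \<subseteq> sets (F 0)"

definition adapted ::
    "(real \<Rightarrow> 'w measure) \<Rightarrow> 'e measure \<Rightarrow> (real \<Rightarrow> 'w \<Rightarrow> 'e) \<Rightarrow> bool" where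
  "adapted F N Y \<longleftrightarrow> (\<forall>t\<ge>0. Y t \<in> measurable (F t) N)"

definition cadlag_in :: "'e topology \<Rightarrow> (real \<Rightarrow> 'e) \<Rightarrow> bool" where
  "cadlag_in T f \<longleftrightarrow>
     (\<forall>t\<ge>0. limitin T f (f t) (at_right t)) \<and>
     (\<forall>t>0. \<exists>l. limitin T f l (at_left t))"

definition markov_process ::
    "'w measure \<Rightarrow> (real \<Rightarrow> 'w measure) \<Rightarrow> 'e measure \<Rightarrow> (real \<Rightarrow> 'w \<Rightarrow> 'e) \<Rightarrow> bool" where
  "markov_process M F N Y \<longleftrightarrow>
     (\<forall>s\<ge>0. \<forall>t\<ge>0. \<forall>h \<in> borel_measurable N. bounded (range h) \<longrightarrow>
        (AE \<omega> in M.
           real_cond_exp M (F s) (\<lambda>\<omega>. h (Y (s + t) \<omega>)) \<omega> =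
           real_cond_exp M (vimage_algebra (space M) (Y s) N) (\<lambda>\<omega>. h (Y (s + t) \<omega>)) \<omega>))"

definition process_sigma ::
    "'w measure \<Rightarrow> 'e measure \<Rightarrow> (real \<Rightarrow> 'w \<Rightarrow> 'e) \<Rightarrow> 'w set set" where
  "process_sigma M N Y = sigma_sets (space M) (\<Union>t\<in>{0..}. {Y t -` A \<inter> space M |A. A \<in> sets N})"


section \<open>Markov additive processes\<close>

definition given_start :: "'w measure \<Rightarrow> (real \<Rightarrow> 'w \<Rightarrow> 's) \<Rightarrow> 's \<Rightarrow> 'w measure" where
  "given_start M J j = uniform_measure M {\<omega> \<in> space M. J 0 \<omega> = j}"

definition MAP ::
    "'w measure \<Rightarrow> (real \<Rightarrow> 'w measure) \<Rightarrow> (real \<Rightarrow> 'w \<Rightarrow> 'a::euclidean_space) \<Rightarrow>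
     (real \<Rightarrow> 'w \<Rightarrow> 's::finite) \<Rightarrow> bool" where
  "MAP M F X J \<longleftrightarrow>
     adapted F borel X \<and> adapted F (count_space UNIV) J \<and>
     (\<forall>\<omega>\<in>space M. cadlag_in euclidean (\<lambda>t. X t \<omega>)) \<and>
     (\<forall>\<omega>\<in>space M. cadlag_in (discrete_topology UNIV) (\<lambda>t. J t \<omega>)) \<and>
     markov_process M F (borel \<Otimes>\<^sub>M count_space UNIV) (\<lambda>t \<omega>. (X t \<omega>, J t \<omega>)) \<and>
     (\<forall>\<omega>\<in>space M. X 0 \<omega> = 0) \<and>
     (\<forall>j. measure M {\<omega> \<in> space M. J 0 \<omega> = j} > 0) \<and>
     (\<forall>s\<ge>0. \<forall>t\<ge>0. \<forall>f \<in> borel_measurable borel. \<forall>g :: 's \<Rightarrow> real. bounded (range f) \<longrightarrow>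
        (AE \<omega> in M.
           real_cond_exp M (F s) (\<lambda>\<omega>. f (X (s + t) \<omega> - X s \<omega>) * g (J (s + t) \<omega>)) \<omega> =
           integral\<^sup>L (given_start M J (J s \<omega>)) (\<lambda>\<omega>. f (X t \<omega> - X 0 \<omega>) * g (J t \<omega>))))"

definition transition_prob ::
    "'w measure \<Rightarrow> (real \<Rightarrow> 'w \<Rightarrow> 's) \<Rightarrow> real \<Rightarrow> 's \<Rightarrow> 's \<Rightarrow> real" where
  "transition_prob M J t i j = measure (given_start M J i) {\<omega> \<in> space M. J t \<omega> = j}"

text \<open>The intensity matrix is the right derivative at \<open>0\<close> of the transition function.\<close>

definition intensity_matrix ::
    "'w measure \<Rightarrow> (real \<Rightarrow> 'w \<Rightarrow> 's::finite) \<Rightarrow> real^'s^'s \<Rightarrow> bool" where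
  "intensity_matrix M J Q \<longleftrightarrow>
     (\<forall>i j. i \<noteq> j \<longrightarrow> 0 \<le> Q $ i $ j) \<and>
     (\<forall>i. Q $ i $ i = - (\<Sum>j\<in>UNIV - {i}. Q $ i $ j)) \<and>
     (\<forall>i j. ((\<lambda>t. transition_prob M J t i j) has_real_derivative Q $ i $ j) (at 0 within {0..}))"

definition irreducible_chain :: "'w measure \<Rightarrow> (real \<Rightarrow> 'w \<Rightarrow> 's) \<Rightarrow> bool" where
  "irreducible_chain M J \<longleftrightarrow> (\<forall>i j. \<exists>t>0. transition_prob M J t i j > 0)"


section \<open>Path structure\<close>

definition levy_process ::
    "'w measure \<Rightarrow> (real \<Rightarrow> 'w measure) \<Rightarrow> (real \<Rightarrow> 'w \<Rightarrow> 'a::euclidean_space) \<Rightarrow> bool" where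
  "levy_process M F Y \<longleftrightarrow>
     adapted F borel Y \<and>
     (\<forall>\<omega>\<in>space M. cadlag_in euclidean (\<lambda>t. Y t \<omega>)) \<and>
     (AE \<omega> in M. Y 0 \<omega> = 0) \<and>
     (\<forall>s t. 0 \<le> s \<and> s \<le> t \<longrightarrow>
        prob_space.indep_set M (sets (F s))
          (sets (vimage_algebra (space M) (\<lambda>\<omega>. Y t \<omega> - Y s \<omega>) borel)) \<and>
        distr M borel (\<lambda>\<omega>. Y t \<omega> - Y s \<omega>) = distr M borel (Y (t - s)))"

text \<open>For a path \<open>f\<close> in a discrete space, \<open>left_value f t\<close> is the left limit \<open>f (t-)\<close>.\<close>

definition left_value :: "(real \<Rightarrow> 's) \<Rightarrow> real \<Rightarrow> 's" where
  "left_value f t = (THE l. \<forall>\<^sub>F u in at_left t. f u = l)"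

text \<open>\<open>jump_time f n\<close> is the \<open>n\<close>-th jump time, with \<open>jump_time f 0 = 0\<close>; it is \<open>\<infinity>\<close> if there
  are fewer than \<open>n\<close> jumps (which happens when the state space is a singleton).\<close>

primrec jump_time :: "(real \<Rightarrow> 's) \<Rightarrow> nat \<Rightarrow> ereal" where
  "jump_time f 0 = 0"
| "jump_time f (Suc n) =
     Inf {ereal t |t. jump_time f n < ereal t \<and> left_value f t \<noteq> f t}"

text \<open>The elementary stochastic integral over \<open>(0, t]\<close> of an integrand \<open>H\<close> that is constant on each
  interval \<open>(\<tau> n, \<tau> (n + 1)]\<close>, where \<open>0 = \<tau> 0 \<le> \<tau> 1 \<le> \<dots>\<close> increases to \<open>\<infinity>\<close>. The value of
  \<open>H\<close> on \<open>(\<tau> n, min (\<tau> (n + 1)) t]\<close> is read off at the right endpoint. Terms with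
  \<open>\<tau> n \<ge> t\<close> vanish, so that the series is a finite sum.\<close>

definition step_integral ::
    "(nat \<Rightarrow> ereal) \<Rightarrow> (real \<Rightarrow> real) \<Rightarrow> (real \<Rightarrow> 'a::real_normed_vector) \<Rightarrow> real \<Rightarrow> 'a" where
  "step_integral \<tau> H Y t =
     (\<Sum>n. H (real_of_ereal (min (\<tau> (Suc n)) (ereal t))) *\<^sub>R
        (Y (real_of_ereal (min (\<tau> (Suc n)) (ereal t))) - Y (real_of_ereal (min (\<tau> n) (ereal t)))))"

text \<open>The integrand \<open>s \<mapsto> 1{J (s-) = i}\<close> used below is constant on these intervals when \<open>\<tau>\<close>
  is the sequence of jump times.\<close>

lemma left_value_eqI:
  assumes "\<forall>\<^sub>F u in at_left t. f u = l"
  shows "left_value f t = l"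
  unfolding left_value_def
proof (rule the_equality)
  fix l' assume "\<forall>\<^sub>F u in at_left t. f u = l'"
  with assms have "\<forall>\<^sub>F u in at_left t. l = l'"
    by eventually_elim simp
  then show "l' = l" by simp
qed (fact assms)

lemma left_value_between_jumps:
  assumes cadlag: "cadlag_in (discrete_topology UNIV) f"
    and a: "jump_time f n = ereal a" "0 \<le> a"
    and s: "a < s" "ereal s \<le> jump_time f (Suc n)"
  shows "left_value f s = f a"
proof -
  have no_jump: "left_value f u = f u" if "a < u" "u < s" for u
  proof (rule ccontr)
    assume "left_value f u \<noteq> f u"
    then have "jump_time f (Suc n) \<le> ereal u"
      using that a by (auto intro!: Inf_lower)
    with s(2) have "ereal s \<le> ereal u" by (rule order_trans)
    with that show False by simp
  qed
  have right: "\<forall>\<^sub>F u in at_right t. f u = f t" if "0 \<le> t" for t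
    using cadlag that by (auto simp: cadlag_in_def limitin_def dest!: spec[of _ t] spec[of _ "{f t}"])
  have const: "f u = f a" if "a < u" "u < s" for u
  proof (rule ccontr)
    assume ne: "f u \<noteq> f a"
    define B where "B = {v. a < v \<and> v < s \<and> f v \<noteq> f a}"
    define v where "v = Inf B"
    have uB: "u \<in> B" using that ne by (simp add: B_def)
    have bdd: "bdd_below B" by (rule bdd_belowI[of _ a]) (auto simp: B_def)
    have vle: "v \<le> w" if "w \<in> B" for w
      unfolding v_def using that bdd by (rule cInf_lower)
    have v_s: "v < s" using vle[OF uB] that by simp
    obtain b where b: "a < b" "\<And>w. a < w \<Longrightarrow> w < b \<Longrightarrow> f w = f a"
      using right[OF a(2)] by (auto simp: eventually_at_right_field)
    have "b \<le> v"
      unfolding v_def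
    proof (rule cInf_greatest)
      fix w assume "w \<in> B" then show "b \<le> w" using b by (force simp: B_def)
    qed (use uB in blast)
    then have a_v: "a < v" using b(1) by simp
    have before: "f w = f a" if "a < w" "w < v" for w
      using vle[of w] that v_s by (force simp: B_def)
    have "\<forall>\<^sub>F w in at_left v. f w = f a"
      using a_v before by (auto simp: eventually_at_left_field)
    then have "left_value f v = f a" by (rule left_value_eqI)
    then have fv: "f v = f a" using no_jump[OF a_v v_s] by simp
    obtain c where c: "v < c" "\<And>w. v < w \<Longrightarrow> w < c \<Longrightarrow> f w = f v"
      using right[of v] a(2) a_v by (auto simp: eventually_at_right_field)
    have "c \<le> v"
      unfolding v_def
    proof (rule cInf_greatest)
      fix w assume w: "w \<in> B"
      then have "v \<noteq> w" using fv by (auto simp: B_def)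
      with vle[OF w] have "v < w" by simp
      then show "c \<le> w" using c(2)[of w] fv w by (force simp: B_def)
    qed (use uB in blast)
    with c(1) show False by simp
  qed
  have "\<forall>\<^sub>F w in at_left s. f w = f a"
    using s(1) const by (auto simp: eventually_at_left_field)
  then show ?thesis by (rule left_value_eqI)
qed

datatype 's source = Chain | Levy 's | Jump 's 's nat

text \<open>The decomposition of \<open>X\<close> into the Levy processes \<open>XL j\<close> and the jumps \<open>Z i j n\<close>, \<open>n \<ge> 1\<close>, at the
  jump times of \<open>J\<close>. The chain, the Levy processes and the \<open>Z i j n\<close> are jointly independent.\<close>

definition map_path_structure ::
    "'w measure \<Rightarrow> (real \<Rightarrow> 'w measure) \<Rightarrow> (real \<Rightarrow> 'w \<Rightarrow> 'a::euclidean_space) \<Rightarrow>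
     (real \<Rightarrow> 'w \<Rightarrow> 's::finite) \<Rightarrow> ('s \<Rightarrow> real \<Rightarrow> 'w \<Rightarrow> 'a) \<Rightarrow>
     ('s \<Rightarrow> 's \<Rightarrow> nat \<Rightarrow> 'w \<Rightarrow> 'a) \<Rightarrow> bool" where
  "map_path_structure M F X J XL Z \<longleftrightarrow>
     (\<forall>j. levy_process M F (XL j)) \<and>
     (\<forall>i j n. i \<noteq> j \<and> 1 \<le> n \<longrightarrow>
        Z i j n \<in> borel_measurable M \<and> distr M borel (Z i j n) = distr M borel (Z i j 1)) \<and>
     prob_space.indep_sets M
       (\<lambda>k. case k of
          Chain \<Rightarrow> process_sigma M (count_space UNIV) J
        | Levy j \<Rightarrow> process_sigma M borel (XL j)
        | Jump i j n \<Rightarrow> sets (vimage_algebra (space M) (Z i j n) borel))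
       ({Chain} \<union> range Levy \<union> {Jump i j n |i j n. i \<noteq> j \<and> 1 \<le> n}) \<and>
     (AE \<omega> in M. \<forall>t\<ge>0.
        let T = jump_time (\<lambda>u. J u \<omega>); JT = (\<lambda>n. J (real_of_ereal (T n)) \<omega>) in
        X t \<omega> =
          (\<Sum>i\<in>UNIV. step_integral T (\<lambda>s. of_bool (left_value (\<lambda>u. J u \<omega>) s = i)) (\<lambda>s. XL i s \<omega>) t) +
          (\<Sum>n. \<Sum>i\<in>UNIV. \<Sum>j\<in>UNIV - {i}.
             of_bool (JT n = i \<and> JT (Suc n) = j \<and> T (Suc n) \<le> ereal t) *\<^sub>R Z i j (Suc n) \<omega>))"


section \<open>Matrices\<close>

text \<open>The multiplication and the unit of the type class instance for \<open>real^'s^'s\<close> are componentwise,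
  so powers and exponentials with respect to the matrix product are defined separately, whereas
  \<open>A * B\<close> is the elementwise product of \<open>A\<close> and \<open>B\<close>, and \<open>1 :: real^'s\<close> is the
  vector of ones.\<close>

primrec matrix_power :: "real^'s^'s \<Rightarrow> nat \<Rightarrow> real^'s^'s" where
  "matrix_power A 0 = mat 1"
| "matrix_power A (Suc n) = A ** matrix_power A n"

definition matrix_exp :: "real^'s^'s \<Rightarrow> real^'s^'s" where
  "matrix_exp A = (\<Sum>n. (1 / fact n) *\<^sub>R matrix_power A n)"

definition diag_matrix :: "('s \<Rightarrow> real) \<Rightarrow> real^'s^'s" where
  "diag_matrix a = (\<chi> i j. if i = j then a i else 0)"

text \<open>Jump moments of order \<open>p\<close>, with the convention \<open>Z j j 1 = 0\<close>. Below they only occur multiplied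
  elementwise with the intensity matrix, so that entries without a transition contribute \<open>0\<close>
  whatever the moment.\<close>

definition jump_moment ::
    "'w measure \<Rightarrow> ('s \<Rightarrow> 's \<Rightarrow> nat \<Rightarrow> 'w \<Rightarrow> real) \<Rightarrow> nat \<Rightarrow> real^'s^'s" where
  "jump_moment M Z p = (\<chi> i j. if i = j then 0 else integral\<^sup>L M (\<lambda>\<omega>. (Z i j 1 \<omega>) ^ p))"

definition eps_X ::
    "'w measure \<Rightarrow> real^'s^'s \<Rightarrow> ('s \<Rightarrow> real \<Rightarrow> 'w \<Rightarrow> real) \<Rightarrow>
     ('s \<Rightarrow> 's \<Rightarrow> nat \<Rightarrow> 'w \<Rightarrow> real) \<Rightarrow> real^'s^'s" where
  "eps_X M Q XL Z =
     diag_matrix (\<lambda>j. integral\<^sup>L M (XL j 1)) + transpose Q * transpose (jump_moment M Z 1)"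

definition eps_XX ::
    "'w measure \<Rightarrow> real^'s^'s \<Rightarrow> ('s \<Rightarrow> real \<Rightarrow> 'w \<Rightarrow> real) \<Rightarrow>
     ('s \<Rightarrow> 's \<Rightarrow> nat \<Rightarrow> 'w \<Rightarrow> real) \<Rightarrow> real^'s^'s" where
  "eps_XX M Q XL Z =
     diag_matrix (\<lambda>j. prob_space.variance M (XL j 1)) + transpose Q * transpose (jump_moment M Z 2)"

end

theory Submission
  imports Defs
begin

text \<open>For \<open>p = 0, 1, 2\<close> let \<open>M\<^sub>p (t)\<close> be the matrix whose entry in row \<open>k\<close> and column \<open>l\<close> is the
  expectation of \<open>(X t)^p\<close> on the event \<open>J t = k\<close>, given \<open>J 0 = l\<close>. Writing
  \<open>X (s + t) = X s + (X (s + t) - X s)\<close> and conditioning on the past up to time \<open>s\<close>, the Markov additive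
  property turns the binomial expansion of the powers of \<open>X (s + t)\<close> into (\<open>moment_add\<close>)
  \<open>M\<^sub>0 (s + t) = M\<^sub>0 (t) M\<^sub>0 (s)\<close>,
  \<open>M\<^sub>1 (s + t) = M\<^sub>0 (t) M\<^sub>1 (s) + M\<^sub>1 (t) M\<^sub>0 (s)\<close> and
  \<open>M\<^sub>2 (s + t) = M\<^sub>0 (t) M\<^sub>2 (s) + 2 M\<^sub>1 (t) M\<^sub>1 (s) + M\<^sub>2 (t) M\<^sub>0 (s)\<close>.
  So the triple \<open>(M\<^sub>0, M\<^sub>1, M\<^sub>2)\<close> is an orbit of a semigroup of linear maps on a finite-dimensional space. Such
  an orbit is differentiable as soon as the semigroup has a derivative at \<open>0\<close>
  (\<open>semigroup_has_vector_derivative\<close>), and here that derivative is given by the transposed intensity matrix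
  and the matrices \<open>eps_X\<close> and \<open>eps_XX\<close>. The resulting triangular linear differential equation is solved by
  variation of constants (\<open>variation_of_constants\<close>), which gives the formula for \<open>M\<^sub>2\<close>. The
  variance formula follows by summing over the final state, because \<open>matrix_exp\<close> of a multiple of the
  transposed intensity matrix preserves the sum of the entries of a vector.

  The probabilistic part is the derivative at \<open>0\<close> (\<open>diagonal_rate\<close>, \<open>offdiagonal_rate\<close>). Split according
  to the number of jumps of \<open>J\<close> up to a small time \<open>h\<close>. Without a jump, \<open>X h\<close> is the value of the Levy
  process of the initial state. With one jump, which has probability of order \<open>h\<close>, \<open>X h\<close> is one
  variable \<open>Z\<close> plus Levy increments whose conditional second moment is of order \<open>h\<close>. The event of two or
  more jumps has probability of order \<open>h\<^sup>2\<close>, and the second moment of \<open>X h\<close> on it is of order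
  \<open>h\<^sup>2\<close> as well. This needs bounds for second moments of the two parts of the decomposition of \<open>X\<close>, which
  involve the Levy processes at the random jump times. To work with deterministic times only, the path of
  \<open>J\<close> is sampled on the grid \<open>t m / n\<close>: for each path, once \<open>n\<close> is large, the changes on the grid reproduce the
  jumps (\<open>grid_jump_sum_eventually\<close>, \<open>grid_levy_sum_tendsto\<close>), so that the bounds follow from
  independence on the grid and Fatou's lemma.

  The hypothesis speaks of \<open>X 1\<close> only. The Levy processes and the variables \<open>Z\<close> inherit finite second moments
  from it, because up to time \<open>1\<close> the chain makes no jump, or exactly one jump along a given transition of
  positive rate, with positive probability (\<open>XL_square\<close>, \<open>Z_square\<close>).\<close>

section \<open>Jump times of cadlag paths in a discrete space\<close>

lemma cadlag_discrete_right:
  assumes "cadlag_in (discrete_topology UNIV) f" "0 \<le> a"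
  obtains b where "a < b" "\<And>u. a \<le> u \<Longrightarrow> u < b \<Longrightarrow> f u = f a"
proof -
  have "\<forall>\<^sub>F u in at_right a. f u = f a"
  proof -
    have "limitin (discrete_topology UNIV) f (f a) (at_right a)"
      using assms by (simp add: cadlag_in_def)
    then have "a \<in> UNIV \<and> (\<forall>U. f a \<in> U \<longrightarrow> (\<forall>\<^sub>F u in at_right a. f u \<in> U))"
      by (simp add: limitin_def)
    then have "\<forall>\<^sub>F u in at_right a. f u \<in> {f a}" by blast
    then show ?thesis by simp
  qed
  then obtain b where "a < b" "\<And>u. a < u \<Longrightarrow> u < b \<Longrightarrow> f u = f a"
    unfolding eventually_at_right_field by blast
  then show ?thesis using that by (metis order_le_less)
qed

lemma cadlag_discrete_left:
  assumes "cadlag_in (discrete_topology UNIV) f" "0 < a"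
  obtains b l where "b < a" "\<And>u. b < u \<Longrightarrow> u < a \<Longrightarrow> f u = l"
proof -
  obtain l where "limitin (discrete_topology UNIV) f l (at_left a)"
    using assms by (auto simp: cadlag_in_def)
  then have "\<forall>\<^sub>F u in at_left a. f u = l"
  proof -
    assume "limitin (discrete_topology UNIV) f l (at_left a)"
    then have "\<forall>U. l \<in> U \<longrightarrow> (\<forall>\<^sub>F u in at_left a. f u \<in> U)"
      by (simp add: limitin_def)
    then have "\<forall>\<^sub>F u in at_left a. f u \<in> {l}" by blast
    then show ?thesis by simp
  qed
  then show ?thesis using that unfolding eventually_at_left_field by blast
qed

lemma left_value_const:
  assumes "a < b" "\<And>u. a < u \<Longrightarrow> u < b \<Longrightarrow> f u = l"
  shows "left_value f b = l"
  using assms by (intro left_value_eqI) (unfold eventually_at_left_field, blast)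

lemma jump_time_Suc_gt:
  assumes cad: "cadlag_in (discrete_topology UNIV) f"
    and a: "jump_time f n = ereal a" "0 \<le> a"
  obtains b where "a < b" "ereal b \<le> jump_time f (Suc n)"
proof -
  obtain b where b: "a < b" "\<And>u. a \<le> u \<Longrightarrow> u < b \<Longrightarrow> f u = f a"
    using cadlag_discrete_right[OF cad a(2)] by blast
  have "ereal b \<le> jump_time f (Suc n)"
    unfolding jump_time.simps
  proof (rule Inf_greatest, clarsimp simp: a(1))
    fix s assume s: "a < s" "left_value f s \<noteq> f s"
    show "b \<le> s"
    proof (rule ccontr)
      assume "\<not> b \<le> s"
      then have "s < b" by simp
      have "left_value f s = f a"
        using s(1) \<open>s < b\<close> by (intro left_value_const[of a s] b(2)) simp_all
      moreover have "f s = f a" using s(1) \<open>s < b\<close> by (intro b(2)) simp_all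
      ultimately show False using s(2) by simp
    qed
  qed
  with b that show ?thesis by blast
qed

lemma jump_time_nonneg: "0 \<le> jump_time f n"
proof (induction n)
  case (Suc n)
  then show ?case
    by (auto intro!: Inf_greatest) (metis less_imp_le order_trans ereal_less_eq(5))
qed simp

text \<open>The infimum that defines the next jump time is attained: the path is constant on some interval to the
  right of every time, so the jumps after a given time cannot accumulate at it.\<close>

lemma jump_time_jumps:
  assumes cad: "cadlag_in (discrete_topology UNIV) f"
    and a: "jump_time f n = ereal a" and b: "jump_time f (Suc n) = ereal b"
  shows "a < b" "left_value f b \<noteq> f b"
proof -
  have a0: "0 \<le> a" using jump_time_nonneg[of f n] a by simp
  show ab: "a < b" using jump_time_Suc_gt[OF cad a a0] b by force
  show "left_value f b \<noteq> f b"
  proof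
    assume nj: "left_value f b = f b"
    obtain c where c: "b < c" "\<And>u. b \<le> u \<Longrightarrow> u < c \<Longrightarrow> f u = f b"
      using cadlag_discrete_right[OF cad] a0 ab by (metis less_imp_le order_trans)
    have "ereal c \<le> jump_time f (Suc n)"
      unfolding jump_time.simps
    proof (rule Inf_greatest, clarsimp simp: a(1))
      fix s assume s: "a < s" "left_value f s \<noteq> f s"
      then have "jump_time f (Suc n) \<le> ereal s"
        using a by (auto intro!: Inf_lower)
      then have "b \<le> s" using b by simp
      with s nj have bs: "b < s" by (metis order_le_less)
      show "c \<le> s"
      proof (rule ccontr)
        assume "\<not> c \<le> s"
        then have "s < c" by simp
        have "left_value f s = f b"
          using bs \<open>s < c\<close> by (intro left_value_const[of b s] c(2)) simp_all
        moreover have "f s = f b" using bs \<open>s < c\<close> by (intro c(2)) simp_all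
        ultimately show False using s(2) by simp
      qed
    qed
    with b c show False by simp
  qed
qed

lemma const_between_jumps:
  assumes cad: "cadlag_in (discrete_topology UNIV) f"
    and a: "jump_time f n = ereal a"
    and u: "a \<le> u" "ereal u < jump_time f (Suc n)"
  shows "f u = f a"
proof (cases "u = a")
  case False
  have a0: "0 \<le> a" using jump_time_nonneg[of f n] a by simp
  have "left_value f u = f u"
  proof (rule ccontr)
    assume "left_value f u \<noteq> f u"
    then have "jump_time f (Suc n) \<le> ereal u"
      using u False a by (auto intro!: Inf_lower)
    with u show False by simp
  qed
  then show ?thesis
    using left_value_between_jumps[OF cad a a0, of u] u False by simp
qed simp

lemma jump_time_mono: "n \<le> m \<Longrightarrow> jump_time f n \<le> jump_time f m"
proof (rule lift_Suc_mono_le[of "jump_time f"])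
  show "jump_time f n \<le> jump_time f (Suc n)" for n
    by (auto intro!: Inf_greatest)
qed

text \<open>If all jump times were at most \<open>t\<close>, they would increase strictly to a limit. The path has a left limit
  there, hence is constant just before it and has no jump there.\<close>

lemma jump_time_unbounded:
  assumes cad: "cadlag_in (discrete_topology UNIV) f"
  obtains n where "jump_time f n > ereal t"
proof (rule ccontr)
  assume "\<not> thesis"
  then have le: "jump_time f n \<le> ereal t" for n using that by (meson not_le_imp_less)
  define a where "a n = real_of_ereal (jump_time f n)" for n
  have a: "jump_time f n = ereal (a n)" for n
    using le[of n] jump_time_nonneg[of f n] unfolding a_def
    by (cases "jump_time f n") auto
  have mono: "a n < a (Suc n)" for n
    using jump_time_jumps(1)[OF cad a a] .
  have inc: "incseq a" using mono by (intro incseq_SucI) (auto intro: less_imp_le)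
  have "\<And>n. a n \<le> t" using le a by simp
  then obtain L where L: "a \<longlonglongrightarrow> L" "\<And>n. a n \<le> L"
    using incseq_convergent[OF inc] by metis
  have lt: "a n < L" for n using mono[of n] L(2)[of "Suc n"] by simp
  have "0 \<le> a 0" using jump_time_nonneg[of f 0] a[of 0] by simp
  with lt[of 0] have "0 < L" by simp
  from cadlag_discrete_left[OF cad this] obtain c l where c: "c < L" "\<And>u. c < u \<Longrightarrow> u < L \<Longrightarrow> f u = l"
    by blast
  have "\<forall>\<^sub>F n in sequentially. c < a n" using L(1) c(1) by (rule order_tendstoD)
  then obtain n where n: "c < a n" by (auto simp: eventually_sequentially)
  have "left_value f (a (Suc n)) = l"
    using n lt[of "Suc n"] mono[of n] c by (intro left_value_const[of "a n"]) auto
  moreover have "f (a (Suc n)) = l"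
    using n lt[of "Suc n"] mono[of n] c by auto
  ultimately show False using jump_time_jumps(2)[OF cad a a, of n] by simp
qed

text \<open>The jumps \<open>a 1 < \<dots> < a r\<close> up to time \<open>t\<close> cut \<open>[0, t]\<close> into intervals of constancy; \<open>a (r + 1)\<close> is
  set to \<open>t\<close>, so that consecutive values of \<open>a\<close> bound all of them.\<close>

lemma jump_partition:
  assumes cad: "cadlag_in (discrete_topology UNIV) f" and t: "0 \<le> t"
  obtains r a where
    "a 0 = 0" "\<And>l. l \<le> r \<Longrightarrow> jump_time f l = ereal (a l)"
    "\<And>l. l < r \<Longrightarrow> a l < a (Suc l)" "a r \<le> t" "a (Suc r) = t" "ereal t < jump_time f (Suc r)"
    "\<And>l u. l < r \<Longrightarrow> a l \<le> u \<Longrightarrow> u < a (Suc l) \<Longrightarrow> f u = f (a l)"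
    "\<And>u. a r \<le> u \<Longrightarrow> u \<le> t \<Longrightarrow> f u = f (a r)"
    "\<And>l. l < r \<Longrightarrow> f (a l) \<noteq> f (a (Suc l))"
proof -
  define k where "k = (LEAST n. jump_time f n > ereal t)"
  have k: "jump_time f k > ereal t"
    unfolding k_def using jump_time_unbounded[OF cad, of t] by (metis LeastI)
  have least: "jump_time f n \<le> ereal t" if "n < k" for n
    using not_less_Least[of n "\<lambda>n. jump_time f n > ereal t"] that unfolding k_def by simp
  have "k \<noteq> 0" using k t by (metis jump_time.simps(1) not_less ereal_less_eq(5) zero_ereal_def)
  then obtain r where r: "k = Suc r" by (cases k) auto
  define a where "a l = (if l \<le> r then real_of_ereal (jump_time f l) else t)" for l
  have a: "jump_time f l = ereal (a l)" if "l \<le> r" for l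
    using that least[of l] jump_time_nonneg[of f l] unfolding a_def r
    by (cases "jump_time f l") auto
  have neq: "f (a l) \<noteq> f (a (Suc l))" if "l < r" for l
  proof -
    have "left_value f (a (Suc l)) = f (a l)"
      using that a[of l] a[of "Suc l"] jump_time_jumps(1)[OF cad a[of l] a[of "Suc l"]] jump_time_nonneg[of f l]
      by (intro left_value_between_jumps[OF cad, of l]) auto
    then show ?thesis using jump_time_jumps(2)[OF cad a[of l] a[of "Suc l"]] that by simp
  qed
  show ?thesis
  proof (rule that[of a r])
    show "a 0 = 0" by (simp add: a_def)
    show "a l < a (Suc l)" if "l < r" for l
      using that jump_time_jumps(1)[OF cad a[of l] a[of "Suc l"]] by simp
    show "a r \<le> t" using least[of r] a[of r] r by simp
    show "a (Suc r) = t" by (simp add: a_def)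
    show "f u = f (a l)" if "l < r" "a l \<le> u" "u < a (Suc l)" for l u
      using that a[of "Suc l"] by (intro const_between_jumps[OF cad a[of l]]) auto
    show "f u = f (a r)" if "a r \<le> u" "u \<le> t" for u
      using that k[unfolded r] by (intro const_between_jumps[OF cad a[of r]])
          (auto simp del: jump_time.simps intro: le_less_trans[of _ "ereal t"])
  qed (use a neq k r in auto)
qed

section \<open>Sampling a path on a grid\<close>

definition grid :: "real \<Rightarrow> nat \<Rightarrow> nat \<Rightarrow> real" where
  "grid t n m = t * real m / real n"

definition grid_change :: "(real \<Rightarrow> 's) \<Rightarrow> real \<Rightarrow> nat \<Rightarrow> nat \<Rightarrow> bool" where
  "grid_change f t n m \<longleftrightarrow> f (grid t n m) \<noteq> f (grid t n (Suc m))"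

text \<open>This numbers the changes on the grid as \<open>jump_time\<close> numbers the jumps.\<close>

definition changes_before :: "(real \<Rightarrow> 's) \<Rightarrow> real \<Rightarrow> nat \<Rightarrow> nat \<Rightarrow> nat" where
  "changes_before f t n m = card {l. l < m \<and> grid_change f t n l}"

definition grid_jump_sum :: "(real \<Rightarrow> 's) \<Rightarrow> real \<Rightarrow> nat \<Rightarrow> ('s \<Rightarrow> 's \<Rightarrow> nat \<Rightarrow> real) \<Rightarrow> real" where
  "grid_jump_sum f t n \<phi> = (\<Sum>m<n. if grid_change f t n m
     then \<phi> (f (grid t n m)) (f (grid t n (Suc m))) (Suc (changes_before f t n m)) else 0)"

definition grid_levy_sum :: "(real \<Rightarrow> 's) \<Rightarrow> real \<Rightarrow> nat \<Rightarrow> ('s \<Rightarrow> real \<Rightarrow> real) \<Rightarrow> real" where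
  "grid_levy_sum f t n Y = (\<Sum>m<n. Y (f (grid t n m)) (grid t n (Suc m)) - Y (f (grid t n m)) (grid t n m))"

text \<open>The sum over the jumps up to time \<open>t\<close>, written exactly as in the decomposition of \<open>X\<close>.\<close>

definition jump_sum :: "(real \<Rightarrow> 's::finite) \<Rightarrow> real \<Rightarrow> ('s \<Rightarrow> 's \<Rightarrow> nat \<Rightarrow> real) \<Rightarrow> real" where
  "jump_sum f t \<phi> = (let T = jump_time f; JT = (\<lambda>n. f (real_of_ereal (T n))) in
     \<Sum>n. \<Sum>i\<in>UNIV. \<Sum>j\<in>UNIV - {i}.
       of_bool (JT n = i \<and> JT (Suc n) = j \<and> T (Suc n) \<le> ereal t) *\<^sub>R \<phi> i j (Suc n))"

definition levy_integral :: "(real \<Rightarrow> 's::finite) \<Rightarrow> real \<Rightarrow> ('s \<Rightarrow> real \<Rightarrow> real) \<Rightarrow> real" where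
  "levy_integral f t Y =
     (\<Sum>i\<in>UNIV. step_integral (jump_time f) (\<lambda>s. of_bool (left_value f s = i)) (Y i) t)"

lemma grid_simps [simp]: "grid t n 0 = 0" "n > 0 \<Longrightarrow> grid t n n = t"
  by (auto simp: grid_def)

lemma grid_nonneg: "0 \<le> t \<Longrightarrow> 0 \<le> grid t n m"
  by (auto simp: grid_def)

lemma grid_Suc: "grid t n (Suc m) = grid t n m + t / real n"
  by (simp add: grid_def add_divide_distrib distrib_left)

text \<open>The grid indices from \<open>c l\<close> up to \<open>c (l + 1)\<close> are those at which \<open>f\<close> has the value that it takes between its
  jumps \<open>a l\<close> and \<open>a (l + 1)\<close>. The last block has an extra condition, since it contains the index \<open>n\<close> of the
  end point.\<close>

definition grid_blocks ::
    "(real \<Rightarrow> 's) \<Rightarrow> real \<Rightarrow> (nat \<Rightarrow> real) \<Rightarrow> nat \<Rightarrow> nat \<Rightarrow> (nat \<Rightarrow> nat) \<Rightarrow> bool" where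
  "grid_blocks f t a r n c \<longleftrightarrow> c 0 = 0 \<and> c (Suc r) = n \<and> c r \<le> n \<and>
     (\<forall>l<r. c l < c (Suc l)) \<and>
     (\<forall>l m. l \<le> r \<longrightarrow> c l \<le> m \<longrightarrow> m < c (Suc l) \<longrightarrow> f (grid t n m) = f (a l)) \<and>
     (\<forall>m. c r \<le> m \<longrightarrow> m \<le> n \<longrightarrow> f (grid t n m) = f (a r))"

text \<open>Once the mesh is smaller than every gap between successive jumps, each interval of constancy contains a
  grid point, and the first one in it is found by rounding up the jump time.\<close>

lemma grid_indices:
  fixes f :: "real \<Rightarrow> 's"
  assumes t: "0 < t" and a0: "a 0 = 0" and inc: "\<And>l. l < r \<Longrightarrow> a l < a (Suc l)"
    and ar: "a r \<le> t" "a (Suc r) = t"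
    and const: "\<And>l u. l < r \<Longrightarrow> a l \<le> u \<Longrightarrow> u < a (Suc l) \<Longrightarrow> f u = f (a l)"
    and last: "\<And>u. a r \<le> u \<Longrightarrow> u \<le> t \<Longrightarrow> f u = f (a r)"
  shows "\<forall>\<^sub>F n in sequentially. grid_blocks f t a r n (\<lambda>l. nat \<lceil>a l * real n / t\<rceil>)"
proof -
  have nonneg: "0 \<le> a l" if "l \<le> r" for l
    using that
  proof (induction l)
    case (Suc l) then show ?case using inc[of l] by simp
  qed (simp add: a0)
  have lim: "(\<lambda>n. t / real n) \<longlonglongrightarrow> 0"
    using tendsto_mult[OF tendsto_const[of t] lim_inverse_n] by (simp add: divide_inverse)
  have "\<forall>\<^sub>F n in sequentially. \<forall>l\<in>{..<r}. t / real n < a (Suc l) - a l"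
  proof (subst eventually_ball_finite_distrib, simp, intro ballI)
    fix l assume "l \<in> {..<r}"
    then have "0 < a (Suc l) - a l" using inc[of l] by simp
    with lim show "\<forall>\<^sub>F n in sequentially. t / real n < a (Suc l) - a l" by (rule order_tendstoD)
  qed
  then show ?thesis using eventually_gt_at_top[of 0]
  proof eventually_elim
    case (elim n)
    define c where "c l = nat \<lceil>a l * real n / t\<rceil>" for l
    have n: "0 < n" by fact
    have le: "c l \<le> m \<longleftrightarrow> a l \<le> grid t n m" for l m
    proof -
      have "c l \<le> m \<longleftrightarrow> a l * real n / t \<le> real m"
        unfolding c_def by (simp add: nat_le_iff ceiling_le_iff)
      also have "\<dots> \<longleftrightarrow> a l \<le> grid t n m"
        using t n by (simp add: grid_def field_simps)
      finally show ?thesis .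
    qed
    have c0: "c 0 = 0" by (simp add: c_def a0)
    have cn: "c (Suc r) = n" using t by (simp add: c_def ar)
    have crn: "c r \<le> n" using le[of r n] n ar by simp
    have cinc: "c l < c (Suc l)" if l: "l < r" for l
    proof -
      have "a l * real n / t + 1 < a (Suc l) * real n / t"
      proof -
        have "t / real n < a (Suc l) - a l" using elim(1) l by simp
        then have "t < (a (Suc l) - a l) * real n" using n by (simp add: divide_less_eq)
        then have "1 < (a (Suc l) - a l) * real n / t" using t by simp
        then show ?thesis by (simp add: left_diff_distrib diff_divide_distrib)
      qed
      then have "\<lceil>a l * real n / t\<rceil> < \<lceil>a (Suc l) * real n / t\<rceil>" by linarith
      moreover have "0 \<le> \<lceil>a l * real n / t\<rceil>"
      proof -
        have "0 \<le> a l * real n / t" using nonneg[of l] l t by simp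
        then show ?thesis by linarith
      qed
      ultimately show ?thesis unfolding c_def by (subst nat_less_eq_zless)
    qed
    have last': "f (grid t n m) = f (a r)" if "c r \<le> m" "m \<le> n" for m
    proof (rule last)
      show "a r \<le> grid t n m" using le that by blast
      have "t * real m \<le> t * real n" using that t by simp
      then show "grid t n m \<le> t" using n by (simp add: grid_def divide_le_eq)
    qed
    have val: "f (grid t n m) = f (a l)" if "l \<le> r" "c l \<le> m" "m < c (Suc l)" for l m
    proof (cases "l = r")
      case True
      then show ?thesis using last' that cn by simp
    next
      case False
      then have "l < r" using that by simp
      then show ?thesis using that le[of l m] le[of "Suc l" m] by (intro const) auto
    qed
    show ?case
      using c0 cn crn cinc last' val unfolding grid_blocks_def c_def by blast
  qed
qed

lemma index_block:
  fixes c :: "nat \<Rightarrow> nat"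
  assumes "c 0 = 0" "m < c (Suc r)"
  obtains l where "l \<le> r" "c l \<le> m" "m < c (Suc l)"
  using assms
proof (induction r arbitrary: thesis)
  case (Suc r)
  show ?case
  proof (cases "m < c (Suc r)")
    case True
    then show ?thesis using Suc.IH Suc.prems le_SucI by metis
  next
    case False
    then show ?thesis using Suc.prems by (intro Suc.prems(1)[of "Suc r"]) auto
  qed
qed auto

lemma sum_blocks:
  fixes c :: "nat \<Rightarrow> nat" and g :: "nat \<Rightarrow> real"
  assumes "c 0 = 0" "\<And>l. l \<le> r \<Longrightarrow> c l \<le> c (Suc l)"
  shows "(\<Sum>m<c (Suc r). g m) = (\<Sum>l\<le>r. \<Sum>m=c l..<c (Suc l). g m)"
  using assms(2)
proof (induction r)
  case 0 then show ?case by (simp add: assms(1) lessThan_atLeast0)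
next
  case (Suc r)
  have "(\<Sum>m<c (Suc (Suc r)). g m) = (\<Sum>m<c (Suc r). g m) + (\<Sum>m=c (Suc r)..<c (Suc (Suc r)). g m)"
    using Suc.prems[of "Suc r"] by (simp add: lessThan_atLeast0 sum.atLeastLessThan_concat)
  then show ?case using Suc by simp
qed

text \<open>A change occurs exactly from the last index of a block to the first index of the next one, so changes and
  block boundaries correspond to each other in order.\<close>

lemma grid_jump_sum_blocks:
  fixes f :: "real \<Rightarrow> 's" and c :: "nat \<Rightarrow> nat"
  assumes c: "c 0 = 0" "c (Suc r) = n" "c r \<le> n" "\<And>l. l < r \<Longrightarrow> c l < c (Suc l)"
    and val: "\<And>l m. l \<le> r \<Longrightarrow> c l \<le> m \<Longrightarrow> m < c (Suc l) \<Longrightarrow> f (grid t n m) = x l"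
    and last: "\<And>m. c r \<le> m \<Longrightarrow> m \<le> n \<Longrightarrow> f (grid t n m) = x r"
    and neq: "\<And>l. l < r \<Longrightarrow> x l \<noteq> x (Suc l)"
  shows "grid_jump_sum f t n \<phi> = (\<Sum>l<r. \<phi> (x l) (x (Suc l)) (Suc l))"
proof -
  define h where "h l = c (Suc l) - 1" for l
  have mono: "c l < c l'" if "l < l'" "l' \<le> r" for l l'
    using that
  proof (induction l')
    case (Suc l') then show ?case using c(4)[of l'] by (cases "l = l'") auto
  qed simp
  have hSuc: "Suc (h l) = c (Suc l)" if "l < r" for l
    using c(4)[OF that] unfolding h_def by simp
  have hval: "f (grid t n (h l)) = x l" if "l < r" for l
    using that c(4)[OF that] by (intro val) (auto simp: h_def)
  have hval2: "f (grid t n (c (Suc l))) = x (Suc l)" if "l < r" for l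
  proof (cases "Suc l = r")
    case True then show ?thesis using last[of "c r"] c(3) by simp
  next
    case False then show ?thesis using that c(4)[of "Suc l"] by (intro val) auto
  qed
  have hmono: "h l < h l'" if "l < l'" "l' < r" for l l'
    using mono[of "Suc l" "Suc l'"] that c(4)[of l] unfolding h_def by simp
  have hiff: "h l < h l' \<longleftrightarrow> l < l'" if "l < r" "l' < r" for l l'
    using hmono that by (metis less_asym less_linear less_irrefl)
  have hn: "h l < n" if "l < r" for l
    using hSuc[OF that] mono[of "Suc l" r] c(3) that by (cases "Suc l = r") auto
  have nochange: "\<not> grid_change f t n m" if m: "m < n" "m \<notin> h ` {..<r}" for m
  proof -
    obtain l where l: "l \<le> r" "c l \<le> m" "m < c (Suc l)"
      using index_block[of c m r] c m by auto
    show ?thesis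
    proof (cases "l = r")
      case True
      then show ?thesis using l m last[of m] last[of "Suc m"] unfolding grid_change_def by simp
    next
      case False
      then have "m \<noteq> h l" using m l by auto
      then have "Suc m < c (Suc l)" using l False hSuc[of l] by simp
      then show ?thesis using l val[of l m] val[of l "Suc m"] unfolding grid_change_def by simp
    qed
  qed
  have change: "grid_change f t n (h l)" if "l < r" for l
    using hval[OF that] hval2[OF that] hSuc[OF that] neq[OF that] unfolding grid_change_def by simp
  have before: "changes_before f t n (h l) = l" if "l < r" for l
  proof -
    have "{k. k < h l \<and> grid_change f t n k} = h ` {..<l}"
    proof (intro set_eqI iffI)
      fix k assume k: "k \<in> {k. k < h l \<and> grid_change f t n k}"
      then have "k \<in> h ` {..<r}" using nochange[of k] hn[OF that] by force
      then show "k \<in> h ` {..<l}" using k hiff that by auto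
    next
      fix k assume "k \<in> h ` {..<l}"
      then show "k \<in> {k. k < h l \<and> grid_change f t n k}" using change hmono that by force
    qed
    moreover have "inj_on h {..<l}"
      using hiff that by (intro inj_onI) (metis lessThan_iff less_irrefl linorder_neqE_nat order.strict_trans)
    ultimately show ?thesis unfolding changes_before_def by (simp add: card_image)
  qed
  have inj: "inj_on h {..<r}"
    using hiff by (intro inj_onI) (metis lessThan_iff less_irrefl linorder_neqE_nat)
  have "grid_jump_sum f t n \<phi> = (\<Sum>m\<in>h ` {..<r}. if grid_change f t n m
     then \<phi> (f (grid t n m)) (f (grid t n (Suc m))) (Suc (changes_before f t n m)) else 0)"
    unfolding grid_jump_sum_def
    by (rule sum.mono_neutral_right) (use hn nochange in auto)
  also have "\<dots> = (\<Sum>l<r. \<phi> (x l) (x (Suc l)) (Suc l))"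
    using inj by (simp add: sum.reindex change hval hSuc hval2 before)
  finally show ?thesis .
qed

lemma jump_sum_blocks:
  fixes f :: "real \<Rightarrow> 's::finite"
  assumes T: "\<And>l. l \<le> r \<Longrightarrow> jump_time f l = ereal (a l)" and inc: "\<And>l. l < r \<Longrightarrow> a l < a (Suc l)"
    and ar: "a r \<le> t" and last: "ereal t < jump_time f (Suc r)"
    and neq: "\<And>l. l < r \<Longrightarrow> f (a l) \<noteq> f (a (Suc l))"
  shows "jump_sum f t \<phi> = (\<Sum>l<r. \<phi> (f (a l)) (f (a (Suc l))) (Suc l))"
proof -
  define g where "g n = (\<Sum>i\<in>UNIV. \<Sum>j\<in>UNIV - {i}.
       of_bool (f (real_of_ereal (jump_time f n)) = i \<and> f (real_of_ereal (jump_time f (Suc n))) = j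
          \<and> jump_time f (Suc n) \<le> ereal t) *\<^sub>R \<phi> i j (Suc n))" for n
  have "jump_sum f t \<phi> = suminf g"
    unfolding jump_sum_def g_def Let_def ..
  also have "\<dots> = (\<Sum>n<r. g n)"
  proof (rule suminf_finite)
    fix n assume "n \<notin> {..<r}"
    then have "jump_time f (Suc r) \<le> jump_time f (Suc n)" by (intro jump_time_mono) simp
    with last have "\<not> jump_time f (Suc n) \<le> ereal t" by (metis leD order_less_le_trans)
    then show "g n = 0" unfolding g_def by (simp del: jump_time.simps)
  qed simp
  also have "\<dots> = (\<Sum>l<r. \<phi> (f (a l)) (f (a (Suc l))) (Suc l))"
  proof (rule sum.cong)
    fix l assume l: "l \<in> {..<r}"
    have am: "a k \<le> t" if "k \<le> r" for k
    proof -
      have "ereal (a k) \<le> ereal (a r)" using jump_time_mono[OF that, of f] T that by simp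
      then show ?thesis using ar by simp
    qed
    have "g l = (\<Sum>i\<in>UNIV. \<Sum>j\<in>UNIV - {i}. if f (a l) = i \<and> f (a (Suc l)) = j then \<phi> i j (Suc l) else 0)"
      unfolding g_def using l am[of "Suc l"]
      by (intro sum.cong refl) (simp add: T del: jump_time.simps)
    also have "\<dots> = (\<Sum>i\<in>UNIV. if f (a l) = i then \<phi> (f (a l)) (f (a (Suc l))) (Suc l) else 0)"
    proof (intro sum.cong refl)
      fix i
      show "(\<Sum>j\<in>UNIV - {i}. if f (a l) = i \<and> f (a (Suc l)) = j then \<phi> i j (Suc l) else 0) =
            (if f (a l) = i then \<phi> (f (a l)) (f (a (Suc l))) (Suc l) else 0)"
        using neq[of l] l by (cases "f (a l) = i") (simp_all add: sum.delta')
    qed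
    also have "\<dots> = \<phi> (f (a l)) (f (a (Suc l))) (Suc l)"
      by (simp add: sum.delta')
    finally show "g l = \<phi> (f (a l)) (f (a (Suc l))) (Suc l)" .
  qed simp
  finally show ?thesis .
qed

lemma grid_jump_sum_eventually:
  fixes f :: "real \<Rightarrow> 's::finite"
  assumes cad: "cadlag_in (discrete_topology UNIV) f" and t: "0 < t"
  shows "\<forall>\<^sub>F n in sequentially. \<forall>\<phi>. grid_jump_sum f t n \<phi> = jump_sum f t \<phi>"
proof -
  obtain r a where p: "a 0 = 0" "\<And>l. l \<le> r \<Longrightarrow> jump_time f l = ereal (a l)"
    "\<And>l. l < r \<Longrightarrow> a l < a (Suc l)" "a r \<le> t" "a (Suc r) = t" "ereal t < jump_time f (Suc r)"
    "\<And>l u. l < r \<Longrightarrow> a l \<le> u \<Longrightarrow> u < a (Suc l) \<Longrightarrow> f u = f (a l)"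
    "\<And>u. a r \<le> u \<Longrightarrow> u \<le> t \<Longrightarrow> f u = f (a r)"
    "\<And>l. l < r \<Longrightarrow> f (a l) \<noteq> f (a (Suc l))"
    by (rule jump_partition[OF cad less_imp_le[OF t]], rule that)
  have J: "jump_sum f t \<phi> = (\<Sum>l<r. \<phi> (f (a l)) (f (a (Suc l))) (Suc l))" for \<phi>
    by (rule jump_sum_blocks) (fact p)+
  have "\<forall>\<^sub>F n in sequentially. grid_blocks f t a r n (\<lambda>l. nat \<lceil>a l * real n / t\<rceil>)"
    by (rule grid_indices) (fact t p)+
  then show ?thesis
  proof eventually_elim
    case (elim n)
    define c where "c l = nat \<lceil>a l * real n / t\<rceil>" for l
    have c: "c 0 = 0" "c (Suc r) = n" "c r \<le> n" "\<And>l. l < r \<Longrightarrow> c l < c (Suc l)"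
      "\<And>l m. l \<le> r \<Longrightarrow> c l \<le> m \<Longrightarrow> m < c (Suc l) \<Longrightarrow> f (grid t n m) = f (a l)"
      "\<And>m. c r \<le> m \<Longrightarrow> m \<le> n \<Longrightarrow> f (grid t n m) = f (a r)"
      using elim unfolding grid_blocks_def c_def by blast+
    have "grid_jump_sum f t n \<phi> = (\<Sum>l<r. \<phi> (f (a l)) (f (a (Suc l))) (Suc l))" for \<phi>
      by (rule grid_jump_sum_blocks) (fact c p)+
    then show ?case by (simp add: J)
  qed
qed

lemma levy_integral_blocks:
  fixes f :: "real \<Rightarrow> 's::finite"
  assumes cad: "cadlag_in (discrete_topology UNIV) f"
    and T: "\<And>l. l \<le> r \<Longrightarrow> jump_time f l = ereal (a l)" and inc: "\<And>l. l < r \<Longrightarrow> a l < a (Suc l)"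
    and ar: "a r \<le> t" "a (Suc r) = t" and last: "ereal t < jump_time f (Suc r)"
  shows "levy_integral f t Y = (\<Sum>l\<le>r. Y (f (a l)) (a (Suc l)) - Y (f (a l)) (a l))"
proof -
  define g where "g i n = (of_bool (left_value f (real_of_ereal (min (jump_time f (Suc n)) (ereal t))) = i) ::
      real) *\<^sub>R
        (Y i (real_of_ereal (min (jump_time f (Suc n)) (ereal t))) - Y i
            (real_of_ereal (min (jump_time f n) (ereal t))))" for i n
  have am: "a k \<le> t" if "k \<le> r" for k
  proof -
    have "ereal (a k) \<le> ereal (a r)" using jump_time_mono[OF that, of f] T that by simp
    then show ?thesis using ar by simp
  qed
  have mn: "real_of_ereal (min (jump_time f n) (ereal t)) = a n" if "n \<le> Suc r" for n
  proof (cases "n = Suc r")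
    case True
    have "min (jump_time f (Suc r)) (ereal t) = ereal t" using last by (intro min_absorb2) (rule less_imp_le)
    then show ?thesis using True ar by (simp del: jump_time.simps)
  next
    case False then show ?thesis using that T[of n] am[of n] by (simp add: min_def)
  qed
  have fin: "g i n = 0" if "n \<notin> {..r}" for i n
  proof -
    have "jump_time f (Suc r) \<le> jump_time f n" using that by (intro jump_time_mono) simp
    moreover have "jump_time f (Suc r) \<le> jump_time f (Suc n)" using that by (intro jump_time_mono) simp
    ultimately have "ereal t < jump_time f n" "ereal t < jump_time f (Suc n)"
      using last by (auto intro: less_le_trans simp del: jump_time.simps)
    then have "min (jump_time f n) (ereal t) = ereal t" "min (jump_time f (Suc n)) (ereal t) = ereal t"
      by (simp_all only: min_absorb2 less_imp_le)
    then show ?thesis by (simp add: g_def del: jump_time.simps)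
  qed
  have lv: "left_value f (a (Suc l)) = f (a l)" if "l \<le> r" "a l \<noteq> a (Suc l)" for l
  proof (rule left_value_between_jumps[OF cad T])
    show "0 \<le> a l" using jump_time_nonneg[of f l] T that by simp
    show "a l < a (Suc l)" using that inc[of l] ar by (cases "l = r") auto
    show "ereal (a (Suc l)) \<le> jump_time f (Suc l)"
      using that T[of "Suc l"] last ar by (cases "l = r") (auto simp del: jump_time.simps)
  qed fact
  have "levy_integral f t Y = (\<Sum>i\<in>UNIV. suminf (g i))"
    unfolding levy_integral_def step_integral_def g_def ..
  also have "\<dots> = (\<Sum>i\<in>UNIV. \<Sum>l\<le>r. g i l)"
    by (intro sum.cong refl suminf_finite) (use fin in auto)
  also have "\<dots> = (\<Sum>l\<le>r. \<Sum>i\<in>UNIV. g i l)" by (rule sum.swap)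
  also have "\<dots> = (\<Sum>l\<le>r. Y (f (a l)) (a (Suc l)) - Y (f (a l)) (a l))"
  proof (rule sum.cong)
    fix l assume "l \<in> {..r}"
    then have l: "l \<le> r" by simp
    \<comment> \<open>If \<open>t\<close> itself is a jump time, the last interval is degenerate and its term vanishes on both sides.\<close>
    show "(\<Sum>i\<in>UNIV. g i l) = Y (f (a l)) (a (Suc l)) - Y (f (a l)) (a l)"
    proof (cases "a l = a (Suc l)")
      case True
      then show ?thesis unfolding g_def using l by (simp add: mn del: jump_time.simps)
    next
      case False
      then have "(\<Sum>i\<in>UNIV. g i l) = (\<Sum>i\<in>UNIV. if f (a l) = i then Y i (a (Suc l)) - Y i (a l) else 0)"
        unfolding g_def using l lv[OF l False] by (intro sum.cong) (simp_all add: mn del: jump_time.simps)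
      then show ?thesis by simp
    qed
  qed simp
  finally show ?thesis .
qed

text \<open>On each block the increments telescope to the increment between two rounded jump times. These decrease
  to the jump times, so right continuity of \<open>Y\<close> gives the limit.\<close>

lemma grid_levy_sum_tendsto:
  fixes f :: "real \<Rightarrow> 's::finite"
  assumes cad: "cadlag_in (discrete_topology UNIV) f" and t: "0 < t"
    and Y: "\<And>i. cadlag_in euclidean (Y i)"
  shows "(\<lambda>n. grid_levy_sum f t n Y) \<longlonglongrightarrow> levy_integral f t Y"
proof -
  obtain r a where p: "a 0 = 0" "\<And>l. l \<le> r \<Longrightarrow> jump_time f l = ereal (a l)"
    "\<And>l. l < r \<Longrightarrow> a l < a (Suc l)" "a r \<le> t" "a (Suc r) = t" "ereal t < jump_time f (Suc r)"
    "\<And>l u. l < r \<Longrightarrow> a l \<le> u \<Longrightarrow> u < a (Suc l) \<Longrightarrow> f u = f (a l)"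
    "\<And>u. a r \<le> u \<Longrightarrow> u \<le> t \<Longrightarrow> f u = f (a r)"
    "\<And>l. l < r \<Longrightarrow> f (a l) \<noteq> f (a (Suc l))"
    by (rule jump_partition[OF cad less_imp_le[OF t]], rule that)
  define c where "c n l = nat \<lceil>a l * real n / t\<rceil>" for n l
  have nonneg: "0 \<le> a l" if "l \<le> Suc r" for l
    using jump_time_nonneg[of f l] p(2)[of l] p(5) t that by (cases "l = Suc r") auto
  have conv: "(\<lambda>n. Y i (grid t n (c n l))) \<longlonglongrightarrow> Y i (a l)" if l: "l \<le> Suc r" for i l
  proof -
    have "(Y i \<longlongrightarrow> Y i (a l)) (at_right (a l))"
      using Y[of i] nonneg[OF l] by (auto simp: cadlag_in_def)
    then have cont: "continuous (at (a l) within {a l..}) (Y i)"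
      by (simp add: continuous_within at_within_Ici_at_right)
    have bounds: "a l \<le> grid t n (c n l) \<and> grid t n (c n l) \<le> a l + t / real n" if "0 < n" for n
    proof -
      have "0 \<le> a l * real n / t" using nonneg[OF l] t by simp
      then have "a l * real n / t \<le> real (c n l)" "real (c n l) \<le> a l * real n / t + 1"
        unfolding c_def by linarith+
      then show ?thesis using t that by (simp add: grid_def field_simps)
    qed
    have lim: "(\<lambda>n. a l + t / real n) \<longlonglongrightarrow> a l"
      using tendsto_add[OF tendsto_const tendsto_mult[OF tendsto_const[of t] lim_inverse_n], of "a l"]
          by (simp add: divide_inverse)
    have gl: "(\<lambda>n. grid t n (c n l)) \<longlonglongrightarrow> a l"
      by (rule tendsto_sandwich[OF _ _ tendsto_const lim])
         (auto intro!: eventually_mono[OF eventually_gt_at_top[of 0]] dest!: bounds)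
    show ?thesis
      by (rule continuous_within_tendsto_compose[OF cont _ gl])
         (auto intro!: eventually_mono[OF eventually_gt_at_top[of 0]] dest!: bounds)
  qed
  have "(\<lambda>n. \<Sum>l\<le>r. Y (f (a l)) (grid t n (c n (Suc l))) - Y (f (a l)) (grid t n (c n l))) \<longlonglongrightarrow>
     (\<Sum>l\<le>r. Y (f (a l)) (a (Suc l)) - Y (f (a l)) (a l))"
    by (intro tendsto_sum tendsto_diff conv) auto
  also have "(\<Sum>l\<le>r. Y (f (a l)) (a (Suc l)) - Y (f (a l)) (a l)) = levy_integral f t Y"
    by (rule levy_integral_blocks[symmetric]) (fact cad p)+
  finally show ?thesis
  proof (rule Lim_transform_eventually)
    have "\<forall>\<^sub>F n in sequentially. grid_blocks f t a r n (c n)"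
      unfolding c_def by (rule grid_indices) (fact t p)+
    then show "\<forall>\<^sub>F n in sequentially. (\<Sum>l\<le>r. Y (f (a l)) (grid t n (c n (Suc l))) - Y (f (a l))
        (grid t n (c n l)))
       = grid_levy_sum f t n Y"
    proof eventually_elim
      case (elim n)
      define d where "d = c n"
      have d: "d 0 = 0" "d (Suc r) = n" "d r \<le> n" "\<And>l. l < r \<Longrightarrow> d l < d (Suc l)"
        "\<And>l m. l \<le> r \<Longrightarrow> c n l \<le> m \<Longrightarrow> m < c n (Suc l) \<Longrightarrow> f (grid t n m) = f (a l)"
        using elim unfolding grid_blocks_def d_def by blast+
      have dm: "d l \<le> d (Suc l)" if "l \<le> r" for l
        using d(2,3) d(4)[of l] that by (cases "l = r") auto
      have "grid_levy_sum f t n Y = (\<Sum>m<d (Suc r). Y (f (grid t n m)) (grid t n (Suc m)) - Y (f (grid t n m))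
          (grid t n m))"
        unfolding grid_levy_sum_def d(2) ..
      also have "\<dots> = (\<Sum>l\<le>r. \<Sum>m=d l..<d (Suc l). Y (f (grid t n m)) (grid t n (Suc m)) - Y (f (grid t n m))
          (grid t n m))"
        by (rule sum_blocks[OF d(1) dm])
      also have "\<dots> = (\<Sum>l\<le>r. \<Sum>m=d l..<d (Suc l). Y (f (a l)) (grid t n (Suc m)) - Y (f (a l)) (grid t n m))"
        by (intro sum.cong refl) (simp add: d(5) d_def)
      also have "\<dots> = (\<Sum>l\<le>r. Y (f (a l)) (grid t n (c n (Suc l))) - Y (f (a l)) (grid t n (c n l)))"
      proof (intro sum.cong refl)
        fix l assume "l \<in> {..r}"
        then show "(\<Sum>m=d l..<d (Suc l). Y (f (a l)) (grid t n (Suc m)) - Y (f (a l)) (grid t n m)) =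
          Y (f (a l)) (grid t n (c n (Suc l))) - Y (f (a l)) (grid t n (c n l))"
          using dm[of l] d_def
            sum_Suc_diff'[of "d l" "d (Suc l)" "\<lambda>m. Y (f (a l)) (grid t n m)"] by simp
      qed
      finally show ?case by simp
    qed
  qed
qed

lemma grid_jump_sum_one: "grid_jump_sum f t n (\<lambda>_ _ _. 1) = real (card {m. m < n \<and> grid_change f t n m})"
proof -
  have "{m. m < n \<and> grid_change f t n m} = {..<n} \<inter> {m. grid_change f t n m}" by auto
  then show ?thesis by (simp add: grid_jump_sum_def sum.If_cases)
qed

lemma grid_jump_sum_one_alt:
  "grid_jump_sum f t n (\<lambda>_ _ _. 1) = (\<Sum>m<n. of_bool (grid_change f t n m))"
  by (simp add: grid_jump_sum_def of_bool_def)

lemma grid_const: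
  assumes "\<And>m'. k \<le> m' \<Longrightarrow> m' < m \<Longrightarrow> \<not> grid_change f t n m'" "k \<le> m"
  shows "f (grid t n m) = f (grid t n k)"
  using assms(2,1)
proof (induction m rule: dec_induct)
  case (step m)
  then show ?case by (auto simp: grid_change_def)
qed simp

lemma grid_no_change:
  assumes "grid_jump_sum f t n (\<lambda>_ _ _. 1) = 0" "0 < n"
  shows "grid_jump_sum f t n \<phi> = 0" "f t = f 0" "grid_levy_sum f t n Y = Y (f 0) t - Y (f 0) 0"
proof -
  have "card {m. m < n \<and> grid_change f t n m} = 0"
    using assms(1) unfolding grid_jump_sum_one by simp
  then have nc: "\<not> grid_change f t n m" if "m < n" for m using that by auto
  show "grid_jump_sum f t n \<phi> = 0" by (simp add: grid_jump_sum_def nc)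
  have c: "f (grid t n m) = f 0" if "m \<le> n" for m
    using grid_const[of 0 m f t n] nc that by auto
  from c[of n] show "f t = f 0" using assms(2) by simp
  have "grid_levy_sum f t n Y = (\<Sum>m<n. Y (f 0) (grid t n (Suc m)) - Y (f 0) (grid t n m))"
    unfolding grid_levy_sum_def by (intro sum.cong) (auto simp: c)
  also have "\<dots> = Y (f 0) (grid t n n) - Y (f 0) (grid t n 0)"
    by (rule sum_lessThan_telescope)
  finally show "grid_levy_sum f t n Y = Y (f 0) t - Y (f 0) 0" using assms(2) by simp
qed

lemma grid_one_change:
  assumes "grid_jump_sum f t n (\<lambda>_ _ _. 1) = 1" "0 < n"
  shows "grid_jump_sum f t n \<phi> = \<phi> (f 0) (f t) 1" "f t \<noteq> f 0"
proof -
  have "card {m. m < n \<and> grid_change f t n m} = 1"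
    using assms(1) unfolding grid_jump_sum_one by simp
  then obtain m where m: "{m. m < n \<and> grid_change f t n m} = {m}" by (auto simp: card_1_singleton_iff)
  then have mn: "m < n" "grid_change f t n m" by auto
  have nc: "\<not> grid_change f t n k" if "k < n" "k \<noteq> m" for k using m that by auto
  have "f (grid t n m) = f (grid t n 0)"
    by (rule grid_const) (use nc mn in auto)
  then have fm: "f (grid t n m) = f 0" by simp
  have "f (grid t n n) = f (grid t n (Suc m))"
    by (rule grid_const) (use nc mn in auto)
  then have fSm: "f (grid t n (Suc m)) = f t" using assms(2) by simp
  have "{l. l < m \<and> grid_change f t n l} = {}" using nc mn by auto
  then have cb: "changes_before f t n m = 0" by (simp add: changes_before_def)
  show "f t \<noteq> f 0" using mn(2) fm fSm by (auto simp: grid_change_def)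
  have "grid_jump_sum f t n \<phi> = (\<Sum>k<n. if k = m then \<phi> (f 0) (f t) 1 else 0)"
    unfolding grid_jump_sum_def by (intro sum.cong) (use nc mn fm fSm cb in auto)
  then show "grid_jump_sum f t n \<phi> = \<phi> (f 0) (f t) 1" using mn by simp
qed

text \<open>Cauchy-Schwarz, with one factor counting the changes.\<close>

lemma grid_jump_sum_square_le:
  "(grid_jump_sum f t n \<phi>)\<^sup>2 \<le> grid_jump_sum f t n (\<lambda>_ _ _. 1) * grid_jump_sum f t n (\<lambda>i j l. (\<phi> i j l)\<^sup>2)"
proof -
  let ?b = "\<lambda>m. of_bool (grid_change f t n m) :: real"
  let ?v = "\<lambda>m. \<phi> (f (grid t n m)) (f (grid t n (Suc m))) (Suc (changes_before f t n m))"
  have eq: "grid_jump_sum f t n \<psi>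
      = (\<Sum>m<n. ?b m * \<psi> (f (grid t n m)) (f (grid t n (Suc m))) (Suc (changes_before f t n m)))" for \<psi>
    unfolding grid_jump_sum_def by (intro sum.cong) auto
  have "(\<Sum>m<n. ?b m * (?b m * ?v m))\<^sup>2 \<le> (\<Sum>m<n. (?b m)\<^sup>2) * (\<Sum>m<n. (?b m * ?v m)\<^sup>2)"
    by (rule Cauchy_Schwarz_ineq_sum)
  moreover have "(\<Sum>m<n. (?b m)\<^sup>2) = (\<Sum>m<n. ?b m)" "(\<Sum>m<n. ?b m * (?b m * ?v m)) = (\<Sum>m<n. ?b m * ?v m)"
    "(\<Sum>m<n. (?b m * ?v m)\<^sup>2) = (\<Sum>m<n. ?b m * (?v m)\<^sup>2)"
    by (rule sum.cong; simp add: power2_eq_square of_bool_def)+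
  ultimately show ?thesis by (simp add: eq)
qed

context
  fixes f :: "real \<Rightarrow> 's::finite" and t :: real
  assumes cad: "cadlag_in (discrete_topology UNIV) f" and t: "0 < t"
begin

text \<open>Properties of a path with few jumps are read off from a single grid that sees all of its jumps.\<close>

lemma jump_sum_grid: obtains n where "0 < n" "\<And>\<phi>. grid_jump_sum f t n \<phi> = jump_sum f t \<phi>"
proof -
  have "\<forall>\<^sub>F n in sequentially. 0 < n \<and> (\<forall>\<phi>. grid_jump_sum f t n \<phi> = jump_sum f t \<phi>)"
    using grid_jump_sum_eventually[OF cad t] eventually_gt_at_top[of 0] by eventually_elim simp
  then show ?thesis using that unfolding eventually_sequentially by blast
qed

lemma jump_sum_one_cases:
  "jump_sum f t (\<lambda>_ _ _. 1) = 0 \<or> jump_sum f t (\<lambda>_ _ _. 1) = 1 \<or> 2 \<le> jump_sum f t (\<lambda>_ _ _. 1)"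
proof -
  obtain n where "\<And>\<phi>. grid_jump_sum f t n \<phi> = jump_sum f t \<phi>" using jump_sum_grid by blast
  then obtain k where k: "jump_sum f t (\<lambda>_ _ _. 1) = real k"
    using grid_jump_sum_one[of f t n] by metis
  consider "k = 0" | "k = 1" | "2 \<le> k" by linarith
  then show ?thesis by cases (simp_all add: k)
qed

lemma no_jump:
  assumes "jump_sum f t (\<lambda>_ _ _. 1) = 0"
  shows "jump_sum f t \<phi> = 0" "f t = f 0"
proof -
  obtain n where n: "0 < n" "\<And>\<phi>. grid_jump_sum f t n \<phi> = jump_sum f t \<phi>" using jump_sum_grid by blast
  have g: "grid_jump_sum f t n (\<lambda>_ _ _. 1) = 0" using n(2) assms by simp
  show "jump_sum f t \<phi> = 0" using grid_no_change(1)[OF g n(1), of \<phi>] n(2) by simp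
  show "f t = f 0" using grid_no_change(2)[OF g n(1)] .
qed

lemma no_jump_levy_integral:
  assumes "jump_sum f t (\<lambda>_ _ _. 1) = 0" "\<And>i. cadlag_in euclidean (Y i)"
  shows "levy_integral f t Y = Y (f 0) t - Y (f 0) 0"
proof (rule LIMSEQ_unique[OF grid_levy_sum_tendsto[OF cad t assms(2)]])
  have "\<forall>\<^sub>F n in sequentially. grid_levy_sum f t n Y = Y (f 0) t - Y (f 0) 0"
    using grid_jump_sum_eventually[OF cad t] eventually_gt_at_top[of 0]
  proof eventually_elim
    case (elim n)
    then have "grid_jump_sum f t n (\<lambda>_ _ _. 1) = 0" using assms(1) by simp
    then show ?case using elim(2) by (rule grid_no_change(3))
  qed
  then show "(\<lambda>n. grid_levy_sum f t n Y) \<longlonglongrightarrow> Y (f 0) t - Y (f 0) 0"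
    by (rule tendsto_eventually)
qed

lemma one_jump:
  assumes "jump_sum f t (\<lambda>_ _ _. 1) = 1"
  shows "jump_sum f t \<phi> = \<phi> (f 0) (f t) 1" "f t \<noteq> f 0"
proof -
  obtain n where n: "0 < n" "\<And>\<phi>. grid_jump_sum f t n \<phi> = jump_sum f t \<phi>" using jump_sum_grid by blast
  have g: "grid_jump_sum f t n (\<lambda>_ _ _. 1) = 1" using n(2) assms by simp
  show "jump_sum f t \<phi> = \<phi> (f 0) (f t) 1" using grid_one_change(1)[OF g n(1), of \<phi>] n(2) by simp
  show "f t \<noteq> f 0" using grid_one_change(2)[OF g n(1)] .
qed

end

section \<open>Additive functions, semigroups and matrix exponentials\<close>

text \<open>Subtract the linear function with the same value at \<open>a\<close>. The difference is additive and \<open>a\<close>-periodic,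
  hence bounded on the half line, and \<open>g (n x) = n g x\<close> forces it to vanish.\<close>

lemma bounded_additive_is_linear:
  fixes f :: "real \<Rightarrow> real"
  assumes add: "\<And>s t. 0 \<le> s \<Longrightarrow> 0 \<le> t \<Longrightarrow> f (s + t) = f s + f t"
    and a: "0 < a" and bdd: "\<And>x. 0 \<le> x \<Longrightarrow> x \<le> a \<Longrightarrow> \<bar>f x\<bar> \<le> B" and x: "0 \<le> x"
  shows "f x = x * f 1"
proof -
  define g where "g x = f x - x / a * f a" for x
  have gadd: "g (s + t) = g s + g t" if "0 \<le> s" "0 \<le> t" for s t
    using add[OF that] by (simp add: g_def add_divide_distrib distrib_right)
  have ga: "g a = 0" using a by (simp add: g_def)
  have f0: "f 0 = 0" using add[of 0 0] by simp
  have gper: "g (x + real n * a) = g x" if "0 \<le> x" for x n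
  proof (induction n)
    case (Suc n)
    have "g (x + real (Suc n) * a) = g ((x + real n * a) + a)" by (simp add: algebra_simps)
    also have "\<dots> = g x" using gadd[of "x + real n * a" a] Suc that a ga by simp
    finally show ?case .
  qed simp
  have gmul: "g (real n * x) = real n * g x" if "0 \<le> x" for x n
  proof (induction n)
    case 0 show ?case by (simp add: g_def f0)
  next
    case (Suc n)
    have "g (real (Suc n) * x) = g (real n * x + x)" by (simp add: algebra_simps)
    also have "\<dots> = real (Suc n) * g x" using gadd[of "real n * x" x] Suc that by (simp add: algebra_simps)
    finally show ?case .
  qed
  define C where "C = B + \<bar>f a\<bar>"
  have gb: "\<bar>g x\<bar> \<le> C" if "0 \<le> x" for x
  proof -
    define n where "n = nat \<lfloor>x / a\<rfloor>"
    define y where "y = x - real n * a"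
    have "real n \<le> x / a" "x / a < real n + 1"
      using that a unfolding n_def by (auto simp: of_nat_nat)
    then have "real n * a \<le> x" "x < real n * a + a"
      using a by (auto simp: field_simps)
    then have y: "0 \<le> y" "y \<le> a" unfolding y_def by auto
    have "g x = g y" using gper[OF y(1), of n] unfolding y_def by simp
    moreover have "\<bar>y / a * f a\<bar> \<le> 1 * \<bar>f a\<bar>"
      unfolding abs_mult using y a by (intro mult_right_mono) auto
    ultimately show ?thesis using bdd[OF y] unfolding C_def g_def by linarith
  qed
  have g0: "g x = 0" if "0 \<le> x" for x
  proof (rule ccontr)
    assume "g x \<noteq> 0"
    then obtain n where "C < real n * \<bar>g x\<bar>" using reals_Archimedean3[of "\<bar>g x\<bar>"] by auto
    also have "\<dots> = \<bar>g (real n * x)\<bar>" by (simp add: gmul[OF that] abs_mult)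
    also have "\<dots> \<le> C" using that by (intro gb) simp
    finally show False by simp
  qed
  have "f 1 = f a / a" using g0[of 1] by (simp add: g_def)
  then show ?thesis using g0[OF x] by (simp add: g_def)
qed

lemma vector_derivative_from_difference_quotients:
  fixes f :: "real \<Rightarrow> 'a::real_normed_vector"
  assumes s: "0 \<le> s"
    and right: "((\<lambda>h. (1 / h) *\<^sub>R (f (s + h) - f s)) \<longlongrightarrow> D) (at_right 0)"
    and left: "0 < s \<Longrightarrow> ((\<lambda>h. (1 / h) *\<^sub>R (f s - f (s - h))) \<longlongrightarrow> D) (at_right 0)"
  shows "(f has_vector_derivative D) (at s within {0..})"
proof -
  let ?q = "\<lambda>y. (1 / (y - s)) *\<^sub>R (f y - f s)"
  have r: "(?q \<longlongrightarrow> D) (at_right s)"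
    unfolding filterlim_at_right_to_0[of ?q _ s] using right by (simp add: add.commute)
  have l: "(?q \<longlongrightarrow> D) (at_left s)" if "0 < s"
  proof -
    have "((\<lambda>h. ?q (- (h + - s))) \<longlongrightarrow> D) (at_right 0)"
    proof (rule Lim_transform_eventually[OF left[OF that]])
      have "(1 / h) *\<^sub>R (f s - f (s - h)) = ?q (- (h + - s))" if "0 < h" for h
        by (simp add: scaleR_diff_right)
      then show "\<forall>\<^sub>F h in at_right 0. (1 / h) *\<^sub>R (f s - f (s - h)) = ?q (- (h + - s))"
        by (auto simp: eventually_at_right_field intro!: exI[of _ 1])
    qed
    then show ?thesis
      unfolding filterlim_at_left_to_right[of ?q _ s] filterlim_at_right_to_0[of "\<lambda>x. ?q (- x)" _ "- s"] .
  qed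
  have "(?q \<longlongrightarrow> D) (at s within {0..})"
  proof (cases "s = 0")
    case True
    then show ?thesis using r by (simp add: at_within_Ici_at_right)
  next
    case False
    then have "at s within {0..} = at s" using s by (intro at_within_interior) auto
    then show ?thesis using filterlim_split_at[OF l r] False s by simp
  qed
  then have "((\<lambda>y. norm (?q y - D)) \<longlongrightarrow> 0) (at s within {0..})"
    by (intro tendsto_norm_zero) (simp add: Lim_null[symmetric])
  moreover have "\<forall>\<^sub>F y in at s within {0..}.
      norm (?q y - D) = norm (f y - f s - (y - s) *\<^sub>R D) / norm (y - s)"
    unfolding eventually_at_filter
  proof (intro always_eventually allI impI)
    fix y assume "y \<noteq> s"
    then have "f y - f s - (y - s) *\<^sub>R D = (y - s) *\<^sub>R (?q y - D)"
      by (simp add: scaleR_diff_right)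
    then show "norm (?q y - D) = norm (f y - f s - (y - s) *\<^sub>R D) / norm (y - s)"
      using \<open>y \<noteq> s\<close> by simp
  qed
  ultimately have "((\<lambda>y. norm (f y - f s - (y - s) *\<^sub>R D) / norm (y - s)) \<longlongrightarrow> 0) (at s within {0..})"
    by (rule Lim_transform_eventually)
  then show ?thesis
    unfolding has_vector_derivative_def has_derivative_iff_norm
    by (simp add: bounded_linear_scaleR_left)
qed

text \<open>In finite dimension pointwise convergence of the difference quotients of \<open>T\<close> at \<open>0\<close> to \<open>G\<close> is uniform on
  bounded sets. The right derivative is then immediate. For the left derivative, \<open>f s = T h (f (s - h))\<close>
  with \<open>T h\<close> close to the identity bounds \<open>f (s - h)\<close> by twice the norm of \<open>f s\<close>; this gives left continuity
  first and then the derivative.\<close>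

lemma semigroup_has_vector_derivative:
  fixes T :: "real \<Rightarrow> 'a::euclidean_space \<Rightarrow> 'a"
  assumes T: "\<And>h. linear (T h)" and G: "linear G"
    and gen: "\<And>x. ((\<lambda>h. (1 / h) *\<^sub>R (T h x - x)) \<longlongrightarrow> G x) (at_right 0)"
    and f: "\<And>s h. 0 \<le> s \<Longrightarrow> 0 \<le> h \<Longrightarrow> f (s + h) = T h (f s)"
    and s: "0 \<le> s"
  shows "(f has_vector_derivative G (f s)) (at s within {0..})"
proof (rule vector_derivative_from_difference_quotients[OF s])
  have "((\<lambda>h. (1 / h) *\<^sub>R (T h (f s) - f s)) \<longlongrightarrow> G (f s)) (at_right 0)" by (rule gen)
  then show "((\<lambda>h. (1 / h) *\<^sub>R (f (s + h) - f s)) \<longlongrightarrow> G (f s)) (at_right 0)"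
    by (rule Lim_transform_eventually)
       (auto simp: eventually_at_right_field f[OF s] intro!: exI[of _ 1])
next
  assume s0: "0 < s"
  define q where "q h x = (1 / h) *\<^sub>R (T h x - x)" for h x
  have qlin: "linear (q h)" for h
    unfolding q_def by (intro linear_compose_scale_right linear_compose_sub T linear_ident)
  define r where "r h = (\<Sum>b\<in>Basis. norm (q h b - G b))" for h
  have "((\<lambda>h. \<Sum>b\<in>Basis. norm (q h b - G b)) \<longlongrightarrow> (\<Sum>b\<in>(Basis::'a set). 0)) (at_right 0)"
    using gen unfolding q_def by (intro tendsto_sum tendsto_norm_zero) (simp add: Lim_null[symmetric])
  then have r0: "(r \<longlongrightarrow> 0) (at_right 0)" by (simp add: r_def[abs_def])
  have r_nonneg: "0 \<le> r h" for h unfolding r_def by (intro sum_nonneg) simp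
  have bound: "norm (q h x - G x) \<le> r h * norm x" for h x
  proof -
    have lin: "linear (\<lambda>x. q h x - G x)" using qlin G by (rule linear_compose_sub)
    have "q h x - G x = q h (\<Sum>b\<in>Basis. (x \<bullet> b) *\<^sub>R b) - G (\<Sum>b\<in>Basis. (x \<bullet> b) *\<^sub>R b)"
      by (simp add: euclidean_representation)
    also have "\<dots> = (\<Sum>b\<in>Basis. (x \<bullet> b) *\<^sub>R (q h b - G b))"
      unfolding linear_sum[OF lin] by (simp add: linear_scale[OF lin])
    also have "norm \<dots> \<le> (\<Sum>b\<in>Basis. norm ((x \<bullet> b) *\<^sub>R (q h b - G b)))" by (rule norm_sum)
    also have "\<dots> \<le> (\<Sum>b\<in>Basis. norm x * norm (q h b - G b))"
      by (intro sum_mono) (auto intro!: mult_right_mono Basis_le_norm)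
    finally show ?thesis by (simp add: r_def sum_distrib_left mult.commute)
  qed
  obtain K where K: "\<And>x. norm (G x) \<le> norm x * K" "0 \<le> K"
    using bounded_linear.nonneg_bounded[of G] G by (auto simp: linear_conv_bounded_linear)
  have qK: "norm (T h y - y) \<le> h * (r h + K) * norm y" if "0 < h" for h y
  proof -
    have "T h y - y = h *\<^sub>R ((q h y - G y) + G y)" using that by (simp add: q_def)
    then have "norm (T h y - y) = h * norm ((q h y - G y) + G y)" using that by simp
    also have "\<dots> \<le> h * (r h * norm y + norm y * K)"
      using that by (intro mult_left_mono norm_triangle_le add_mono bound K) auto
    finally show ?thesis by (simp add: algebra_simps)
  qed
  have small: "((\<lambda>h. h * (r h + K)) \<longlongrightarrow> 0 * (0 + K)) (at_right 0)"
    by (intro tendsto_intros r0)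
  then have ev: "\<forall>\<^sub>F h in at_right 0. h * (r h + K) < 1/2"
    by (intro order_tendstoD[where a="1/2"]) auto
  have evs: "\<forall>\<^sub>F h in at_right 0. 0 < h \<and> h < s"
    using s0 by (auto simp: eventually_at_right_field)
  have y2: "\<forall>\<^sub>F h in at_right 0. norm (f (s - h)) \<le> 2 * norm (f s)"
    using ev evs
  proof eventually_elim
    case (elim h)
    have fs: "f s = T h (f (s - h))" using f[of "s - h" h] elim by simp
    have "norm (f (s - h)) \<le> norm (f s) + norm (T h (f (s - h)) - f (s - h))"
      unfolding fs by (metis norm_triangle_sub norm_minus_commute)
    also have "\<dots> \<le> norm (f s) + 1/2 * norm (f (s - h))"
      using qK[of h "f (s - h)"] elim
      by (intro add_left_mono) (smt (verit) mult_right_mono norm_ge_zero)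
    finally show ?case by simp
  qed
  have lim_y: "((\<lambda>h. f (s - h)) \<longlongrightarrow> f s) (at_right 0)"
  proof (rule iffD2[OF Lim_null], rule Lim_null_comparison)
    show "\<forall>\<^sub>F h in at_right 0. norm (f (s - h) - f s) \<le> h * (r h + K) * (2 * norm (f s))"
      using y2 evs
    proof eventually_elim
      case (elim h)
      have fs: "f s = T h (f (s - h))" using f[of "s - h" h] elim by simp
      have "norm (f (s - h) - f s) \<le> h * (r h + K) * norm (f (s - h))"
        using qK[of h "f (s - h)"] elim by (simp add: fs[symmetric] norm_minus_commute)
      also have "\<dots> \<le> h * (r h + K) * (2 * norm (f s))"
        using elim r_nonneg K by (intro mult_left_mono mult_nonneg_nonneg add_nonneg_nonneg) auto
      finally show ?case .
    qed
    show "((\<lambda>h. h * (r h + K) * (2 * norm (f s))) \<longlongrightarrow> 0) (at_right 0)"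
      using tendsto_mult[OF small tendsto_const[of "2 * norm (f s)"]] by simp
  qed
  have limG: "((\<lambda>h. G (f (s - h))) \<longlongrightarrow> G (f s)) (at_right 0)"
    using G lim_y by (auto simp: linear_conv_bounded_linear intro: bounded_linear.tendsto)
  have "((\<lambda>h. q h (f (s - h)) - G (f (s - h))) \<longlongrightarrow> 0) (at_right 0)"
  proof (rule Lim_null_comparison)
    show "\<forall>\<^sub>F h in at_right 0. norm (q h (f (s - h)) - G (f (s - h))) \<le> r h * (2 * norm (f s))"
      using y2
    proof eventually_elim
      case (elim h)
      show ?case using bound[of h "f (s - h)"] mult_left_mono[OF elim r_nonneg[of h]] by linarith
    qed
    show "((\<lambda>h. r h * (2 * norm (f s))) \<longlongrightarrow> 0) (at_right 0)"
      using tendsto_mult[OF r0 tendsto_const[of "2 * norm (f s)"]] by simp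
  qed
  from tendsto_add[OF this limG] have "((\<lambda>h. q h (f (s - h))) \<longlongrightarrow> G (f s)) (at_right 0)" by simp
  then show "((\<lambda>h. (1 / h) *\<^sub>R (f s - f (s - h))) \<longlongrightarrow> G (f s)) (at_right 0)"
  proof (rule Lim_transform_eventually)
    show "\<forall>\<^sub>F h in at_right 0. q h (f (s - h)) = (1 / h) *\<^sub>R (f s - f (s - h))"
      using evs
    proof eventually_elim
      case (elim h)
      then show ?case using f[of "s - h" h] by (simp add: q_def)
    qed
  qed
qed

lemma bounded_bilinear_matrix_mult:
  "bounded_bilinear (\<lambda>(A :: real^'n^'m) (B :: real^'p^'n). A ** B)"
proof -
  have "bilinear (\<lambda>(A :: real^'n^'m) (B :: real^'p^'n). A ** B)"
    unfolding bilinear_def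
    by (auto intro!: linearI simp: matrix_matrix_mult_def vec_eq_iff sum.distrib algebra_simps sum_distrib_left)
  then show ?thesis by (simp add: bilinear_conv_bounded_bilinear)
qed

lemma has_vector_derivative_vecI:
  fixes f :: "real \<Rightarrow> 'a::real_normed_vector ^ 'n"
  assumes "\<And>i. ((\<lambda>x. f x $ i) has_vector_derivative (f' $ i)) (at t within S)"
  shows "(f has_vector_derivative f') (at t within S)"
  unfolding has_vector_derivative_def has_derivative_within
proof (intro conjI)
  show "bounded_linear (\<lambda>h. h *\<^sub>R f')" by (rule bounded_linear_scaleR_left)
  show "((\<lambda>y. (1 / norm (y - t)) *\<^sub>R (f y - (f t + (y - t) *\<^sub>R f'))) \<longlongrightarrow> 0) (at t within S)"
    using assms unfolding has_vector_derivative_def has_derivative_within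
    by (intro vec_tendstoI) simp
qed

lemma matrix_power_Suc': "matrix_power A (Suc n) = matrix_power A n ** A"
  by (induction n) (simp_all add: matrix_mul_assoc)

lemma matrix_power_scaleR: "matrix_power (t *\<^sub>R A) n = t ^ n *\<^sub>R matrix_power A n"
  by (induction n) (simp_all add: bounded_bilinear.scaleR_left[OF bounded_bilinear_matrix_mult]
      bounded_bilinear.scaleR_right[OF bounded_bilinear_matrix_mult])

lemma matrix_power_bound:
  fixes A :: "real^'s^'s"
  shows "\<bar>matrix_power A n $ i $ k\<bar> \<le> (\<Sum>i\<in>UNIV. \<Sum>k\<in>UNIV. \<bar>A $ i $ k\<bar>) ^ n"
proof (induction n arbitrary: i k)
  case 0 show ?case by (simp add: mat_def)
next
  case (Suc n)
  let ?B = "\<Sum>i\<in>UNIV. \<Sum>k\<in>UNIV. \<bar>A $ i $ k\<bar>"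
  have B: "0 \<le> ?B" by (intro sum_nonneg) simp
  have "\<bar>matrix_power A (Suc n) $ i $ k\<bar> \<le> (\<Sum>l\<in>UNIV. \<bar>A $ i $ l\<bar> * \<bar>matrix_power A n $ l $ k\<bar>)"
    by (simp add: matrix_matrix_mult_def abs_mult[symmetric])
  also have "\<dots> \<le> (\<Sum>l\<in>UNIV. \<bar>A $ i $ l\<bar> * ?B ^ n)"
    by (intro sum_mono mult_left_mono Suc) simp
  also have "\<dots> = (\<Sum>l\<in>UNIV. \<bar>A $ i $ l\<bar>) * ?B ^ n" by (simp add: sum_distrib_right)
  also have "\<dots> \<le> ?B * ?B ^ n"
    using B by (intro mult_right_mono member_le_sum[of i UNIV "\<lambda>i. \<Sum>k\<in>UNIV. \<bar>A $ i $ k\<bar>"])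
        (auto intro: sum_nonneg)
  finally show ?case by simp
qed

text \<open>Each entry of \<open>matrix_exp (t *\<^sub>R A)\<close> is a power series in \<open>t\<close> with these coefficients, which reduces its
  calculus to that of real power series.\<close>

definition exp_coeff :: "real^'s^'s \<Rightarrow> 's \<Rightarrow> 's \<Rightarrow> nat \<Rightarrow> real" where
  "exp_coeff A i k n = matrix_power A n $ i $ k / fact n"

lemma summable_exp_coeff: "summable (\<lambda>n. exp_coeff A i k n * t ^ n)"
proof (rule summable_comparison_test)
  let ?B = "\<Sum>i\<in>UNIV. \<Sum>k\<in>UNIV. \<bar>A $ i $ k\<bar>"
  have "norm (exp_coeff A i k n * t ^ n) \<le> inverse (fact n) * (?B * \<bar>t\<bar>) ^ n" for n
    using mult_right_mono[OF matrix_power_bound[of A n i k], of "\<bar>t\<bar> ^ n"]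
    by (simp add: exp_coeff_def abs_mult power_abs power_mult_distrib divide_simps)
  then show "\<exists>N. \<forall>n\<ge>N. norm (exp_coeff A i k n * t ^ n) \<le> inverse (fact n) * (?B * \<bar>t\<bar>) ^ n" by blast
  show "summable (\<lambda>n. inverse (fact n) * (?B * \<bar>t\<bar>) ^ n)" by (rule summable_exp)
qed

lemma matrix_exp_nth: "matrix_exp (t *\<^sub>R A) $ i $ k = (\<Sum>n. exp_coeff A i k n * t ^ n)"
proof -
  have "(\<lambda>n. (1 / fact n) *\<^sub>R matrix_power (t *\<^sub>R A) n) sums (\<chi> i k. \<Sum>n. exp_coeff A i k n * t ^ n)"
    unfolding sums_def
  proof (intro vec_tendstoI)
    fix i k
    have "(\<lambda>n. exp_coeff A i k n * t ^ n) sums (\<Sum>n. exp_coeff A i k n * t ^ n)"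
      by (rule summable_sums[OF summable_exp_coeff])
    then show "(\<lambda>n. (\<Sum>n<n. (1 / fact n) *\<^sub>R matrix_power (t *\<^sub>R A) n) $ i $ k)
      \<longlonglongrightarrow> (\<chi> i k. \<Sum>n. exp_coeff A i k n * t ^ n) $ i $ k"
      by (simp add: sums_def matrix_power_scaleR exp_coeff_def field_simps)
  qed
  then have "matrix_exp (t *\<^sub>R A) = (\<chi> i k. \<Sum>n. exp_coeff A i k n * t ^ n)"
    unfolding matrix_exp_def by (rule sums_unique[symmetric])
  then show ?thesis by simp
qed

lemma matrix_exp_0: "matrix_exp (0 *\<^sub>R A) = mat 1"
  unfolding vec_eq_iff matrix_exp_nth powser_zero by (simp add: exp_coeff_def)

lemma diffs_exp_coeff:
  "diffs (exp_coeff A i k) n = (\<Sum>l\<in>UNIV. A $ i $ l * exp_coeff A l k n)"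
  "diffs (exp_coeff A i k) n = (\<Sum>l\<in>UNIV. exp_coeff A i l n * A $ l $ k)"
proof -
  have "diffs (exp_coeff A i k) n = matrix_power A (Suc n) $ i $ k / fact n"
    by (simp add: diffs_def exp_coeff_def del: matrix_power.simps)
  note * = this
  show "diffs (exp_coeff A i k) n = (\<Sum>l\<in>UNIV. A $ i $ l * exp_coeff A l k n)"
    unfolding * by (simp add: exp_coeff_def matrix_matrix_mult_def sum_divide_distrib)
  show "diffs (exp_coeff A i k) n = (\<Sum>l\<in>UNIV. exp_coeff A i l n * A $ l $ k)"
    unfolding * matrix_power_Suc' by (simp add: exp_coeff_def matrix_matrix_mult_def sum_divide_distrib)
qed

text \<open>Both forms of the derivative are used: the first for the growth of the exponential, the second to cancel
  the generator in variation of constants.\<close>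

lemma matrix_exp_has_vector_derivative:
  fixes A :: "real^'s^'s"
  shows "((\<lambda>t. matrix_exp (t *\<^sub>R A)) has_vector_derivative (A ** matrix_exp (t *\<^sub>R A))) (at t within S)"
    and "((\<lambda>t. matrix_exp (t *\<^sub>R A)) has_vector_derivative (matrix_exp (t *\<^sub>R A) ** A)) (at t within S)"
proof -
  have D: "((\<lambda>t. matrix_exp (t *\<^sub>R A) $ i $ k) has_vector_derivative (\<Sum>n. diffs (exp_coeff A i k) n * t ^ n))
      (at t within S)" for i k
  proof -
    have "((\<lambda>t. \<Sum>n. exp_coeff A i k n * t ^ n) has_field_derivative (\<Sum>n. diffs (exp_coeff A i k) n * t ^ n))
        (at t)"
      by (rule termdiffs_strong_converges_everywhere) (rule summable_exp_coeff)
    then show ?thesis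
      unfolding matrix_exp_nth has_real_derivative_iff_has_vector_derivative
      by (rule has_vector_derivative_at_within)
  qed
  have "(\<Sum>n. diffs (exp_coeff A i k) n * t ^ n) = (A ** matrix_exp (t *\<^sub>R A)) $ i $ k" for i k
  proof -
    have "(\<Sum>n. diffs (exp_coeff A i k) n * t ^ n) = (\<Sum>n. \<Sum>l\<in>UNIV. A $ i $ l * (exp_coeff A l k n * t ^ n))"
      by (simp add: diffs_exp_coeff(1) sum_distrib_right mult.assoc)
    also have "\<dots> = (\<Sum>l\<in>UNIV. \<Sum>n. A $ i $ l * (exp_coeff A l k n * t ^ n))"
      by (intro suminf_sum summable_mult summable_exp_coeff)
    also have "\<dots> = (A ** matrix_exp (t *\<^sub>R A)) $ i $ k"
      by (simp add: suminf_mult[OF summable_exp_coeff] matrix_matrix_mult_def matrix_exp_nth)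
    finally show ?thesis .
  qed
  then show "((\<lambda>t. matrix_exp (t *\<^sub>R A)) has_vector_derivative (A ** matrix_exp (t *\<^sub>R A))) (at t within S)"
    using D by (intro has_vector_derivative_vecI) simp
  have "(\<Sum>n. diffs (exp_coeff A i k) n * t ^ n) = (matrix_exp (t *\<^sub>R A) ** A) $ i $ k" for i k
  proof -
    have "(\<Sum>n. diffs (exp_coeff A i k) n * t ^ n) = (\<Sum>n. \<Sum>l\<in>UNIV. A $ l $ k * (exp_coeff A i l n * t ^ n))"
      by (simp add: diffs_exp_coeff(2) sum_distrib_left mult_ac)
    also have "\<dots> = (\<Sum>l\<in>UNIV. \<Sum>n. A $ l $ k * (exp_coeff A i l n * t ^ n))"
      by (intro suminf_sum summable_mult summable_exp_coeff)
    also have "\<dots> = (matrix_exp (t *\<^sub>R A) ** A) $ i $ k"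
      by (simp add: suminf_mult[OF summable_exp_coeff] matrix_matrix_mult_def matrix_exp_nth)
        (simp add: mult.commute)
    finally show ?thesis .
  qed
  then show "((\<lambda>t. matrix_exp (t *\<^sub>R A)) has_vector_derivative (matrix_exp (t *\<^sub>R A) ** A)) (at t within S)"
    using D by (intro has_vector_derivative_vecI) simp
qed

lemma continuous_on_matrix_exp:
  fixes g :: "real \<Rightarrow> real"
  assumes "continuous_on S g"
  shows "continuous_on S (\<lambda>t. matrix_exp (g t *\<^sub>R A))"
proof (rule continuous_on_compose2[OF _ assms subset_UNIV])
  show "continuous_on UNIV (\<lambda>t. matrix_exp (t *\<^sub>R A))"
    by (rule continuous_on_vector_derivative) (rule matrix_exp_has_vector_derivative(1))
qed

text \<open>The function \<open>s \<mapsto> matrix_exp ((t - s) *\<^sub>R A) ** g s\<close> has the derivative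
  \<open>matrix_exp ((t - s) *\<^sub>R A) ** b s\<close>; integrate over \<open>[0, t]\<close>.\<close>

lemma variation_of_constants:
  fixes A :: "real^'s^'s" and g b :: "real \<Rightarrow> real^'s^'s"
  assumes t: "0 \<le> t"
    and g: "\<And>s. 0 \<le> s \<Longrightarrow> (g has_vector_derivative (A ** g s + b s)) (at s within {0..})"
  shows "((\<lambda>s. matrix_exp ((t - s) *\<^sub>R A) ** b s) has_integral (g t - matrix_exp (t *\<^sub>R A) ** g 0)) {0..t}"
proof -
  have "((\<lambda>s. matrix_exp ((t - s) *\<^sub>R A) ** g s) has_vector_derivative (matrix_exp ((t - s) *\<^sub>R A) ** b s))
      (at s within {0..t})"
    if s: "s \<in> {0..t}" for s
  proof -
    have "((\<lambda>t. matrix_exp (t *\<^sub>R A)) \<circ> (\<lambda>s. t - s) has_vector_derivative (-1)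
        *\<^sub>R (matrix_exp ((t - s) *\<^sub>R A) ** A)) (at s within {0..t})"
      by (rule vector_diff_chain_within[OF _ matrix_exp_has_vector_derivative(2)])
         (auto intro!: derivative_eq_intros)
    then have E: "((\<lambda>s. matrix_exp ((t - s) *\<^sub>R A)) has_vector_derivative - (matrix_exp ((t - s) *\<^sub>R A) ** A))
        (at s within {0..t})"
      by (simp add: o_def)
    have G: "(g has_vector_derivative (A ** g s + b s)) (at s within {0..t})"
      using g[of s] s by (auto intro: has_vector_derivative_within_subset)
    have "((\<lambda>s. matrix_exp ((t - s) *\<^sub>R A) ** g s) has_vector_derivative
        (matrix_exp ((t - s) *\<^sub>R A) ** (A ** g s + b s) + (- (matrix_exp ((t - s) *\<^sub>R A) ** A)) ** g s))
            (at s within {0..t})"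
      by (rule bounded_bilinear.has_vector_derivative[OF bounded_bilinear_matrix_mult E G])
    moreover have "matrix_exp ((t - s) *\<^sub>R A) ** (A ** g s + b s) + (- (matrix_exp ((t - s) *\<^sub>R A) ** A)) ** g s
        = matrix_exp ((t - s) *\<^sub>R A) ** b s"
      by (simp add: matrix_add_ldistrib matrix_mul_assoc
          bounded_bilinear.minus_left[OF bounded_bilinear_matrix_mult])
    ultimately show ?thesis by simp
  qed
  from fundamental_theorem_of_calculus[OF t this]
  show ?thesis by (simp add: matrix_exp_0 del: scaleR_zero_left)
qed

section \<open>Conditioning and the Markov chain\<close>

text \<open>Independence enters through events \<open>B\<close> of a sub-\<open>\<sigma>\<close>-algebra \<open>H\<close>. It says that the law of \<open>U\<close> under \<open>M\<close>
  restricted to \<open>A\<close> is a multiple of the law of \<open>U\<close> under \<open>M\<close>.\<close>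

lemma (in prob_space) indep_nn_integral:
  fixes U :: "'a \<Rightarrow> ennreal"
  assumes A: "A \<in> events" and H: "space H = space M"
    "\<And>B. B \<in> sets H \<Longrightarrow> B \<in> events" "\<And>B. B \<in> sets H \<Longrightarrow> prob (A \<inter> B) = prob A * prob B"
    and U: "U \<in> borel_measurable H"
  shows "(\<integral>\<^sup>+\<omega>. U \<omega> * indicator A \<omega> \<partial>M) = emeasure M A * (\<integral>\<^sup>+\<omega>. U \<omega> \<partial>M)"
proof -
  have UM: "U \<in> borel_measurable M"
  proof (rule measurableI)
    fix B :: "ennreal set" assume "B \<in> sets borel"
    with U have "U -` B \<inter> space H \<in> sets H" by (rule measurable_sets)
    then show "U -` B \<inter> space M \<in> events" using H(1,2) by metis
  qed simp
  have ind: "(indicator A :: 'a \<Rightarrow> ennreal) \<in> borel_measurable M" using A by simp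
  have "distr (density M (indicator A)) borel U = scale_measure (emeasure M A) (distr M borel U)"
  proof (rule measure_eqI)
    fix B assume "B \<in> sets (distr (density M (indicator A)) borel U)"
    then have B: "B \<in> sets borel" by simp
    have BH: "U -` B \<inter> space M \<in> sets H" using measurable_sets[OF U B] H(1) by simp
    have "emeasure (distr (density M (indicator A)) borel U) B = emeasure (density M (indicator A))
        (U -` B \<inter> space M)"
      using UM B by (simp add: emeasure_distr)
    also have "\<dots> = emeasure M (A \<inter> (U -` B \<inter> space M))"
      using A H(2)[OF BH] by (subst emeasure_density) (auto simp: indicator_inter_arith[symmetric])
    also have "\<dots> = emeasure M A * emeasure M (U -` B \<inter> space M)"
      using H(3)[OF BH] by (simp add: emeasure_eq_measure ennreal_mult')
    finally show "emeasure (distr (density M (indicator A)) borel U) B =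
        emeasure (scale_measure (emeasure M A) (distr M borel U)) B"
      using UM B by (simp add: emeasure_distr)
  qed simp
  note eq = this
  have "(\<integral>\<^sup>+\<omega>. U \<omega> * indicator A \<omega> \<partial>M) = (\<integral>\<^sup>+\<omega>. U \<omega> \<partial>density M (indicator A))"
    using UM ind by (subst nn_integral_density) (auto simp: mult.commute)
  also have "\<dots> = (\<integral>\<^sup>+x. x \<partial>distr (density M (indicator A)) borel U)"
    using UM by (subst nn_integral_distr) auto
  also have "\<dots> = emeasure M A * (\<integral>\<^sup>+x. x \<partial>distr M borel U)"
    unfolding eq by (subst nn_integral_scale_measure) auto
  also have "(\<integral>\<^sup>+x. x \<partial>distr M borel U) = (\<integral>\<^sup>+\<omega>. U \<omega> \<partial>M)"
    using UM by (subst nn_integral_distr) auto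
  finally show ?thesis .
qed

lemma (in prob_space) indep_integral:
  fixes U :: "'a \<Rightarrow> real"
  assumes A: "A \<in> events" and H: "space H = space M"
    "\<And>B. B \<in> sets H \<Longrightarrow> B \<in> events" "\<And>B. B \<in> sets H \<Longrightarrow> prob (A \<inter> B) = prob A * prob B"
    and U [measurable]: "U \<in> borel_measurable H" and int: "integrable M U"
  shows "(\<integral>\<omega>. U \<omega> * indicator A \<omega> \<partial>M) = prob A * (\<integral>\<omega>. U \<omega> \<partial>M)"
proof -
  have 1: "(\<integral>\<^sup>+\<omega>. ennreal (U \<omega> * indicator A \<omega>) \<partial>M) = emeasure M A * (\<integral>\<^sup>+\<omega>. ennreal (U \<omega>) \<partial>M)"
  proof -
    have "(\<integral>\<^sup>+\<omega>. ennreal (U \<omega> * indicator A \<omega>) \<partial>M) = (\<integral>\<^sup>+\<omega>. ennreal (U \<omega>) * indicator A \<omega> \<partial>M)"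
      by (intro nn_integral_cong) (simp add: indicator_def)
    also have "\<dots> = emeasure M A * (\<integral>\<^sup>+\<omega>. ennreal (U \<omega>) \<partial>M)"
      by (intro indep_nn_integral[OF A H] measurable_compose[OF U measurable_ennreal])
    finally show ?thesis .
  qed
  have 2: "(\<integral>\<^sup>+\<omega>. ennreal (- (U \<omega> * indicator A \<omega>)) \<partial>M) = emeasure M A * (\<integral>\<^sup>+\<omega>. ennreal (- U \<omega>) \<partial>M)"
  proof -
    have "(\<integral>\<^sup>+\<omega>. ennreal (- (U \<omega> * indicator A \<omega>)) \<partial>M) = (\<integral>\<^sup>+\<omega>. ennreal (- U \<omega>) * indicator A \<omega> \<partial>M)"
      by (intro nn_integral_cong) (simp add: indicator_def)
    also have "\<dots> = emeasure M A * (\<integral>\<^sup>+\<omega>. ennreal (- U \<omega>) \<partial>M)"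
      by (intro indep_nn_integral[OF A H] measurable_compose[OF borel_measurable_uminus[OF U]
          measurable_ennreal])
    finally show ?thesis .
  qed
  have "integrable M (\<lambda>\<omega>. U \<omega> * indicator A \<omega>)"
    using integrable_mult_indicator[OF A int] by (simp add: mult.commute)
  from real_lebesgue_integral_def[OF this] real_lebesgue_integral_def[OF int]
  show ?thesis unfolding 1 2 by (simp add: emeasure_eq_measure enn2real_mult right_diff_distrib)
qed

locale map_setting = usual_filtered_prob_space M F
  for M :: "'w measure" and F :: "real \<Rightarrow> 'w measure" +
  fixes X :: "real \<Rightarrow> 'w \<Rightarrow> real" and J :: "real \<Rightarrow> 'w \<Rightarrow> 's::finite"
    and XL :: "'s \<Rightarrow> real \<Rightarrow> 'w \<Rightarrow> real" and Z :: "'s \<Rightarrow> 's \<Rightarrow> nat \<Rightarrow> 'w \<Rightarrow> real"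
    and Q :: "real^'s^'s"
  assumes map: "MAP M F X J"
    and intensity: "intensity_matrix M J Q"
    and path_structure: "map_path_structure M F X J XL Z"
    and square_integrable_1: "\<And>i. integrable (given_start M J i) (\<lambda>\<omega>. \<bar>X 1 \<omega>\<bar>\<^sup>2)"
begin

abbreviation state_at :: "real \<Rightarrow> 's \<Rightarrow> 'w set" where
  "state_at t i \<equiv> {\<omega> \<in> space M. J t \<omega> = i}"

abbreviation P :: "real \<Rightarrow> 's \<Rightarrow> 's \<Rightarrow> real" where
  "P \<equiv> transition_prob M J"

lemma space_F [simp]: "0 \<le> t \<Longrightarrow> space (F t) = space M"
  using subalg[of t] by (simp add: subalgebra_def)

lemma sets_F: "0 \<le> t \<Longrightarrow> A \<in> sets (F t) \<Longrightarrow> A \<in> events"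
  using subalg[of t] by (auto simp: subalgebra_def)

lemma X_measurable_F: "0 \<le> t \<Longrightarrow> X t \<in> borel_measurable (F t)"
  and J_measurable_F: "0 \<le> t \<Longrightarrow> J t \<in> measurable (F t) (count_space UNIV)"
  using map by (auto simp: MAP_def adapted_def)

lemma X_measurable [measurable]: "0 \<le> t \<Longrightarrow> X t \<in> borel_measurable M"
  using measurable_from_subalg[OF subalg X_measurable_F] .

lemma J_measurable [measurable]: "0 \<le> t \<Longrightarrow> J t \<in> measurable M (count_space UNIV)"
  using measurable_from_subalg[OF subalg J_measurable_F] .

lemma state_at_F: "0 \<le> s \<Longrightarrow> s \<le> t \<Longrightarrow> state_at s i \<in> sets (F t)"
proof -
  assume s: "0 \<le> s" "s \<le> t"
  have "J s -` {i} \<inter> space (F s) \<in> sets (F s)"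
    using J_measurable_F[OF s(1)] by (rule measurable_sets) simp
  moreover have "J s -` {i} \<inter> space (F s) = state_at s i" using s by auto
  ultimately show ?thesis using filtration_mono[OF s] by auto
qed

lemma state_at_events [measurable]: "0 \<le> s \<Longrightarrow> state_at s i \<in> events"
  by (rule sets_F[of s], assumption, rule state_at_F) simp_all

lemma J_cadlag: "\<omega> \<in> space M \<Longrightarrow> cadlag_in (discrete_topology UNIV) (\<lambda>t. J t \<omega>)"
  and X_0: "\<omega> \<in> space M \<Longrightarrow> X 0 \<omega> = 0"
  and start_pos: "0 < prob (state_at 0 i)"
  using map unfolding MAP_def by blast+

lemma space_given_start [simp]: "space (given_start M J i) = space M"
  and sets_given_start [simp, measurable_cong]: "sets (given_start M J i) = events"
  by (simp_all add: given_start_def)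

lemma prob_space_given_start: "prob_space (given_start M J i)"
  unfolding given_start_def using start_pos[of i]
  by (intro prob_space_uniform_measure) (simp_all add: emeasure_eq_measure)

lemma measure_given_start: "A \<in> events \<Longrightarrow> measure (given_start M J i) A = prob (state_at 0 i \<inter> A) / prob
    (state_at 0 i)"
  unfolding given_start_def using start_pos[of i]
  by (subst measure_uniform_measure) (auto simp: emeasure_eq_measure)

lemma given_start_density:
  "given_start M J i = density M (\<lambda>\<omega>. ennreal (indicator (state_at 0 i) \<omega> / prob (state_at 0 i)))"
  unfolding given_start_def uniform_measure_def using start_pos[of i]
  by (intro density_cong) (auto simp: emeasure_eq_measure divide_ennreal[symmetric] ennreal_indicator)

lemma integrable_given_start:
  fixes f :: "'w \<Rightarrow> real"
  assumes "f \<in> borel_measurable M"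
  shows "integrable (given_start M J i) f \<longleftrightarrow> integrable M (\<lambda>\<omega>. indicator (state_at 0 i) \<omega> * f \<omega>)"
proof -
  have "integrable (given_start M J i) f
      \<longleftrightarrow> integrable M (\<lambda>\<omega>. (indicator (state_at 0 i) \<omega> / prob (state_at 0 i)) *\<^sub>R f \<omega>)"
    unfolding given_start_density using assms by (subst integrable_density) auto
  also have "(\<lambda>\<omega>. (indicator (state_at 0 i) \<omega> / prob (state_at 0 i)) *\<^sub>R f \<omega>) =
      (\<lambda>\<omega>. (1 / prob (state_at 0 i)) * (indicator (state_at 0 i) \<omega> * f \<omega>))" by auto
  also have "integrable M \<dots> \<longleftrightarrow> integrable M (\<lambda>\<omega>. indicator (state_at 0 i) \<omega> * f \<omega>)"
    using start_pos[of i] by (subst integrable_mult_left_iff) auto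
  finally show ?thesis .
qed

lemma integral_given_start:
  fixes f :: "'w \<Rightarrow> real"
  assumes "f \<in> borel_measurable M"
  shows "integral\<^sup>L (given_start M J i) f = (\<integral>\<omega>. indicator (state_at 0 i) \<omega> * f \<omega> \<partial>M) / prob (state_at 0 i)"
proof -
  have "integral\<^sup>L (given_start M J i) f = (\<integral>\<omega>. (indicator (state_at 0 i) \<omega> / prob (state_at 0 i)) *\<^sub>R f \<omega> \<partial>M)"
    unfolding given_start_density using assms by (subst integral_density) auto
  also have "(\<lambda>\<omega>. (indicator (state_at 0 i) \<omega> / prob (state_at 0 i)) *\<^sub>R f \<omega>) =
      (\<lambda>\<omega>. (indicator (state_at 0 i) \<omega> * f \<omega>) / prob (state_at 0 i))" by auto
  finally show ?thesis by simp
qed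

text \<open>The Markov additive property in integrated form: multiplying by a weight \<open>V\<close> from the past and
  integrating removes the conditional expectation.\<close>

lemma map_integral:
  fixes V :: "'w \<Rightarrow> real" and f :: "real \<Rightarrow> real" and g :: "'s \<Rightarrow> real"
  assumes st: "0 \<le> s" "0 \<le> t" and V: "V \<in> borel_measurable (F s)" "\<And>\<omega>. \<bar>V \<omega>\<bar> \<le> L"
    and f: "f \<in> borel_measurable borel" "bounded (range f)"
  shows "(\<integral>\<omega>. V \<omega> * (f (X (s + t) \<omega> - X s \<omega>) * g (J (s + t) \<omega>)) \<partial>M) =
     (\<Sum>l\<in>UNIV. (\<integral>\<omega>. V \<omega> * indicator (state_at s l) \<omega> \<partial>M) * (\<integral>\<omega>. f (X t \<omega>) * g (J t \<omega>) \<partial>given_start M J l))"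
proof -
  interpret Fs: finite_measure_subalgebra M "F s"
    using subalg[OF st(1)] by unfold_locales
  define h where "h \<omega> = f (X (s + t) \<omega> - X s \<omega>) * g (J (s + t) \<omega>)" for \<omega>
  define c where "c l = (\<integral>\<omega>. f (X t \<omega>) * g (J t \<omega>) \<partial>given_start M J l)" for l
  have VM [measurable]: "V \<in> borel_measurable M"
    by (rule measurable_from_subalg[OF subalg[OF st(1)] V(1)])
  have hm [measurable]: "h \<in> borel_measurable M"
  proof -
    have st': "0 \<le> s + t" using st by simp
    show ?thesis
      unfolding h_def
      by (intro borel_measurable_times measurable_compose[OF _ f(1)] borel_measurable_diff
          X_measurable[OF st'] X_measurable[OF st(1)] measurable_compose[OF J_measurable[OF st']]) simp
  qed
  obtain K where K: "\<And>x. \<bar>f x\<bar> \<le> K" using f(2) by (auto simp: bounded_iff)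
  define G where "G = (\<Sum>i\<in>UNIV. \<bar>g i\<bar>)"
  have G: "\<bar>g i\<bar> \<le> G" for i unfolding G_def by (rule member_le_sum) auto
  have hb: "\<bar>h \<omega>\<bar> \<le> K * G" for \<omega>
    unfolding h_def abs_mult using K G by (intro mult_mono) (auto intro: order_trans[OF abs_ge_zero])
  have "AE \<omega> in M. real_cond_exp M (F s) h \<omega> =
      integral\<^sup>L (given_start M J (J s \<omega>)) (\<lambda>\<omega>. f (X t \<omega> - X 0 \<omega>) * g (J t \<omega>))"
    using map st f unfolding MAP_def h_def by blast
  moreover have "integral\<^sup>L (given_start M J l) (\<lambda>\<omega>. f (X t \<omega> - X 0 \<omega>) * g (J t \<omega>)) = c l" for l
    unfolding c_def by (intro Bochner_Integration.integral_cong) (simp_all add: X_0)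
  ultimately have ae: "AE \<omega> in M. real_cond_exp M (F s) h \<omega> = c (J s \<omega>)" by simp
  have L: "0 \<le> L" using V(2) by (rule order_trans[OF abs_ge_zero])
  have int: "integrable M (\<lambda>\<omega>. V \<omega> * h \<omega>)"
  proof (rule integrable_const_bound[of _ "L * (K * G)"])
    show "AE \<omega> in M. norm (V \<omega> * h \<omega>) \<le> L * (K * G)"
      using V(2) hb L by (intro AE_I2) (simp add: abs_mult mult_mono)
  qed measurable
  have VJ: "integrable M (\<lambda>\<omega>. V \<omega> * indicator (state_at s l) \<omega>)" for l
  proof (rule integrable_const_bound[of _ L])
    show "AE \<omega> in M. norm (V \<omega> * indicator (state_at s l) \<omega>) \<le> L"
      using V(2) L by (intro AE_I2) (simp add: indicator_def)
    show "(\<lambda>\<omega>. V \<omega> * indicator (state_at s l) \<omega>) \<in> borel_measurable M"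
      using state_at_events[OF st(1)] by measurable
  qed
  have "(\<integral>\<omega>. V \<omega> * h \<omega> \<partial>M) = (\<integral>\<omega>. V \<omega> * real_cond_exp M (F s) h \<omega> \<partial>M)"
    by (intro Fs.real_cond_exp_intg(2)[OF int, symmetric] V hm)
  also have "\<dots> = (\<integral>\<omega>. (\<Sum>l\<in>UNIV. V \<omega> * indicator (state_at s l) \<omega> * c l) \<partial>M)"
  proof (rule integral_cong_AE)
    show "(\<lambda>\<omega>. V \<omega> * real_cond_exp M (F s) h \<omega>) \<in> borel_measurable M"
      by measurable
    show "(\<lambda>\<omega>. \<Sum>l\<in>UNIV. V \<omega> * indicator (state_at s l) \<omega> * c l) \<in> borel_measurable M"
      using state_at_events[OF st(1)] by measurable
    show "AE \<omega> in M. V \<omega> * real_cond_exp M (F s) h \<omega> = (\<Sum>l\<in>UNIV. V \<omega> * indicator (state_at s l) \<omega> * c l)"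
      using ae
    proof (rule AE_mp, intro AE_I2 impI)
      fix \<omega> assume \<omega>: "\<omega> \<in> space M" "real_cond_exp M (F s) h \<omega> = c (J s \<omega>)"
      have "(\<Sum>l\<in>UNIV. V \<omega> * indicator (state_at s l) \<omega> * c l) = (\<Sum>l\<in>UNIV. if J s \<omega> = l then V \<omega> * c l else 0)"
        using \<omega>(1) by (intro sum.cong) (auto simp: indicator_def)
      then show "V \<omega> * real_cond_exp M (F s) h \<omega> = (\<Sum>l\<in>UNIV. V \<omega> * indicator (state_at s l) \<omega> * c l)"
        using \<omega>(2) by simp
    qed
  qed
  also have "\<dots> = (\<Sum>l\<in>UNIV. (\<integral>\<omega>. V \<omega> * indicator (state_at s l) \<omega> \<partial>M) * c l)"
    by (subst Bochner_Integration.integral_sum, intro integrable_mult_left VJ)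
       (intro sum.cong refl Bochner_Integration.integral_mult_left VJ)
  finally show ?thesis unfolding h_def c_def .
qed

lemma chain_step:
  assumes st: "0 \<le> s" "0 \<le> t" and A: "A \<in> sets (F s)"
  shows "prob (A \<inter> state_at s i \<inter> state_at (s + t) k) = prob (A \<inter> state_at s i) * P t i k"
proof -
  have AM: "A \<in> events" using sets_F[OF st(1) A] .
  have B: "A \<inter> state_at s i \<in> sets (F s)" using A state_at_F[of s s i] st by auto
  have V: "(\<integral>\<omega>. indicator (A \<inter> state_at s i) \<omega> * indicator (state_at s l) \<omega> \<partial>M)
      = prob (A \<inter> state_at s i \<inter> state_at s l)" for l
  proof -
    have "A \<inter> state_at s i \<inter> state_at s l \<inter> space M = A \<inter> state_at s i \<inter> state_at s l" by auto
    then show ?thesis unfolding indicator_inter_arith[symmetric] by simp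
  qed
  have "(\<integral>\<omega>. indicator (A \<inter> state_at s i) \<omega> * (1 * (of_bool (J (s + t) \<omega> = k) :: real)) \<partial>M) =
     (\<Sum>l\<in>UNIV. prob (A \<inter> state_at s i \<inter> state_at s l)
         * (\<integral>\<omega>. 1 * (of_bool (J t \<omega> = k) :: real) \<partial>given_start M J l))"
    unfolding V[symmetric]
    by (rule map_integral[OF st _ _, where f="\<lambda>_. 1" and g="\<lambda>l. of_bool (l = k)" and L=1])
        (auto intro!: borel_measurable_indicator B simp del: sets.Int)
  also have "(\<integral>\<omega>. indicator (A \<inter> state_at s i) \<omega> * (1 * (of_bool (J (s + t) \<omega> = k) :: real)) \<partial>M) =
     (\<integral>\<omega>. indicator (A \<inter> state_at s i \<inter> state_at (s + t) k) \<omega> \<partial>M)"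
    by (intro Bochner_Integration.integral_cong) (auto simp: indicator_def)
  also have "\<dots> = prob (A \<inter> state_at s i \<inter> state_at (s + t) k)"
    by (auto simp: Int_absorb2 intro!: arg_cong[where f=prob])
  also have "(\<Sum>l\<in>UNIV. prob (A \<inter> state_at s i \<inter> state_at s l)
      * (\<integral>\<omega>. 1 * (of_bool (J t \<omega> = k) :: real) \<partial>given_start M J l)) =
     (\<Sum>l\<in>UNIV. if i = l then prob (A \<inter> state_at s i) * P t i k else 0)"
  proof (intro sum.cong refl)
    fix l
    have "(\<integral>\<omega>. 1 * (of_bool (J t \<omega> = k) :: real) \<partial>given_start M J l)
        = (\<integral>\<omega>. indicator (state_at t k) \<omega> \<partial>given_start M J l)"
      by (intro Bochner_Integration.integral_cong) (auto simp: indicator_def)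
    also have "\<dots> = measure (given_start M J l) (state_at t k \<inter> space (given_start M J l))" by simp
    also have "state_at t k \<inter> space (given_start M J l) = state_at t k" by auto
    finally have c: "(\<integral>\<omega>. 1 * (of_bool (J t \<omega> = k) :: real) \<partial>given_start M J l) = P t l k"
      by (simp add: transition_prob_def)
    have "A \<inter> state_at s i \<inter> state_at s l = (if i = l then A \<inter> state_at s i else {})" by auto
    then show "prob (A \<inter> state_at s i \<inter> state_at s l)
        * (\<integral>\<omega>. 1 * (of_bool (J t \<omega> = k) :: real) \<partial>given_start M J l) =
      (if i = l then prob (A \<inter> state_at s i) * P t i k else 0)" unfolding c by simp
  qed
  finally show ?thesis by simp
qed

lemma P_bounds: "0 \<le> P t i k" "P t i k \<le> 1"
  using prob_space.prob_le_1[OF prob_space_given_start] by (simp_all add: transition_prob_def)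

lemma P_0: "P 0 i k = (if i = k then 1 else 0)"
proof -
  have "P 0 i k = prob (state_at 0 i \<inter> state_at 0 k) / prob (state_at 0 i)"
    by (simp add: transition_prob_def measure_given_start)
  also have "state_at 0 i \<inter> state_at 0 k = (if i = k then state_at 0 i else {})" by auto
  finally show ?thesis using start_pos[of i] by auto
qed

lemma P_derivative: "((\<lambda>h. (P h i k - P 0 i k) / h) \<longlongrightarrow> Q $ i $ k) (at_right 0)"
proof -
  have "((\<lambda>t. P t i k) has_real_derivative Q $ i $ k) (at 0 within {0..})"
    using intensity by (auto simp: intensity_matrix_def)
  then show ?thesis
    unfolding has_field_derivative_iff by (simp add: at_within_Ici_at_right)
qed

text \<open>Near \<open>0\<close> this is differentiability of the transition function, and away from \<open>0\<close> the left-hand side is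
  at most \<open>1\<close>.\<close>

lemma exit_rate: "\<exists>c>0. \<forall>i d. 0 \<le> d \<longrightarrow> 1 - P d i i \<le> c * d"
proof -
  have "\<exists>c>0. \<forall>d\<ge>0. 1 - P d i i \<le> c * d" for i
  proof -
    have "\<forall>\<^sub>F h in at_right 0. Q $ i $ i - 1 < (P h i i - P 0 i i) / h"
      using P_derivative[of i i] by (rule order_tendstoD) simp
    then obtain b where b: "0 < b" "\<And>h. 0 < h \<Longrightarrow> h < b \<Longrightarrow> Q $ i $ i - 1 < (P h i i - 1) / h"
      unfolding eventually_at_right_field P_0 by auto
    define c where "c = \<bar>Q $ i $ i - 1\<bar> + 1 / b"
    have "1 - P d i i \<le> c * d" if "0 \<le> d" for d
    proof (cases "d = 0 \<or> b \<le> d")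
      case True
      then show ?thesis
      proof
        assume "b \<le> d"
        then have "1 \<le> 1 / b * d" using b by (simp add: field_simps)
        also have "\<dots> \<le> c * d" using that by (intro mult_right_mono) (auto simp: c_def)
        finally show ?thesis using P_bounds(1)[of d i i] by linarith
      qed (simp add: P_0)
    next
      case False
      then have d: "0 < d" "d < b" using that by auto
      then have "(Q $ i $ i - 1) * d < P d i i - 1" using b(2)[of d] by (simp add: less_divide_eq)
      moreover have "- ((Q $ i $ i - 1) * d) \<le> c * d"
        using d b unfolding c_def minus_mult_left by (intro mult_right_mono) (auto intro: add_increasing2)
      ultimately show ?thesis by linarith
    qed
    moreover have "0 < c" using b by (auto simp: c_def intro: add_nonneg_pos)
    ultimately show ?thesis by blast
  qed
  then obtain c where c: "\<And>i. 0 < c i" "\<And>i d. 0 \<le> d \<Longrightarrow> 1 - P d i i \<le> c i * d" by metis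
  have "1 - P d i i \<le> (\<Sum>i\<in>UNIV. c i) * d" if "0 \<le> d" for i d
  proof -
    have "c i \<le> (\<Sum>i\<in>UNIV. c i)" using c(1) by (intro member_le_sum) (auto intro: less_imp_le)
    then show ?thesis using c(2)[OF that, of i] mult_right_mono[of "c i" _ d] that by (meson order_trans)
  qed
  moreover have "0 < (\<Sum>i\<in>UNIV. c i)" using c(1) by (intro sum_pos) auto
  ultimately show ?thesis by blast
qed

text \<open>A choice of the constant in \<open>exit_rate\<close>; it bounds the rates at which the states are left.\<close>

definition rate :: real where
  "rate = (SOME c. c > 0 \<and> (\<forall>i d. 0 \<le> d \<longrightarrow> 1 - P d i i \<le> c * d))"

lemma rate: "0 < rate" "0 \<le> d \<Longrightarrow> 1 - P d i i \<le> rate * d"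
  using someI_ex[OF exit_rate] unfolding rate_def by auto

lemma stay_prob:
  assumes s: "0 \<le> s" "0 \<le> d" and A: "A \<in> sets (F s)"
  shows "(1 - rate * d) * prob A \<le> prob (A \<inter> {\<omega>\<in>space M. J s \<omega> = J (s + d) \<omega>})"
    and "prob (A \<inter> {\<omega>\<in>space M. J s \<omega> \<noteq> J (s + d) \<omega>}) \<le> rate * d * prob A"
proof -
  have AM [measurable]: "A \<in> events" using sets_F[OF s(1) A] .
  have sd: "0 \<le> s + d" using s by simp
  note [measurable] = J_measurable[OF s(1)] J_measurable[OF sd]
  let ?S = "{\<omega>\<in>space M. J s \<omega> = J (s + d) \<omega>}"
  have Sm: "?S \<in> events" by measurable
  have split: "prob B = (\<Sum>i\<in>UNIV. prob (B \<inter> state_at s i))" if "B \<in> events" for B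
  proof -
    have "prob (\<Union>i\<in>UNIV. B \<inter> state_at s i) = (\<Sum>i\<in>UNIV. prob (B \<inter> state_at s i))"
      using that s by (intro finite_measure_finite_Union) (auto simp: disjoint_family_on_def)
    moreover have "(\<Union>i\<in>UNIV. B \<inter> state_at s i) = B" using sets.sets_into_space[OF that] by auto
    ultimately show ?thesis by simp
  qed
  have "(1 - rate * d) * prob A = (\<Sum>i\<in>UNIV. prob (A \<inter> state_at s i) * (1 - rate * d))"
    by (subst split[OF AM]) (simp add: sum_distrib_left mult.commute)
  also have "\<dots> \<le> (\<Sum>i\<in>UNIV. prob (A \<inter> state_at s i) * P d i i)"
    using rate(2)[OF s(2)] by (intro sum_mono mult_left_mono) (auto simp: algebra_simps)
  also have "\<dots> = (\<Sum>i\<in>UNIV. prob (A \<inter> state_at s i \<inter> state_at (s + d) i))"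
    by (simp add: chain_step[OF s A])
  also have "\<dots> = (\<Sum>i\<in>UNIV. prob (A \<inter> ?S \<inter> state_at s i))"
    by (intro sum.cong refl arg_cong[where f=prob]) auto
  also have "\<dots> = prob (A \<inter> ?S)" by (rule split[symmetric]) measurable
  finally show 1: "(1 - rate * d) * prob A \<le> prob (A \<inter> ?S)" .
  have "prob (A \<inter> {\<omega>\<in>space M. J s \<omega> \<noteq> J (s + d) \<omega>}) = prob (A - A \<inter> ?S)"
    using sets.sets_into_space[OF AM] by (intro arg_cong[where f=prob]) auto
  also have "\<dots> = prob A - prob (A \<inter> ?S)" using AM Sm by (intro finite_measure_Diff) auto
  also have "\<dots> \<le> rate * d * prob A" using 1 by (simp add: algebra_simps)
  finally show "prob (A \<inter> {\<omega>\<in>space M. J s \<omega> \<noteq> J (s + d) \<omega>}) \<le> rate * d * prob A" .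
qed

end

section \<open>Moments of Levy processes\<close>

lemma (in prob_space) indep_mult:
  fixes U V :: "'a \<Rightarrow> real"
  assumes G: "space G = space M" "sets G \<subseteq> events"
    and V: "V \<in> borel_measurable G" "integrable M V" and U: "integrable M U"
    and indep: "indep_set (sets G) (sets (vimage_algebra (space M) U borel))"
  shows "integrable M (\<lambda>\<omega>. V \<omega> * U \<omega>)"
    and "(\<integral>\<omega>. V \<omega> * U \<omega> \<partial>M) = (\<integral>\<omega>. V \<omega> \<partial>M) * (\<integral>\<omega>. U \<omega> \<partial>M)"
proof -
  have sub: "sigma_sets (space M) {V -` A \<inter> space M |A. A \<in> sets borel} \<subseteq> sets G"
    unfolding G(1)[symmetric] using measurable_sets[OF V(1)] by (intro sets.sigma_sets_subset) auto
  have "indep_set (sigma_sets (space M) {V -` A \<inter> space M |A. A \<in> sets borel})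
     (sigma_sets (space M) {U -` A \<inter> space M |A. A \<in> sets borel})"
    unfolding sets_vimage_algebra[symmetric]
  proof (rule indep_setI)
    show "sets (vimage_algebra (space M) V borel) \<subseteq> events"
      using sub G(2) unfolding sets_vimage_algebra by blast
    show "sets (vimage_algebra (space M) U borel) \<subseteq> events"
      using indep by (rule indep_setD_ev2)
    show "prob (a \<inter> b) = prob a * prob b"
      if "a \<in> sets (vimage_algebra (space M) V borel)" "b \<in> sets (vimage_algebra (space M) U borel)" for a b
      using that sub indep unfolding sets_vimage_algebra[of _ V] by (intro indep_setD[OF indep]) auto
  qed
  then have "indep_var borel V borel U"
    using V(2) U by (simp add: indep_var_eq borel_measurable_integrable)
  from indep_var_integrable[OF this V(2) U] indep_var_lebesgue_integral[OF this V(2) U]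
  show "integrable M (\<lambda>\<omega>. V \<omega> * U \<omega>)"
    "(\<integral>\<omega>. V \<omega> * U \<omega> \<partial>M) = (\<integral>\<omega>. V \<omega> \<partial>M) * (\<integral>\<omega>. U \<omega> \<partial>M)" .
qed

lemma (in prob_space) integrable_of_square:
  fixes U :: "'a \<Rightarrow> real"
  assumes "U \<in> borel_measurable M" "integrable M (\<lambda>\<omega>. (U \<omega>)\<^sup>2)"
  shows "integrable M U"
proof (rule Bochner_Integration.integrable_bound)
  show "integrable M (\<lambda>\<omega>. 1 + (U \<omega>)\<^sup>2)" using assms by simp
  show "AE \<omega> in M. norm (U \<omega>) \<le> norm (1 + (U \<omega>)\<^sup>2)"
  proof (rule AE_I2)
    fix \<omega>
    have "0 \<le> (\<bar>U \<omega>\<bar> - 1)\<^sup>2" by simp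
    then have "2 * \<bar>U \<omega>\<bar> \<le> 1 + (U \<omega>)\<^sup>2" by (simp add: power2_diff)
    then show "norm (U \<omega>) \<le> norm (1 + (U \<omega>)\<^sup>2)" by simp
  qed
qed fact

lemma square_add_le: "((a::real) + b)\<^sup>2 \<le> 2 * a\<^sup>2 + 2 * b\<^sup>2"
  using sum_squares_bound[of a b] by (simp add: power2_sum)

lemma integrable_square_add:
  fixes U V :: "'a \<Rightarrow> real"
  assumes [measurable]: "U \<in> borel_measurable M" "V \<in> borel_measurable M"
    and "integrable M (\<lambda>\<omega>. (U \<omega>)\<^sup>2)" "integrable M (\<lambda>\<omega>. (V \<omega>)\<^sup>2)"
  shows "integrable M (\<lambda>\<omega>. (U \<omega> + V \<omega>)\<^sup>2)"
proof (rule Bochner_Integration.integrable_bound)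
  show "integrable M (\<lambda>\<omega>. 2 * (U \<omega>)\<^sup>2 + 2 * (V \<omega>)\<^sup>2)" using assms by simp
  show "AE \<omega> in M. norm ((U \<omega> + V \<omega>)\<^sup>2) \<le> norm (2 * (U \<omega>)\<^sup>2 + 2 * (V \<omega>)\<^sup>2)"
    by (intro AE_I2) (simp add: square_add_le)
qed simp

lemma integrable_mult_squares:
  fixes U V :: "'a \<Rightarrow> real"
  assumes [measurable]: "U \<in> borel_measurable M" "V \<in> borel_measurable M"
    and "integrable M (\<lambda>\<omega>. (U \<omega>)\<^sup>2)" "integrable M (\<lambda>\<omega>. (V \<omega>)\<^sup>2)"
  shows "integrable M (\<lambda>\<omega>. U \<omega> * V \<omega>)"
proof (rule Bochner_Integration.integrable_bound)
  show "integrable M (\<lambda>\<omega>. (U \<omega>)\<^sup>2 + (V \<omega>)\<^sup>2)" using assms by simp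
  show "AE \<omega> in M. norm (U \<omega> * V \<omega>) \<le> norm ((U \<omega>)\<^sup>2 + (V \<omega>)\<^sup>2)"
  proof (rule AE_I2)
    fix \<omega>
    have "2 * (\<bar>U \<omega>\<bar> * \<bar>V \<omega>\<bar>) \<le> (U \<omega>)\<^sup>2 + (V \<omega>)\<^sup>2"
      using sum_squares_bound[of "\<bar>U \<omega>\<bar>" "\<bar>V \<omega>\<bar>"] by simp
    moreover have "0 \<le> \<bar>U \<omega>\<bar> * \<bar>V \<omega>\<bar>" by simp
    ultimately have "\<bar>U \<omega>\<bar> * \<bar>V \<omega>\<bar> \<le> (U \<omega>)\<^sup>2 + (V \<omega>)\<^sup>2" by linarith
    then show "norm (U \<omega> * V \<omega>) \<le> norm ((U \<omega>)\<^sup>2 + (V \<omega>)\<^sup>2)" by (simp add: abs_mult)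
  qed
qed simp

text \<open>Since \<open>V\<^sup>2 \<le> 2 (V + U)\<^sup>2 + 2 n\<^sup>2\<close> where \<open>U\<close> is bounded by \<open>n\<close>, and independence splits off
  the probability of that event, it suffices to take \<open>n\<close> so large that this probability is positive.\<close>

lemma (in prob_space) indep_summand_square_integrable:
  fixes U V :: "'a \<Rightarrow> real"
  assumes G: "space G = space M" "sets G \<subseteq> events"
    and V: "V \<in> borel_measurable G" and U [measurable]: "U \<in> borel_measurable M"
    and indep: "indep_set (sets G) (sets (vimage_algebra (space M) U borel))"
    and sq: "integrable M (\<lambda>\<omega>. (V \<omega> + U \<omega>)\<^sup>2)"
  shows "integrable M (\<lambda>\<omega>. (V \<omega>)\<^sup>2)"
proof -
  have VM [measurable]: "V \<in> borel_measurable M"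
    using V G by (auto simp: measurable_def)
  define B where "B n = {\<omega>\<in>space M. \<bar>U \<omega>\<bar> \<le> real n}" for n
  have Bm [measurable]: "B n \<in> events" for n unfolding B_def by measurable
  have "incseq B" by (auto simp: incseq_def B_def)
  then have "(\<lambda>n. prob (B n)) \<longlonglongrightarrow> prob (\<Union>n. B n)"
    by (intro finite_Lim_measure_incseq) auto
  moreover have "(\<Union>n. B n) = space M"
    using real_arch_simple by (auto simp: B_def)
  ultimately have "(\<lambda>n. prob (B n)) \<longlonglongrightarrow> 1" by (simp add: prob_space)
  then have "\<forall>\<^sub>F n in sequentially. 0 < prob (B n)" by (rule order_tendstoD) simp
  then obtain n where n: "0 < prob (B n)" by (auto simp: eventually_sequentially)
  have BU: "B n \<in> sets (vimage_algebra (space M) U borel)"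
  proof -
    have "U -` {- real n..real n} \<inter> space M \<in> sets (vimage_algebra (space M) U borel)"
      by (rule in_vimage_algebra) simp
    moreover have "U -` {- real n..real n} \<inter> space M = B n" by (auto simp: B_def)
    ultimately show ?thesis by simp
  qed
  have "emeasure M (B n) * (\<integral>\<^sup>+\<omega>. ennreal ((V \<omega>)\<^sup>2) \<partial>M) = (\<integral>\<^sup>+\<omega>. ennreal ((V \<omega>)\<^sup>2) * indicator (B n) \<omega> \<partial>M)"
  proof (rule indep_nn_integral[symmetric, OF Bm G(1)])
    show "C \<in> events" if "C \<in> sets G" for C using that G by auto
    show "prob (B n \<inter> C) = prob (B n) * prob C" if "C \<in> sets G" for C
      using indep_setD[OF indep that BU] by (simp add: Int_commute mult.commute)
    show "(\<lambda>\<omega>. ennreal ((V \<omega>)\<^sup>2)) \<in> borel_measurable G"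
      using V by measurable
  qed
  also have "\<dots> \<le> (\<integral>\<^sup>+\<omega>. ennreal (2 * (V \<omega> + U \<omega>)\<^sup>2 + 2 * (real n)\<^sup>2) \<partial>M)"
  proof (intro nn_integral_mono)
    fix \<omega> assume \<omega>: "\<omega> \<in> space M"
    show "ennreal ((V \<omega>)\<^sup>2) * indicator (B n) \<omega> \<le> ennreal (2 * (V \<omega> + U \<omega>)\<^sup>2 + 2 * (real n)\<^sup>2)"
    proof (cases "\<omega> \<in> B n")
      case True
      have "(V \<omega>)\<^sup>2 = ((V \<omega> + U \<omega>) + (- U \<omega>))\<^sup>2" by simp
      also have "\<dots> \<le> 2 * (V \<omega> + U \<omega>)\<^sup>2 + 2 * (- U \<omega>)\<^sup>2"
        by (rule square_add_le)
      also have "(- U \<omega>)\<^sup>2 \<le> (real n)\<^sup>2" using True by (simp add: B_def abs_le_square_iff[symmetric])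
      finally show ?thesis using True by (simp add: ennreal_leI del: ennreal_plus)
    qed (simp add: B_def)
  qed
  also have "\<dots> < \<infinity>"
    using sq by (subst nn_integral_eq_integral) auto
  finally have "emeasure M (B n) * (\<integral>\<^sup>+\<omega>. ennreal ((V \<omega>)\<^sup>2) \<partial>M) < \<infinity>" .
  then have "(\<integral>\<^sup>+\<omega>. ennreal ((V \<omega>)\<^sup>2) \<partial>M) < \<infinity>"
    using n by (auto simp: ennreal_mult_less_top emeasure_eq_measure)
  then show ?thesis by (intro integrableI_bounded) auto
qed

context usual_filtered_prob_space
begin

lemma F_space_sets: "0 \<le> t \<Longrightarrow> space (F t) = space M" "0 \<le> t \<Longrightarrow> sets (F t) \<subseteq> events"
  using subalg[of t] by (simp_all add: subalgebra_def)

context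
  fixes Y :: "real \<Rightarrow> 'w \<Rightarrow> real"
  assumes levy: "levy_process M F Y"
begin

lemma levy_measurable_F: "0 \<le> s \<Longrightarrow> s \<le> t \<Longrightarrow> Y s \<in> borel_measurable (F t)"
proof -
  assume st: "0 \<le> s" "s \<le> t"
  have "Y s \<in> borel_measurable (F s)" using levy st by (simp add: levy_process_def adapted_def)
  moreover have "subalgebra (F t) (F s)"
    using st filtration_mono[OF st] F_space_sets(1)[of s] F_space_sets(1)[of t] by (simp add: subalgebra_def)
  ultimately show ?thesis by (rule measurable_from_subalg[rotated])
qed

lemma levy_measurable: "0 \<le> t \<Longrightarrow> Y t \<in> borel_measurable M"
  by (rule measurable_from_subalg[OF subalg levy_measurable_F]) auto

lemma levy_cadlag: "\<omega> \<in> space M \<Longrightarrow> cadlag_in euclidean (\<lambda>t. Y t \<omega>)"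
  and levy_0: "AE \<omega> in M. Y 0 \<omega> = 0"
  and levy_indep: "0 \<le> s \<Longrightarrow> s \<le> t \<Longrightarrow>
    indep_set (sets (F s)) (sets (vimage_algebra (space M) (\<lambda>\<omega>. Y t \<omega> - Y s \<omega>) borel))"
  and levy_stationary: "0 \<le> s \<Longrightarrow> s \<le> t \<Longrightarrow> distr M borel (\<lambda>\<omega>. Y t \<omega> - Y s \<omega>) = distr M borel (Y (t - s))"
  using levy unfolding levy_process_def by blast+

lemma levy_increment_integrable:
  assumes "0 \<le> s" "s \<le> t" and g: "g \<in> borel_measurable borel"
  shows "integrable M (\<lambda>\<omega>. (g (Y t \<omega> - Y s \<omega>)) :: real) \<longleftrightarrow> integrable M (\<lambda>\<omega>. g (Y (t - s) \<omega>))"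
    and "(\<integral>\<omega>. (g (Y t \<omega> - Y s \<omega>)) \<partial>M) = (\<integral>\<omega>. g (Y (t - s) \<omega>) \<partial>M)"
proof -
  have [measurable]: "Y t \<in> borel_measurable M" "Y s \<in> borel_measurable M" "Y (t - s) \<in> borel_measurable M"
    using assms by (auto intro!: levy_measurable)
  note st = levy_stationary[OF assms(1,2)]
  show "integrable M (\<lambda>\<omega>. g (Y t \<omega> - Y s \<omega>)) \<longleftrightarrow> integrable M (\<lambda>\<omega>. g (Y (t - s) \<omega>))"
    using g integrable_distr_eq[of "\<lambda>\<omega>. Y t \<omega> - Y s \<omega>" M borel g] integrable_distr_eq[of
        "Y (t - s)" M borel g] st
    by simp
  show "(\<integral>\<omega>. g (Y t \<omega> - Y s \<omega>) \<partial>M) = (\<integral>\<omega>. g (Y (t - s) \<omega>) \<partial>M)"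
    using g integral_distr[of "\<lambda>\<omega>. Y t \<omega> - Y s \<omega>" M borel g] integral_distr[of "Y (t - s)" M borel g] st
    by simp
qed

context
  assumes sq1: "integrable M (\<lambda>\<omega>. (Y 1 \<omega>)\<^sup>2)"
begin

text \<open>Square integrability passes from \<open>t\<close> to \<open>2 t\<close> by stationarity of the increments, and from a larger to a
  smaller time because \<open>Y t\<close> is a summand with an independent complement.\<close>

lemma levy_square_integrable:
  assumes t: "0 \<le> t"
  shows "integrable M (\<lambda>\<omega>. (Y t \<omega>)\<^sup>2)"
proof -
  have pow: "integrable M (\<lambda>\<omega>. (Y (2 ^ n) \<omega>)\<^sup>2)" for n :: nat
  proof (induction n)
    case 0 then show ?case using sq1 by simp
  next
    case (Suc n)
    let ?t = "2 ^ n :: real"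
    have [measurable]: "Y ?t \<in> borel_measurable M" "Y (2 * ?t) \<in> borel_measurable M"
      by (auto intro!: levy_measurable)
    have "integrable M (\<lambda>\<omega>. (Y (2 * ?t) \<omega> - Y ?t \<omega>)\<^sup>2) \<longleftrightarrow> integrable M (\<lambda>\<omega>. (Y (2 * ?t - ?t) \<omega>)\<^sup>2)"
      by (rule levy_increment_integrable(1)) auto
    then have "integrable M (\<lambda>\<omega>. (Y (2 * ?t) \<omega> - Y ?t \<omega>)\<^sup>2)" using Suc by simp
    then have "integrable M (\<lambda>\<omega>. (Y ?t \<omega> + (Y (2 * ?t) \<omega> - Y ?t \<omega>))\<^sup>2)"
      by (intro integrable_square_add Suc) measurable
    then show ?case by simp
  qed
  obtain n :: nat where n: "t < 2 ^ n" using real_arch_pow[of 2 t] by auto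
  have [measurable]: "Y t \<in> borel_measurable M" "Y (2 ^ n) \<in> borel_measurable M"
    using t by (auto intro!: levy_measurable)
  show ?thesis
  proof (rule indep_summand_square_integrable[where G="F t" and U="\<lambda>\<omega>. Y (2 ^ n) \<omega> - Y t \<omega>"])
    show "Y t \<in> borel_measurable (F t)" using t by (intro levy_measurable_F) auto
    show "indep_set (sets (F t)) (sets (vimage_algebra (space M) (\<lambda>\<omega>. Y (2 ^ n) \<omega> - Y t \<omega>) borel))"
      using t n by (intro levy_indep) auto
    show "integrable M (\<lambda>\<omega>. (Y t \<omega> + (Y (2 ^ n) \<omega> - Y t \<omega>))\<^sup>2)" using pow[of n] by simp
  qed (use F_space_sets t in auto)
qed

lemma levy_integrable: "0 \<le> t \<Longrightarrow> integrable M (Y t)"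
  by (rule integrable_of_square[OF levy_measurable levy_square_integrable])

lemma levy_increment_moments:
  assumes "0 \<le> s" "0 \<le> t"
  shows "integrable M (\<lambda>\<omega>. Y (s + t) \<omega> - Y s \<omega>)" "integrable M (\<lambda>\<omega>. (Y (s + t) \<omega> - Y s \<omega>)\<^sup>2)"
    "(\<integral>\<omega>. Y (s + t) \<omega> - Y s \<omega> \<partial>M) = expectation (Y t)"
    "(\<integral>\<omega>. (Y (s + t) \<omega> - Y s \<omega>)\<^sup>2 \<partial>M) = (\<integral>\<omega>. (Y t \<omega>)\<^sup>2 \<partial>M)"
  using levy_increment_integrable[of s "s + t" "\<lambda>x. x"] levy_increment_integrable[of s "s + t" "\<lambda>x. x\<^sup>2"]
    levy_integrable[of t] levy_square_integrable[of t] assms by auto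

lemma levy_moments_add:
  assumes st: "0 \<le> s" "0 \<le> t"
  shows "expectation (Y (s + t)) = expectation (Y s) + expectation (Y t)"
    and "(\<integral>\<omega>. (Y (s + t) \<omega>)\<^sup>2 \<partial>M) =
      (\<integral>\<omega>. (Y s \<omega>)\<^sup>2 \<partial>M) + 2 * expectation (Y s) * expectation (Y t) + (\<integral>\<omega>. (Y t \<omega>)\<^sup>2 \<partial>M)"
proof -
  let ?D = "\<lambda>\<omega>. Y (s + t) \<omega> - Y s \<omega>"
  note D = levy_increment_moments[OF st]
  have "expectation (Y (s + t)) = (\<integral>\<omega>. Y s \<omega> + ?D \<omega> \<partial>M)" by simp
  also have "\<dots> = expectation (Y s) + expectation (Y t)"
    using D levy_integrable[OF st(1)] by (subst Bochner_Integration.integral_add) auto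
  finally show "expectation (Y (s + t)) = expectation (Y s) + expectation (Y t)" .
  have m: "integrable M (\<lambda>\<omega>. Y s \<omega> * ?D \<omega>)" "(\<integral>\<omega>. Y s \<omega> * ?D \<omega> \<partial>M) = expectation (Y s) * (\<integral>\<omega>. ?D \<omega> \<partial>M)"
    by (rule indep_mult[OF F_space_sets[OF st(1)] levy_measurable_F[OF st(1) order_refl]
        levy_integrable[OF st(1)] D(1)],
        rule levy_indep, use st in simp_all)+
  have "(\<integral>\<omega>. (Y (s + t) \<omega>)\<^sup>2 \<partial>M) = (\<integral>\<omega>. (Y s \<omega>)\<^sup>2 + 2 * (Y s \<omega> * ?D \<omega>) + (?D \<omega>)\<^sup>2 \<partial>M)"
    by (intro Bochner_Integration.integral_cong) (auto simp: power2_eq_square algebra_simps)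
  also have "\<dots> = (\<integral>\<omega>. (Y s \<omega>)\<^sup>2 \<partial>M) + 2 * (\<integral>\<omega>. Y s \<omega> * ?D \<omega> \<partial>M) + (\<integral>\<omega>. (?D \<omega>)\<^sup>2 \<partial>M)"
    using m(1) D(2) levy_square_integrable[OF st(1)] by simp
  finally show "(\<integral>\<omega>. (Y (s + t) \<omega>)\<^sup>2 \<partial>M) =
      (\<integral>\<omega>. (Y s \<omega>)\<^sup>2 \<partial>M) + 2 * expectation (Y s) * expectation (Y t) + (\<integral>\<omega>. (Y t \<omega>)\<^sup>2 \<partial>M)"
    using m(2) D(3,4) by simp
qed

text \<open>The variance is additive in time and bounded by its value at \<open>1\<close> on \<open>[0, 1]\<close>.\<close>

lemma levy_variance:
  assumes t: "0 \<le> t"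
  shows "variance (Y t) = t * variance (Y 1)"
proof -
  have add: "variance (Y (s + t)) = variance (Y s) + variance (Y t)" if "0 \<le> s" "0 \<le> t" for s t
  proof -
    have v: "variance (Y r) = (\<integral>\<omega>. (Y r \<omega>)\<^sup>2 \<partial>M) - (expectation (Y r))\<^sup>2" if "0 \<le> r" for r
      by (rule variance_eq[OF levy_integrable[OF that] levy_square_integrable[OF that]])
    have "variance (Y (s + t)) = (\<integral>\<omega>. (Y (s + t) \<omega>)\<^sup>2 \<partial>M) - (expectation (Y (s + t)))\<^sup>2"
      using that by (intro v) simp
    also have "\<dots> = ((\<integral>\<omega>. (Y s \<omega>)\<^sup>2 \<partial>M) - (expectation (Y s))\<^sup>2) + ((\<integral>\<omega>. (Y t \<omega>)\<^sup>2 \<partial>M) - (expectation (Y t))\<^sup>2)"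
      unfolding levy_moments_add[OF that] by (simp add: power2_sum)
    also have "\<dots> = variance (Y s) + variance (Y t)"
      unfolding v[OF that(1)] v[OF that(2)] ..
    finally show ?thesis .
  qed
  show ?thesis
  proof (rule bounded_additive_is_linear[OF add, of 1 "variance (Y 1)"])
    show "\<bar>variance (Y x)\<bar> \<le> variance (Y 1)" if "0 \<le> x" "x \<le> 1" for x
      using add[of x "1 - x"] that variance_positive[of "Y x"] variance_positive[of "Y (1 - x)"] by simp
  qed (use t in auto)
qed

text \<open>The mean is additive in time, so boundedness near \<open>0\<close> suffices. Suppose that the mean stayed above \<open>2\<close> in
  absolute value along times tending to \<open>0\<close>. By Chebyshev's inequality \<open>Y\<close> at these times would be within
  \<open>1\<close> of its mean with probability close to \<open>1\<close>, whereas right continuity makes \<open>Y\<close> small there with probability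
  close to \<open>1\<close>.\<close>

lemma levy_mean:
  assumes t: "0 \<le> t"
  shows "expectation (Y t) = t * expectation (Y 1)"
proof -
  have "\<exists>a>0. \<forall>h. 0 \<le> h \<longrightarrow> h \<le> a \<longrightarrow> \<bar>expectation (Y h)\<bar> \<le> 2"
  proof (rule ccontr)
    assume "\<not> ?thesis"
    then have "\<forall>n. \<exists>h. 0 \<le> h \<and> h \<le> 1 / real (Suc n) \<and> 2 < \<bar>expectation (Y h)\<bar>"
      by (metis not_le of_nat_0_less_iff zero_less_Suc zero_less_divide_1_iff)
    then obtain h where h: "\<And>n. 0 \<le> h n" "\<And>n. h n \<le> 1 / real (Suc n)" "\<And>n. 2 < \<bar>expectation (Y (h n))\<bar>"
      by metis
    have h0: "h \<longlonglongrightarrow> 0"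
      by (rule tendsto_sandwich[OF _ _ tendsto_const LIMSEQ_Suc[OF lim_1_over_n]])
         (use h in \<open>auto intro!: always_eventually\<close>)
    have [measurable]: "Y (h n) \<in> borel_measurable M" for n by (rule levy_measurable[OF h(1)])
    define B where "B n = {\<omega>\<in>space M. 1 \<le> \<bar>Y (h n) \<omega>\<bar>}" for n
    have [measurable]: "B n \<in> events" for n unfolding B_def by measurable
    have "(\<lambda>n. \<integral>\<omega>. indicator (B n) \<omega> \<partial>M) \<longlonglongrightarrow> (\<integral>\<omega>. (0::real) \<partial>M)"
    proof (rule integral_dominated_convergence[where w="\<lambda>_. 1"])
      show "AE \<omega> in M. (\<lambda>n. indicator (B n) \<omega> :: real) \<longlonglongrightarrow> 0"
        using levy_0
      proof (rule AE_mp, intro AE_I2 impI)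
        fix \<omega> assume \<omega>: "\<omega> \<in> space M" "Y 0 \<omega> = 0"
        have "((\<lambda>t. Y t \<omega>) \<longlongrightarrow> Y 0 \<omega>) (at_right 0)"
          using levy_cadlag[OF \<omega>(1)] by (simp add: cadlag_in_def)
        then have "continuous (at 0 within {0..}) (\<lambda>t. Y t \<omega>)"
          by (simp add: continuous_within at_within_Ici_at_right)
        then have "(\<lambda>n. Y (h n) \<omega>) \<longlonglongrightarrow> Y 0 \<omega>"
          by (rule continuous_within_tendsto_compose) (use h h0 in auto)
        then have "(\<lambda>n. \<bar>Y (h n) \<omega>\<bar>) \<longlonglongrightarrow> 0" using \<omega>(2) by (simp add: tendsto_rabs_zero)
        then have "\<forall>\<^sub>F n in sequentially. \<bar>Y (h n) \<omega>\<bar> < 1" by (rule order_tendstoD) simp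
        then have "\<forall>\<^sub>F n in sequentially. indicator (B n) \<omega> = (0::real)"
          by eventually_elim (simp add: B_def)
        then show "(\<lambda>n. indicator (B n) \<omega> :: real) \<longlonglongrightarrow> 0" by (rule tendsto_eventually)
      qed
    qed (auto simp: indicator_def)
    then have "(\<lambda>n. prob (B n)) \<longlonglongrightarrow> 0" by simp
    then have 1: "\<forall>\<^sub>F n in sequentially. prob (B n) < 1/2" by (rule order_tendstoD) simp
    have "(\<lambda>n. h n * variance (Y 1)) \<longlonglongrightarrow> 0 * variance (Y 1)" by (intro tendsto_intros h0)
    then have "(\<lambda>n. h n * variance (Y 1)) \<longlonglongrightarrow> 0" by simp
    then have 2: "\<forall>\<^sub>F n in sequentially. h n * variance (Y 1) < 1/2" by (rule order_tendstoD) simp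
    obtain n where n: "prob (B n) < 1/2" "h n * variance (Y 1) < 1/2"
      using eventually_conj[OF 1 2] by (auto simp: eventually_sequentially)
    define C where "C = {\<omega>\<in>space M. \<bar>Y (h n) \<omega> - expectation (Y (h n))\<bar> \<ge> 1}"
    have [measurable]: "C \<in> events" unfolding C_def by measurable
    have "prob C \<le> variance (Y (h n)) / 1\<^sup>2"
      unfolding C_def by (rule Chebyshev_inequality) (use h levy_square_integrable in auto)
    then have "prob C < 1/2" using n(2) levy_variance[OF h(1)[of n]] by simp
    moreover have "space M \<subseteq> B n \<union> C"
    proof
      fix \<omega> assume "\<omega> \<in> space M"
      then show "\<omega> \<in> B n \<union> C" using h(3)[of n] unfolding B_def C_def by (auto split: abs_split)
    qed
    then have "1 \<le> prob (B n \<union> C)" using finite_measure_mono[of "space M" "B n \<union> C"] by (simp add: prob_space)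
    moreover have "prob (B n \<union> C) \<le> prob (B n) + prob C" by (rule measure_Un_le) auto
    ultimately show False using n(1) by simp
  qed
  then obtain a where a: "0 < a" "\<And>h. 0 \<le> h \<Longrightarrow> h \<le> a \<Longrightarrow> \<bar>expectation (Y h)\<bar> \<le> 2" by blast
  show ?thesis
    by (rule bounded_additive_is_linear[OF levy_moments_add(1) a t])
qed

lemma levy_second_moment:
  assumes t: "0 \<le> t"
  shows "(\<integral>\<omega>. (Y t \<omega>)\<^sup>2 \<partial>M) = t * variance (Y 1) + t\<^sup>2 * (expectation (Y 1))\<^sup>2"
  using levy_variance[OF t] levy_mean[OF t] variance_eq[OF levy_integrable[OF t] levy_square_integrable[OF t]]
  by (simp add: power_mult_distrib)

text \<open>Different increments are independent with equal means, so the expectation of their product is a square.\<close>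

lemma levy_grid_products:
  assumes t: "0 \<le> t"
  defines "D n m \<omega> \<equiv> Y (grid t n (Suc m)) \<omega> - Y (grid t n m) \<omega>"
  shows "integrable M (\<lambda>\<omega>. D n m \<omega> * D n m' \<omega>)" "0 \<le> (\<integral>\<omega>. D n m \<omega> * D n m' \<omega> \<partial>M)"
proof -
  have d: "0 \<le> t / real n" using t by simp
  have D: "integrable M (D n m)" "integrable M (\<lambda>\<omega>. (D n m \<omega>)\<^sup>2)" "expectation (D n m)
      = expectation (Y (t / real n))" for m
    unfolding D_def grid_Suc using levy_increment_moments[OF grid_nonneg[OF t] d] by auto
  have lt: "integrable M (\<lambda>\<omega>. D n m \<omega> * D n m' \<omega>) \<and> 0 \<le> (\<integral>\<omega>. D n m \<omega> * D n m' \<omega> \<partial>M)" if "m < m'" for m m'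
  proof -
    have g: "0 \<le> grid t n m'" "grid t n m' \<le> grid t n (Suc m')" "0 \<le> grid t n (Suc m)" "grid t n (Suc m)
        \<le> grid t n m'" "0 \<le> grid t n m"
       "grid t n m \<le> grid t n m'"
      using t that unfolding grid_def by (auto intro!: divide_right_mono mult_left_mono)
    have Fm: "D n m \<in> borel_measurable (F (grid t n m'))"
      unfolding D_def using g by (intro borel_measurable_diff levy_measurable_F)
    have i: "indep_set (sets (F (grid t n m'))) (sets (vimage_algebra (space M) (D n m') borel))"
      unfolding D_def by (rule levy_indep) (use g in auto)
    show ?thesis
      using indep_mult[OF F_space_sets[OF g(1)] Fm D(1) D(1) i] D(3)[of m] D(3)[of m'] by simp
  qed
  consider "m < m'" | "m = m'" | "m' < m" by linarith
  then have "integrable M (\<lambda>\<omega>. D n m \<omega> * D n m' \<omega>) \<and> 0 \<le> (\<integral>\<omega>. D n m \<omega> * D n m' \<omega> \<partial>M)"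
  proof cases
    case 1 then show ?thesis by (rule lt)
  next
    case 2 then show ?thesis using D(2)[of m] by (simp add: power2_eq_square)
  next
    case 3 then show ?thesis using lt[OF 3] by (simp add: mult.commute)
  qed
  then show "integrable M (\<lambda>\<omega>. D n m \<omega> * D n m' \<omega>)" "0 \<le> (\<integral>\<omega>. D n m \<omega> * D n m' \<omega> \<partial>M)" by auto
qed

end
end
end

section \<open>The two parts of the process\<close>

text \<open>This is the form of Fatou's lemma that carries every bound from the grid to the limit.\<close>

lemma nn_integral_le_of_tendsto:
  fixes u :: "nat \<Rightarrow> 'a \<Rightarrow> ennreal"
  assumes "\<And>n. u n \<in> borel_measurable M" "AE \<omega> in M. (\<lambda>n. u n \<omega>) \<longlonglongrightarrow> v \<omega>"
    and "\<forall>\<^sub>F n in sequentially. (\<integral>\<^sup>+\<omega>. u n \<omega> \<partial>M) \<le> c"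
  shows "(\<integral>\<^sup>+\<omega>. v \<omega> \<partial>M) \<le> c"
proof -
  have "(\<integral>\<^sup>+\<omega>. v \<omega> \<partial>M) = (\<integral>\<^sup>+\<omega>. liminf (\<lambda>n. u n \<omega>) \<partial>M)"
    using assms(2) by (intro nn_integral_cong_AE) (auto elim!: eventually_mono simp: lim_imp_Liminf)
  also have "\<dots> \<le> liminf (\<lambda>n. \<integral>\<^sup>+\<omega>. u n \<omega> \<partial>M)"
    using assms(1) by (rule nn_integral_liminf)
  also have "\<dots> \<le> liminf (\<lambda>n::nat. c)"
    using assms(3) by (rule Liminf_mono)
  also have "\<dots> = c" by (rule Liminf_const) simp
  finally show ?thesis .
qed

lemma changes_before_eq_sum: "changes_before f t n m = (\<Sum>k<m. if grid_change f t n k then 1 else 0)"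
proof -
  have "{l. l < m \<and> grid_change f t n l} = {..<m} \<inter> {l. grid_change f t n l}" by auto
  then show ?thesis by (simp add: changes_before_def sum.If_cases)
qed

lemma changes_before_le: "changes_before f t n m \<le> m"
proof -
  have "changes_before f t n m \<le> card {..<m}"
    unfolding changes_before_def by (intro card_mono) auto
  then show ?thesis by simp
qed

text \<open>Step \<open>m\<close> of the grid is the change number \<open>l + 1\<close> and leads from \<open>i\<close> to \<open>j\<close>. On such an event the summand of
  \<open>grid_jump_sum\<close> has fixed arguments, which is what makes a random \<open>\<phi>\<close> tractable.\<close>

definition grid_event :: "(real \<Rightarrow> 's) \<Rightarrow> real \<Rightarrow> nat \<Rightarrow> nat \<times> 's \<times> 's \<times> nat \<Rightarrow> bool" where
  "grid_event f t n = (\<lambda>(m, i, j, l). grid_change f t n m \<and> f (grid t n m) = i \<and>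
     f (grid t n (Suc m)) = j \<and> changes_before f t n m = l)"

definition grid_index :: "nat \<Rightarrow> (nat \<times> 's::finite \<times> 's \<times> nat) set" where
  "grid_index n = {..<n} \<times> UNIV \<times> UNIV \<times> {..n}"

lemma finite_grid_index [simp]: "finite (grid_index n)"
  by (simp add: grid_index_def)

lemma grid_jump_sum_expand:
  fixes f :: "real \<Rightarrow> 's::finite"
  shows "grid_jump_sum f t n \<phi> =
    (\<Sum>(m, i, j, l)\<in>grid_index n. of_bool (grid_event f t n (m, i, j, l)) * \<phi> i j (Suc l))"
proof -
  have "(\<Sum>(m, i, j, l)\<in>grid_index n. of_bool (grid_event f t n (m, i, j, l)) * \<phi> i j (Suc l)) =
    (\<Sum>m<n. \<Sum>i\<in>UNIV. \<Sum>j\<in>UNIV. \<Sum>l\<le>n. of_bool (grid_event f t n (m, i, j, l)) * \<phi> i j (Suc l))"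
    by (simp only: grid_index_def sum.cartesian_product case_prod_unfold fst_conv snd_conv)
  also have "\<dots> = grid_jump_sum f t n \<phi>"
    unfolding grid_jump_sum_def
  proof (intro sum.cong refl)
    fix m assume "m \<in> {..<n}"
    then have cb: "changes_before f t n m \<le> n" using changes_before_le[of f t n m] by simp
    let ?x = "f (grid t n m)" and ?y = "f (grid t n (Suc m))" and ?k = "changes_before f t n m"
    define c where "c = (if grid_change f t n m then \<phi> ?x ?y (Suc ?k) else 0)"
    have inner: "(\<Sum>l\<le>n. of_bool (grid_event f t n (m, i, j, l)) * \<phi> i j (Suc l)) =
        (if ?x = i then if ?y = j then c else 0 else 0)" for i j
    proof -
      have "(\<Sum>l\<le>n. of_bool (grid_event f t n (m, i, j, l)) * \<phi> i j (Suc l)) =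
          (\<Sum>l\<le>n. if ?k = l then (if ?x = i then if ?y = j then c else 0 else 0) else 0)"
        by (intro sum.cong refl) (auto simp: grid_event_def c_def)
      then show ?thesis using cb by simp
    qed
    have "(\<Sum>i\<in>UNIV. \<Sum>j\<in>UNIV. \<Sum>l\<le>n. of_bool (grid_event f t n (m, i, j, l)) * \<phi> i j (Suc l)) =
        (\<Sum>i\<in>UNIV. if ?x = i then (\<Sum>j\<in>UNIV. if ?y = j then c else 0) else 0)"
      unfolding inner by (intro sum.cong refl) auto
    also have "\<dots> = (if grid_change f t n m then \<phi> ?x ?y (Suc ?k) else 0)"
      by (simp add: c_def)
    finally show "(\<Sum>i\<in>UNIV. \<Sum>j\<in>UNIV. \<Sum>l\<le>n. of_bool (grid_event f t n (m, i, j, l)) * \<phi> i j (Suc l)) =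
       (if grid_change f t n m then \<phi> ?x ?y (Suc ?k) else 0)" .
  qed
  finally show ?thesis ..
qed

text \<open>Summands along transitions that do not occur on the grid may be changed freely.\<close>

lemma grid_jump_sum_cong:
  fixes f :: "real \<Rightarrow> 's"
  assumes "\<And>i j. \<phi> i j \<noteq> \<psi> i j \<Longrightarrow> i \<noteq> j \<Longrightarrow> grid_jump_sum f t n (\<lambda>a b _. of_bool (a = i \<and> b = j)) = 0"
  shows "grid_jump_sum f t n \<phi> = grid_jump_sum f t n \<psi>"
  unfolding grid_jump_sum_def
proof (intro sum.cong refl if_cong)
  fix m assume m: "m \<in> {..<n}" "grid_change f t n m"
  let ?x = "f (grid t n m)" and ?y = "f (grid t n (Suc m))" and ?k = "changes_before f t n m"
  have "\<phi> ?x ?y = \<psi> ?x ?y"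
  proof (rule ccontr)
    assume "\<phi> ?x ?y \<noteq> \<psi> ?x ?y"
    then have "grid_jump_sum f t n (\<lambda>a b _. of_bool (a = ?x \<and> b = ?y)) = 0"
      using m by (intro assms) (auto simp: grid_change_def)
    then have "\<forall>k\<in>{..<n}. (if grid_change f t n k then of_bool (f (grid t n k) = ?x \<and> f (grid t n (Suc k))
        = ?y) else (0::real)) = 0"
      unfolding grid_jump_sum_def by (subst (asm) sum_nonneg_eq_0_iff) auto
    from bspec[OF this m(1)] m(2) show False by simp
  qed
  then show "\<phi> ?x ?y (Suc ?k) = \<psi> ?x ?y (Suc ?k)" by simp
qed

context map_setting
begin

definition chain_sigma :: "'w measure" where
  "chain_sigma = sigma (space M) (\<Union>t\<in>{0..}. {J t -` A \<inter> space M |A. A \<in> sets (count_space UNIV)})"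

definition levy_sigma :: "'s \<Rightarrow> 'w measure" where
  "levy_sigma i = sigma (space M) (\<Union>t\<in>{0..}. {XL i t -` A \<inter> space M |A. A \<in> sets borel})"

lemma space_chain_sigma [simp]: "space chain_sigma = space M" and sets_chain_sigma: "sets chain_sigma
    = process_sigma M (count_space UNIV) J"
  and space_levy_sigma [simp]: "space (levy_sigma i) = space M" and sets_levy_sigma: "sets (levy_sigma i)
      = process_sigma M borel (XL i)"
  unfolding chain_sigma_def levy_sigma_def process_sigma_def
  by (auto intro!: space_measure_of sets_measure_of)

lemma J_measurable_chain [measurable]: "0 \<le> t \<Longrightarrow> J t \<in> measurable chain_sigma (count_space UNIV)"
proof (rule measurableI)
  fix A :: "'s set" assume t: "0 \<le> t" and A: "A \<in> sets (count_space UNIV)"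
  have "J t -` A \<inter> space M \<in> process_sigma M (count_space UNIV) J"
    unfolding process_sigma_def using t A by (intro sigma_sets.Basic) auto
  then show "J t -` A \<inter> space chain_sigma \<in> sets chain_sigma" by (simp add: sets_chain_sigma)
qed simp

lemma XL_measurable_levy_sigma: "0 \<le> t \<Longrightarrow> XL i t \<in> borel_measurable (levy_sigma i)"
proof (rule measurableI)
  fix A :: "real set" assume t: "0 \<le> t" and A: "A \<in> sets borel"
  have "XL i t -` A \<inter> space M \<in> process_sigma M borel (XL i)"
    unfolding process_sigma_def using t A by (intro sigma_sets.Basic) auto
  then show "XL i t -` A \<inter> space (levy_sigma i) \<in> sets (levy_sigma i)" by (simp add: sets_levy_sigma)
qed simp

lemma levy: "levy_process M F (XL i)"
  and Z_measurable [measurable]: "i \<noteq> j \<Longrightarrow> 1 \<le> n \<Longrightarrow> Z i j n \<in> borel_measurable M"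
  and Z_distr: "i \<noteq> j \<Longrightarrow> 1 \<le> n \<Longrightarrow> distr M borel (Z i j n) = distr M borel (Z i j 1)"
  using path_structure unfolding map_path_structure_def by blast+

lemma XL_measurable [measurable]: "0 \<le> t \<Longrightarrow> XL i t \<in> borel_measurable M"
  by (rule levy_measurable[OF levy])

lemma sources_indep:
  "indep_sets (\<lambda>k. case k of Chain \<Rightarrow> sets chain_sigma | Levy j \<Rightarrow> sets (levy_sigma j)
      | Jump i j n \<Rightarrow> sets (vimage_algebra (space M) (Z i j n) borel))
    ({Chain} \<union> range Levy \<union> {Jump i j n |i j n. i \<noteq> j \<and> 1 \<le> n})"
  using path_structure unfolding map_path_structure_def sets_chain_sigma sets_levy_sigma by blast

lemma chain_sigma_events: "A \<in> sets chain_sigma \<Longrightarrow> A \<in> events"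
  and levy_sigma_events: "A \<in> sets (levy_sigma i) \<Longrightarrow> A \<in> events"
  using sources_indep unfolding indep_sets_def by force+

lemma chain_levy_indep:
  assumes "A \<in> sets chain_sigma" "B \<in> sets (levy_sigma i)"
  shows "prob (A \<inter> B) = prob A * prob B"
  using indep_setsD[OF sources_indep, of "{Chain, Levy i}" "\<lambda>k. if k = Chain then A else B"] assms
  by (auto simp: Int_commute)

lemma chain_jump_indep:
  assumes "A \<in> sets chain_sigma" "B \<in> sets (vimage_algebra (space M) (Z i j n) borel)" "i \<noteq> j" "1 \<le> n"
  shows "prob (A \<inter> B) = prob A * prob B"
  using indep_setsD[OF sources_indep, of "{Chain, Jump i j n}" "\<lambda>k. if k = Chain then A else B"] assms
  by (auto simp: Int_commute)

lemma chain_levy_nn_integral: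
  assumes "A \<in> sets chain_sigma" "U \<in> borel_measurable (levy_sigma i)"
  shows "(\<integral>\<^sup>+\<omega>. U \<omega> * indicator A \<omega> \<partial>M) = emeasure M A * (\<integral>\<^sup>+\<omega>. U \<omega> \<partial>M)"
  by (rule indep_nn_integral[OF chain_sigma_events[OF assms(1)] space_levy_sigma levy_sigma_events
      chain_levy_indep[OF assms(1)] assms(2)])

lemma chain_levy_integral:
  fixes U :: "'w \<Rightarrow> real"
  assumes "A \<in> sets chain_sigma" "U \<in> borel_measurable (levy_sigma i)" "integrable M U"
  shows "(\<integral>\<omega>. U \<omega> * indicator A \<omega> \<partial>M) = prob A * (\<integral>\<omega>. U \<omega> \<partial>M)"
  by (rule indep_integral[OF chain_sigma_events[OF assms(1)] space_levy_sigma levy_sigma_events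
      chain_levy_indep[OF assms(1)] assms(2,3)])

lemma Z_vimage_events: "i \<noteq> j \<Longrightarrow> 1 \<le> n \<Longrightarrow> B \<in> sets (vimage_algebra (space M) (Z i j n) borel) \<Longrightarrow> B \<in> events"
  using measurable_sets[OF Z_measurable] sets.sigma_sets_subset[of
      "{Z i j n -` A \<inter> space M |A. A \<in> sets borel}" M]
  unfolding sets_vimage_algebra by blast

lemma chain_jump_nn_integral:
  assumes A: "A \<in> sets chain_sigma" and ij: "i \<noteq> j" "1 \<le> n" and g: "g \<in> borel_measurable borel"
  shows "(\<integral>\<^sup>+\<omega>. g (Z i j n \<omega>) * indicator A \<omega> \<partial>M) = emeasure M A * (\<integral>\<^sup>+\<omega>. g (Z i j 1 \<omega>) \<partial>M)"
proof -
  have [measurable]: "Z i j n \<in> borel_measurable M" "Z i j 1 \<in> borel_measurable M" using ij by auto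
  have "(\<integral>\<^sup>+\<omega>. g (Z i j n \<omega>) * indicator A \<omega> \<partial>M) = emeasure M A * (\<integral>\<^sup>+\<omega>. g (Z i j n \<omega>) \<partial>M)"
    by (rule indep_nn_integral[where H="vimage_algebra (space M) (Z i j n) borel", OF chain_sigma_events[OF A]
        _ Z_vimage_events[OF ij] chain_jump_indep[OF A _ ij]])
       (auto intro!: measurable_compose[OF measurable_vimage_algebra1 g])
  also have "(\<integral>\<^sup>+\<omega>. g (Z i j n \<omega>) \<partial>M) = (\<integral>\<^sup>+x. g x \<partial>distr M borel (Z i j n))"
    using g by (subst nn_integral_distr) auto
  also have "\<dots> = (\<integral>\<^sup>+\<omega>. g (Z i j 1 \<omega>) \<partial>M)"
    unfolding Z_distr[OF ij] using g by (subst nn_integral_distr) (auto simp del: One_nat_def)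
  finally show ?thesis .
qed

abbreviation state_path :: "'w \<Rightarrow> real \<Rightarrow> 's" where "state_path \<omega> \<equiv> \<lambda>u. J u \<omega>"

text \<open>The number of jumps is kept as a real number, so that it is a \<open>jump_sum\<close> like the jump part.\<close>

definition jump_count :: "real \<Rightarrow> 'w \<Rightarrow> real" where
  "jump_count t \<omega> = jump_sum (state_path \<omega>) t (\<lambda>_ _ _. 1)"

definition jump_part :: "real \<Rightarrow> 'w \<Rightarrow> real" where
  "jump_part t \<omega> = jump_sum (state_path \<omega>) t (\<lambda>i j n. Z i j n \<omega>)"

definition levy_part :: "real \<Rightarrow> 'w \<Rightarrow> real" where
  "levy_part t \<omega> = levy_integral (state_path \<omega>) t (\<lambda>i s. XL i s \<omega>)"

lemma X_decomposition: "AE \<omega> in M. \<forall>t\<ge>0. X t \<omega> = levy_part t \<omega> + jump_part t \<omega>"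
  using path_structure
  unfolding map_path_structure_def levy_part_def jump_part_def levy_integral_def jump_sum_def Let_def by blast

definition grid_count :: "real \<Rightarrow> nat \<Rightarrow> 'w \<Rightarrow> real" where
  "grid_count t n \<omega> = grid_jump_sum (state_path \<omega>) t n (\<lambda>_ _ _. 1)"

definition step_event :: "real \<Rightarrow> nat \<Rightarrow> nat \<times> 's \<times> 's \<times> nat \<Rightarrow> 'w set" where
  "step_event t n q = {\<omega>\<in>space M. grid_event (state_path \<omega>) t n q}"

definition change_at :: "real \<Rightarrow> nat \<Rightarrow> nat \<Rightarrow> 'w set" where
  "change_at t n m = {\<omega>\<in>space M. grid_change (state_path \<omega>) t n m}"

lemma grid_change_measurable [measurable]:
  assumes "0 \<le> t" shows "Measurable.pred chain_sigma (\<lambda>\<omega>. grid_change (state_path \<omega>) t n m)"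
proof -
  note [measurable] = J_measurable_chain[OF grid_nonneg[OF assms]]
  show ?thesis unfolding grid_change_def by measurable
qed

lemma change_at_chain: "0 \<le> t \<Longrightarrow> change_at t n m \<in> sets chain_sigma"
  using measurable_sets[OF grid_change_measurable, of t "{True}" n m]
  unfolding change_at_def by (simp add: vimage_def Int_def conj_commute)

lemma step_event_chain:
  assumes t: "0 \<le> t" shows "step_event t n q \<in> sets chain_sigma"
proof -
  obtain m i j l where q: "q = (m, i, j, l)" by (cases q)
  note [measurable] = J_measurable_chain[OF grid_nonneg[OF t]] grid_change_measurable[OF t]
  have "Measurable.pred chain_sigma (\<lambda>\<omega>. grid_event (state_path \<omega>) t n q)"
    unfolding grid_event_def q prod.case changes_before_eq_sum by measurable
  from measurable_sets[OF this, of "{True}"] show ?thesis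
    unfolding step_event_def by (simp add: vimage_def Int_def conj_commute)
qed

lemma grid_count_sum: "\<omega> \<in> space M \<Longrightarrow> grid_count t n \<omega> = (\<Sum>m<n. indicator (change_at t n m) \<omega>)"
  unfolding grid_count_def grid_jump_sum_one_alt by (auto simp: change_at_def indicator_def intro!: sum.cong)

lemma grid_jump_sum_step_event: "\<omega> \<in> space M \<Longrightarrow> grid_jump_sum (state_path \<omega>) t n \<phi> =
    (\<Sum>(m, i, j, l)\<in>grid_index n. indicator (step_event t n (m, i, j, l)) \<omega> * \<phi> i j (Suc l))"
  unfolding grid_jump_sum_expand by (auto simp: step_event_def indicator_def intro!: sum.cong)

lemma grid_count_nonneg: "0 \<le> grid_count t n \<omega>"
  unfolding grid_count_def grid_jump_sum_one by simp

lemma grid_jump_sum_measurable_chain: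
  assumes "0 \<le> t"
  shows "(\<lambda>\<omega>. grid_jump_sum (state_path \<omega>) t n \<phi>) \<in> borel_measurable chain_sigma"
proof -
  have "(\<lambda>\<omega>. \<Sum>(m, i, j, l)\<in>grid_index n. indicator (step_event t n (m, i, j, l)) \<omega> * \<phi> i j (Suc l)) \<in>
      borel_measurable chain_sigma"
    using step_event_chain[OF assms] by (intro borel_measurable_sum) auto
  then show ?thesis by (subst measurable_cong[where g="\<lambda>\<omega>. \<Sum>(m, i, j, l)\<in>grid_index n. indicator
      (step_event t n (m, i, j, l)) \<omega> * \<phi> i j (Suc l)"])
      (auto intro: grid_jump_sum_step_event)
qed

lemma grid_jump_sum_limit:
  assumes "0 < t" "\<omega> \<in> space M"
  shows "\<forall>\<^sub>F n in sequentially. \<forall>\<phi>. grid_jump_sum (state_path \<omega>) t n \<phi> = jump_sum (state_path \<omega>) t \<phi>"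
  using grid_jump_sum_eventually[OF J_cadlag[OF assms(2)] assms(1)] .

lemma jump_sum_measurable_chain:
  assumes t: "0 < t"
  shows "(\<lambda>\<omega>. jump_sum (state_path \<omega>) t \<phi>) \<in> borel_measurable chain_sigma"
proof (rule borel_measurable_LIMSEQ_real)
  show "(\<lambda>\<omega>. grid_jump_sum (state_path \<omega>) t n \<phi>) \<in> borel_measurable chain_sigma" for n
    using t by (intro grid_jump_sum_measurable_chain) simp
  fix \<omega> assume "\<omega> \<in> space chain_sigma"
  then have "\<forall>\<^sub>F n in sequentially. grid_jump_sum (state_path \<omega>) t n \<phi> = jump_sum (state_path \<omega>) t \<phi>"
    using grid_jump_sum_limit[OF t, of \<omega>] by (auto elim: eventually_mono)
  then show "(\<lambda>n. grid_jump_sum (state_path \<omega>) t n \<phi>) \<longlonglongrightarrow> jump_sum (state_path \<omega>) t \<phi>"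
    by (rule tendsto_eventually)
qed

lemma chain_measurable: "f \<in> measurable chain_sigma N \<Longrightarrow> f \<in> measurable M N"
  by (rule measurable_from_subalg[of M chain_sigma])
    (simp_all add: subalgebra_def subsetI chain_sigma_events)

section \<open>The number of jumps\<close>

lemma change_at_eq: "change_at t n m = {\<omega>\<in>space M. J (grid t n m) \<omega> \<noteq> J (grid t n m + t / real n) \<omega>}"
  by (simp add: change_at_def grid_change_def grid_Suc)

lemma change_at_events: "0 \<le> t \<Longrightarrow> change_at t n m \<in> events"
  by (rule chain_sigma_events[OF change_at_chain])

lemma step_event_events: "0 \<le> t \<Longrightarrow> step_event t n q \<in> events"
  by (rule chain_sigma_events[OF step_event_chain])

lemma change_at_F:
  assumes t: "0 \<le> t" and u: "grid t n (Suc m) \<le> u"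
  shows "change_at t n m \<in> sets (F u)"
proof -
  have g: "0 \<le> grid t n m" "grid t n m \<le> u" "0 \<le> grid t n (Suc m)" "0 \<le> u"
    using t u grid_nonneg[OF t, of n m] grid_nonneg[OF t, of n "Suc m"] grid_Suc[of t n m]
      divide_nonneg_nonneg[of t "real n"] by linarith+
  have "change_at t n m = space (F u) - (\<Union>i\<in>UNIV. state_at (grid t n m) i \<inter> state_at (grid t n (Suc m)) i)"
    using g(4) by (auto simp: change_at_def grid_change_def)
  also have "\<dots> \<in> sets (F u)"
    using g u by (intro sets.compl_sets sets.finite_UN sets.Int state_at_F) auto
  finally show ?thesis .
qed

text \<open>Given the past up to a grid point, the next step is a change with probability at most
  \<open>rate * (t / n)\<close>.\<close>

lemma change_at_prob_given:
  assumes t: "0 \<le> t" and A: "A \<in> sets (F (grid t n m))"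
  shows "prob (A \<inter> change_at t n m) \<le> rate * (t / real n) * prob A"
    and "(1 - rate * (t / real n)) * prob A \<le> prob (A - change_at t n m)"
proof -
  have d: "0 \<le> t / real n" using t by simp
  have AM: "A \<in> events" using sets_F[OF grid_nonneg[OF t] A] .
  show 1: "prob (A \<inter> change_at t n m) \<le> rate * (t / real n) * prob A"
    unfolding change_at_eq by (rule stay_prob(2)[OF grid_nonneg[OF t] d A])
  have "prob (A - change_at t n m) = prob A - prob (A \<inter> change_at t n m)"
    using AM change_at_events[OF t] by (rule finite_measure_Diff')
  then show "(1 - rate * (t / real n)) * prob A \<le> prob (A - change_at t n m)"
    using 1 by (simp add: algebra_simps)
qed

lemma change_at_prob: "0 \<le> t \<Longrightarrow> prob (change_at t n k) \<le> rate * (t / real n)"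
  using change_at_prob_given(1)[of t "space M" n k] sets.top[of "F (grid t n k)"] grid_nonneg[of t n k]
      sets.sets_into_space[OF change_at_events[of t n k]]
    by (simp add: Int_absorb1 prob_space)

lemma two_changes_prob:
  assumes t: "0 \<le> t" and m: "m \<noteq> m'"
  shows "prob (change_at t n m \<inter> change_at t n m') \<le> (rate * (t / real n))\<^sup>2"
proof -
  have r: "0 \<le> rate * (t / real n)" using rate(1) t by simp
  have lt: "prob (change_at t n m \<inter> change_at t n m') \<le> (rate * (t / real n))\<^sup>2" if "m < m'" for m m'
  proof -
    have "grid t n (Suc m) \<le> grid t n m'"
      unfolding grid_def using that t by (intro divide_right_mono mult_left_mono) auto
    then have "prob (change_at t n m \<inter> change_at t n m') \<le> rate * (t / real n) * prob (change_at t n m)"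
      by (intro change_at_prob_given(1)[OF t] change_at_F[OF t])
    also have "\<dots> \<le> rate * (t / real n) * (rate * (t / real n))"
      using change_at_prob[OF t] r by (intro mult_left_mono)
    finally show ?thesis by (simp add: power2_eq_square)
  qed
  show ?thesis
    using lt[of m m'] lt[of m' m] m by (cases "m < m'") (auto simp: Int_commute)
qed

lemma grid_count_measurable_chain [measurable]: "0 \<le> t \<Longrightarrow> grid_count t n \<in> borel_measurable chain_sigma"
  unfolding grid_count_def[abs_def] by (rule grid_jump_sum_measurable_chain)

lemma grid_count_measurable [measurable]: "0 \<le> t \<Longrightarrow> grid_count t n \<in> borel_measurable M"
  by (rule chain_measurable[OF grid_count_measurable_chain])

text \<open>Expand the square into pairs of steps. The diagonal gives the mean and each of the \<open>n\<^sup>2\<close> other pairs at most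
  \<open>(rate * (t / n))\<^sup>2\<close>.\<close>

lemma grid_count_integrals:
  assumes t: "0 \<le> t" and n: "0 < n"
  shows "integrable M (grid_count t n)" "integrable M (\<lambda>\<omega>. (grid_count t n \<omega>)\<^sup>2)"
    "expectation (grid_count t n) \<le> rate * t"
    "(\<integral>\<omega>. (grid_count t n \<omega>)\<^sup>2 \<partial>M) \<le> expectation (grid_count t n) + (rate * t)\<^sup>2"
proof -
  have I: "integrable M (\<lambda>\<omega>. indicator (change_at t n m) \<omega> :: real)" for m
    using change_at_events[OF t] by (simp add: emeasure_eq_measure)
  have II: "integrable M (\<lambda>\<omega>. indicator (change_at t n m) \<omega> * indicator (change_at t n m') \<omega> :: real)" for m m'
    unfolding indicator_inter_arith[symmetric] using change_at_events[OF t] by (simp add: emeasure_eq_measure)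
  have E: "(\<integral>\<omega>. indicator (change_at t n m) \<omega> \<partial>M) = prob (change_at t n m)" for m
    using sets.sets_into_space[OF change_at_events[OF t]] by (simp add: Int_absorb2)
  have EE: "(\<integral>\<omega>. indicator (change_at t n m) \<omega> * indicator (change_at t n m') \<omega> \<partial>M)
      = prob (change_at t n m \<inter> change_at t n m')" for m m'
  proof -
    have "change_at t n m \<inter> change_at t n m' \<inter> space M = change_at t n m \<inter> change_at t n m'"
      using sets.sets_into_space[OF change_at_events[OF t]] by blast
    then show ?thesis unfolding indicator_inter_arith[symmetric] by simp
  qed
  have sq: "(grid_count t n \<omega>)\<^sup>2 = (\<Sum>m<n. \<Sum>m'<n. indicator (change_at t n m) \<omega> * indicator (change_at t n m')
      \<omega>)"
    if "\<omega> \<in> space M" for \<omega>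
    unfolding grid_count_sum[OF that] power2_eq_square by (simp add: sum_product)
  have "integrable M (\<lambda>\<omega>. \<Sum>m<n. indicator (change_at t n m) \<omega> :: real)" using I by simp
  then show i1: "integrable M (grid_count t n)"
    by (subst Bochner_Integration.integrable_cong[OF refl grid_count_sum]) auto
  have "integrable M (\<lambda>\<omega>. \<Sum>m<n. \<Sum>m'<n. indicator (change_at t n m) \<omega> * indicator (change_at t n m') \<omega> :: real)"
    by (intro Bochner_Integration.integrable_sum II)
  then show i2: "integrable M (\<lambda>\<omega>. (grid_count t n \<omega>)\<^sup>2)"
    by (subst Bochner_Integration.integrable_cong[OF refl sq]) auto
  have e1: "expectation (grid_count t n) = (\<Sum>m<n. prob (change_at t n m))"
    by (subst Bochner_Integration.integral_cong[OF refl grid_count_sum])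
        (simp_all add: I E del: Bochner_Integration.integral_indicator)
  also have "\<dots> \<le> (\<Sum>m<n. rate * (t / real n))" by (intro sum_mono change_at_prob t)
  also have "\<dots> = rate * t" using n by simp
  finally show "expectation (grid_count t n) \<le> rate * t" .
  have "(\<integral>\<omega>. (grid_count t n \<omega>)\<^sup>2 \<partial>M) = (\<Sum>m<n. \<Sum>m'<n. prob (change_at t n m \<inter> change_at t n m'))"
  proof -
    have "(\<integral>\<omega>. (grid_count t n \<omega>)\<^sup>2 \<partial>M) =
        (\<integral>\<omega>. (\<Sum>m<n. \<Sum>m'<n. indicator (change_at t n m) \<omega> * indicator (change_at t n m') \<omega>) \<partial>M)"
      by (intro Bochner_Integration.integral_cong refl sq)
    also have "\<dots> = (\<Sum>m<n. \<integral>\<omega>. (\<Sum>m'<n. indicator (change_at t n m) \<omega> * indicator (change_at t n m') \<omega>) \<partial>M)"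
      by (intro Bochner_Integration.integral_sum Bochner_Integration.integrable_sum II)
    also have "\<dots> = (\<Sum>m<n. \<Sum>m'<n. prob (change_at t n m \<inter> change_at t n m'))"
      by (intro sum.cong refl, subst Bochner_Integration.integral_sum) (simp_all only: II EE)
    finally show ?thesis .
  qed
  also have "\<dots> \<le> (\<Sum>m<n. \<Sum>m'<n. (if m = m' then prob (change_at t n m) else 0) + (rate * (t / real n))\<^sup>2)"
    using two_changes_prob[OF t] by (intro sum_mono) auto
  also have "\<dots> = (\<Sum>m<n. prob (change_at t n m)) + real n * (real n * (rate * (t / real n))\<^sup>2)"
    by (simp add: sum.distrib)
  also have "real n * (real n * (rate * (t / real n))\<^sup>2) = (rate * t)\<^sup>2"
    using n by (simp add: power2_eq_square)
  finally show "(\<integral>\<omega>. (grid_count t n \<omega>)\<^sup>2 \<partial>M) \<le> expectation (grid_count t n) + (rate * t)\<^sup>2"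
    unfolding e1 .
qed

lemma grid_count_nn_integrals:
  assumes t: "0 \<le> t" and n: "0 < n"
  shows "(\<integral>\<^sup>+\<omega>. ennreal (grid_count t n \<omega>) \<partial>M) \<le> ennreal (rate * t)"
    and "(\<integral>\<^sup>+\<omega>. ennreal ((grid_count t n \<omega>)\<^sup>2) \<partial>M) \<le> ennreal (rate * t + (rate * t)\<^sup>2)"
    and "(\<integral>\<^sup>+\<omega>. ennreal ((grid_count t n \<omega>)\<^sup>2) * indicator {\<omega>\<in>space M. 2 \<le> grid_count t n \<omega>} \<omega> \<partial>M)
      \<le> ennreal (2 * (rate * t)\<^sup>2)"
proof -
  note I = grid_count_integrals[OF t n]
  show "(\<integral>\<^sup>+\<omega>. ennreal (grid_count t n \<omega>) \<partial>M) \<le> ennreal (rate * t)"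
    using I(1,3) by (subst nn_integral_eq_integral) (auto intro: ennreal_leI simp: grid_count_nonneg)
  show "(\<integral>\<^sup>+\<omega>. ennreal ((grid_count t n \<omega>)\<^sup>2) \<partial>M) \<le> ennreal (rate * t + (rate * t)\<^sup>2)"
    using I(2,3,4) by (subst nn_integral_eq_integral) (auto intro!: ennreal_leI simp del: ennreal_plus)
  have sq_ge: "grid_count t n \<omega> \<le> (grid_count t n \<omega>)\<^sup>2" for \<omega>
  proof -
    have "real k \<le> (real k)\<^sup>2" for k :: nat
      by (cases k) (auto simp: power2_eq_square)
    then show ?thesis unfolding grid_count_def grid_jump_sum_one .
  qed
  have "(\<integral>\<^sup>+\<omega>. ennreal ((grid_count t n \<omega>)\<^sup>2) * indicator {\<omega>\<in>space M. 2 \<le> grid_count t n \<omega>} \<omega> \<partial>M)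
     \<le> (\<integral>\<^sup>+\<omega>. ennreal (2 * ((grid_count t n \<omega>)\<^sup>2 - grid_count t n \<omega>)) \<partial>M)"
  proof (intro nn_integral_mono)
    fix \<omega>
    show "ennreal ((grid_count t n \<omega>)\<^sup>2) * indicator {\<omega>\<in>space M. 2 \<le> grid_count t n \<omega>} \<omega>
       \<le> ennreal (2 * ((grid_count t n \<omega>)\<^sup>2 - grid_count t n \<omega>))"
    proof (cases "2 \<le> grid_count t n \<omega>")
      case True
      then have "2 * grid_count t n \<omega> \<le> (grid_count t n \<omega>)\<^sup>2"
        unfolding power2_eq_square by (intro mult_right_mono) auto
      then show ?thesis by (auto simp: indicator_def intro!: ennreal_leI)
    qed simp
  qed
  also have "\<dots> = ennreal (\<integral>\<omega>. 2 * ((grid_count t n \<omega>)\<^sup>2 - grid_count t n \<omega>) \<partial>M)"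
    using I(1,2) sq_ge by (intro nn_integral_eq_integral) auto
  also have "\<dots> \<le> ennreal (2 * (rate * t)\<^sup>2)"
    using I by (intro ennreal_leI) simp
  finally show "(\<integral>\<^sup>+\<omega>. ennreal ((grid_count t n \<omega>)\<^sup>2) * indicator {\<omega>\<in>space M. 2 \<le> grid_count t n \<omega>} \<omega> \<partial>M)
      \<le> ennreal (2 * (rate * t)\<^sup>2)" .
qed

lemma jump_count_measurable_chain [measurable]: "0 < t \<Longrightarrow> jump_count t \<in> borel_measurable chain_sigma"
  unfolding jump_count_def[abs_def] by (rule jump_sum_measurable_chain)

lemma jump_count_measurable [measurable]: "0 < t \<Longrightarrow> jump_count t \<in> borel_measurable M"
  by (rule chain_measurable[OF jump_count_measurable_chain])

lemma grid_count_limit: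
  assumes "0 < t" "\<omega> \<in> space M"
  shows "\<forall>\<^sub>F n in sequentially. grid_count t n \<omega> = jump_count t \<omega>"
  using grid_jump_sum_limit[OF assms] unfolding grid_count_def jump_count_def
  by (auto elim: eventually_mono)

lemma jump_count_cases:
  assumes "0 < t" "\<omega> \<in> space M"
  shows "jump_count t \<omega> = 0 \<or> jump_count t \<omega> = 1 \<or> 2 \<le> jump_count t \<omega>"
  unfolding jump_count_def by (rule jump_sum_one_cases[OF J_cadlag[OF assms(2)] assms(1)])

text \<open>Two jumps already have probability of order \<open>t\<^sup>2\<close>: where the count is at least \<open>2\<close>, its square is at most
  twice the difference of its square and itself, whose expectation on the grid is of that order.\<close>

lemma jump_count_prob:
  assumes t: "0 < t"
  shows "prob {\<omega>\<in>space M. jump_count t \<omega> \<noteq> 0} \<le> rate * t"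
    and "prob {\<omega>\<in>space M. 2 \<le> jump_count t \<omega>} \<le> (rate * t)\<^sup>2"
proof -
  note [measurable] = jump_count_measurable[OF t] grid_count_measurable[OF less_imp_le[OF t]]
  have r: "0 \<le> rate * t" using rate(1) t by simp
  have "emeasure M {\<omega>\<in>space M. jump_count t \<omega> \<noteq> 0} = (\<integral>\<^sup>+\<omega>. indicator {\<omega>\<in>space M. jump_count t \<omega> \<noteq> 0} \<omega> \<partial>M)"
    by (rule nn_integral_indicator[symmetric]) measurable
  also have "\<dots> \<le> (\<integral>\<^sup>+\<omega>. ennreal (jump_count t \<omega>) \<partial>M)"
    using jump_count_cases[OF t]
        by (intro nn_integral_mono) (force simp: indicator_def simp flip: ennreal_1 intro: ennreal_leI)
  also have "\<dots> \<le> ennreal (rate * t)"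
  proof (rule nn_integral_le_of_tendsto)
    show "AE \<omega> in M. (\<lambda>n. ennreal (grid_count t n \<omega>)) \<longlonglongrightarrow> ennreal (jump_count t \<omega>)"
    proof (intro AE_I2 tendsto_eventually)
      fix \<omega> assume "\<omega> \<in> space M"
      from grid_count_limit[OF t this]
      show "\<forall>\<^sub>F n in sequentially. ennreal (grid_count t n \<omega>) = ennreal (jump_count t \<omega>)"
        by eventually_elim (simp only:)
    qed
    show "\<forall>\<^sub>F n in sequentially. (\<integral>\<^sup>+\<omega>. ennreal (grid_count t n \<omega>) \<partial>M) \<le> ennreal (rate * t)"
      using eventually_gt_at_top[of 0] by eventually_elim (use grid_count_nn_integrals(1) t in auto)
  qed measurable
  finally show "prob {\<omega>\<in>space M. jump_count t \<omega> \<noteq> 0} \<le> rate * t"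
    using r by (simp add: emeasure_eq_measure)
  let ?B = "{\<omega>\<in>space M. 2 \<le> jump_count t \<omega>}" and ?G = "\<lambda>n. {\<omega>\<in>space M. 2 \<le> grid_count t n \<omega>}"
  have "2 * emeasure M ?B = (\<integral>\<^sup>+\<omega>. 2 * indicator ?B \<omega> \<partial>M)"
    by (subst nn_integral_cmult) (simp_all add: nn_integral_indicator)
  also have "\<dots> \<le> (\<integral>\<^sup>+\<omega>. ennreal ((jump_count t \<omega>)\<^sup>2) * indicator ?B \<omega> \<partial>M)"
  proof (intro nn_integral_mono)
    fix \<omega>
    have "2 \<le> (jump_count t \<omega>)\<^sup>2" if "2 \<le> jump_count t \<omega>"
      using power_mono[OF that, of 2] by simp
    then show "2 * indicator ?B \<omega> \<le> ennreal ((jump_count t \<omega>)\<^sup>2) * indicator ?B \<omega>"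
      by (auto simp: indicator_def simp flip: ennreal_numeral intro: ennreal_leI)
  qed
  also have "\<dots> \<le> ennreal (2 * (rate * t)\<^sup>2)"
  proof (rule nn_integral_le_of_tendsto)
    show "AE \<omega> in M. (\<lambda>n. ennreal ((grid_count t n \<omega>)\<^sup>2) * indicator (?G n) \<omega>) \<longlonglongrightarrow> ennreal ((jump_count t \<omega>)\<^sup>2)
        * indicator ?B \<omega>"
    proof (intro AE_I2 tendsto_eventually)
      fix \<omega> assume "\<omega> \<in> space M"
      from grid_count_limit[OF t this]
      show "\<forall>\<^sub>F n in sequentially. ennreal ((grid_count t n \<omega>)\<^sup>2) * indicator (?G n) \<omega> =
          ennreal ((jump_count t \<omega>)\<^sup>2) * indicator ?B \<omega>"
        by eventually_elim (simp only: indicator_def mem_Collect_eq)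
    qed
    show "\<forall>\<^sub>F n in sequentially. (\<integral>\<^sup>+\<omega>. ennreal ((grid_count t n \<omega>)\<^sup>2) * indicator (?G n) \<omega> \<partial>M)
        \<le> ennreal (2 * (rate * t)\<^sup>2)"
      using eventually_gt_at_top[of 0] by eventually_elim (use grid_count_nn_integrals(3) t in auto)
  qed measurable
  finally have "ennreal (2 * prob ?B) \<le> ennreal (2 * (rate * t)\<^sup>2)"
    by (simp add: emeasure_eq_measure ennreal_mult')
  then show "prob ?B \<le> (rate * t)\<^sup>2"
    by (subst (asm) ennreal_le_iff) auto
qed

lemma jump_rate_limit:
  assumes t: "0 < t" and ij: "i \<noteq> j"
  shows "(\<lambda>n. real n * P (t / real n) i j) \<longlonglongrightarrow> t * Q $ i $ j"
proof -
  have "((\<lambda>h. P h i j / h) \<longlongrightarrow> Q $ i $ j) (at_right 0)"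
    using P_derivative[of i j] ij by (simp add: P_0)
  moreover have "filterlim (\<lambda>n. t / real n) (at_right 0) sequentially"
  proof (rule tendsto_imp_filterlim_at_right)
    show "(\<lambda>n. t / real n) \<longlonglongrightarrow> 0"
      using tendsto_mult[OF tendsto_const[of t] lim_inverse_n] by (simp add: divide_inverse)
    show "\<forall>\<^sub>F n in sequentially. 0 < t / real n"
      using eventually_gt_at_top[of 0] by eventually_elim (use t in simp)
  qed
  ultimately have "(\<lambda>n. P (t / real n) i j / (t / real n)) \<longlonglongrightarrow> Q $ i $ j" by (rule filterlim_compose)
  then have "(\<lambda>n. t * (P (t / real n) i j / (t / real n))) \<longlonglongrightarrow> t * Q $ i $ j" by (intro tendsto_intros)
  then show ?thesis
    by (rule Lim_transform_eventually) (use t in \<open>auto intro!: always_eventually\<close>)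
qed

text \<open>The expected number of changes on the grid from \<open>i\<close> to \<open>j\<close> is at most \<open>n\<close> times a transition probability that
  is \<open>o (1 / n)\<close>.\<close>

lemma no_impossible_jump:
  assumes t: "0 < t" and q: "Q $ i $ j = 0" and ij: "i \<noteq> j"
  shows "AE \<omega> in M. jump_sum (state_path \<omega>) t (\<lambda>a b _. of_bool (a = i \<and> b = j)) = 0"
proof -
  let ?K = "\<lambda>\<omega>. jump_sum (state_path \<omega>) t (\<lambda>a b _. of_bool (a = i \<and> b = j))"
  let ?Kn = "\<lambda>n \<omega>. grid_jump_sum (state_path \<omega>) t n (\<lambda>a b _. of_bool (a = i \<and> b = j))"
  let ?S = "\<lambda>n m. state_at (grid t n m) i \<inter> state_at (grid t n (Suc m)) j"
  have t0: "0 \<le> t" using t by simp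
  note g = grid_nonneg[OF t0]
  have [measurable]: "?Kn n \<in> borel_measurable M" for n
    by (rule chain_measurable[OF grid_jump_sum_measurable_chain[OF t0]])
  have [measurable]: "?K \<in> borel_measurable M"
    by (rule chain_measurable[OF jump_sum_measurable_chain[OF t]])
  have lim: "(\<lambda>n. real n * P (t / real n) i j) \<longlonglongrightarrow> t * 0"
    using jump_rate_limit[OF t ij] q by simp
  have Kn: "(\<integral>\<^sup>+\<omega>. ennreal (?Kn n \<omega>) \<partial>M) \<le> ennreal (real n * P (t / real n) i j)" for n
  proof -
    have "(\<integral>\<^sup>+\<omega>. ennreal (?Kn n \<omega>) \<partial>M) \<le> (\<integral>\<^sup>+\<omega>. (\<Sum>m<n. indicator (?S n m) \<omega>) \<partial>M)"
    proof (intro nn_integral_mono)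
      fix \<omega> assume \<omega>: "\<omega> \<in> space M"
      have "?Kn n \<omega> \<le> (\<Sum>m<n. indicator (?S n m) \<omega>)"
        unfolding grid_jump_sum_def using \<omega> by (intro sum_mono) (auto simp: indicator_def)
      then have "ennreal (?Kn n \<omega>) \<le> ennreal (\<Sum>m<n. indicator (?S n m) \<omega>)" by (rule ennreal_leI)
      also have "\<dots> = (\<Sum>m<n. indicator (?S n m) \<omega>)"
        by (simp add: sum_ennreal[symmetric] ennreal_indicator)
      finally show "ennreal (?Kn n \<omega>) \<le> (\<Sum>m<n. indicator (?S n m) \<omega>)" .
    qed
    also have "\<dots> = (\<Sum>m<n. emeasure M (?S n m))"
      using g by (subst nn_integral_sum) auto
    also have "\<dots> \<le> (\<Sum>m<n. ennreal (P (t / real n) i j))"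
    proof (intro sum_mono)
      fix m
      have "prob (space M \<inter> state_at (grid t n m) i \<inter> state_at (grid t n m + t / real n) j)
          = prob (space M \<inter> state_at (grid t n m) i) * P (t / real n) i j"
        using g[of n m] t0 sets.top[of "F (grid t n m)"] by (intro chain_step) auto
      also have "\<dots> \<le> 1 * P (t / real n) i j" using P_bounds by (intro mult_right_mono) auto
      also have "space M \<inter> state_at (grid t n m) i \<inter> state_at (grid t n m + t / real n) j = ?S n m"
          by (auto simp: grid_Suc)
      finally show "emeasure M (?S n m) \<le> ennreal (P (t / real n) i j)"
        by (simp add: emeasure_eq_measure ennreal_leI)
    qed
    also have "\<dots> = ennreal (real n * P (t / real n) i j)"
      using P_bounds by (simp add: ennreal_mult' ennreal_of_nat_eq_real_of_nat)
    finally show ?thesis .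
  qed
  have "(\<integral>\<^sup>+\<omega>. ennreal (?K \<omega>) \<partial>M) \<le> 0 + ennreal e" if e: "0 < e" for e
  proof (rule nn_integral_le_of_tendsto)
    show "AE \<omega> in M. (\<lambda>n. ennreal (?Kn n \<omega>)) \<longlonglongrightarrow> ennreal (?K \<omega>)"
    proof (intro AE_I2 tendsto_eventually)
      fix \<omega> assume "\<omega> \<in> space M"
      from grid_jump_sum_limit[OF t this]
      show "\<forall>\<^sub>F n in sequentially. ennreal (?Kn n \<omega>) = ennreal (?K \<omega>)"
        by eventually_elim (simp only:)
    qed
    have "\<forall>\<^sub>F n in sequentially. real n * P (t / real n) i j < e"
      using lim e by (intro order_tendstoD) auto
    then show "\<forall>\<^sub>F n in sequentially. (\<integral>\<^sup>+\<omega>. ennreal (?Kn n \<omega>) \<partial>M) \<le> 0 + ennreal e"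
      by eventually_elim (simp, rule order_trans[OF Kn ennreal_leI], simp)
  qed measurable
  then have "(\<integral>\<^sup>+\<omega>. ennreal (?K \<omega>) \<partial>M) \<le> 0" by (rule ennreal_le_epsilon)
  then have "AE \<omega> in M. ennreal (?K \<omega>) = 0"
    by (subst nn_integral_0_iff_AE[symmetric]) auto
  note ae = this
  have nn: "0 \<le> ?K \<omega>" if \<omega>: "\<omega> \<in> space M" for \<omega>
  proof -
    obtain n where "\<And>\<phi>. grid_jump_sum (state_path \<omega>) t n \<phi> = jump_sum (state_path \<omega>) t \<phi>"
      using jump_sum_grid[OF J_cadlag[OF \<omega>] t] by blast
    then have "?K \<omega> = ?Kn n \<omega>" by simp
    also have "0 \<le> ?Kn n \<omega>" unfolding grid_jump_sum_def by (intro sum_nonneg) auto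
    finally show ?thesis .
  qed
  show ?thesis
    using ae by (rule AE_mp) (intro AE_I2 impI antisym nn, simp_all add: ennreal_eq_0_iff)
qed

section \<open>Second moments of the two parts\<close>

text \<open>Only transitions of positive rate are kept: along the others \<open>Z i j\<close> need not have finite moments, but
  almost surely they do not occur.\<close>

definition possible_jump :: "'w \<Rightarrow> 's \<Rightarrow> 's \<Rightarrow> nat \<Rightarrow> real" where
  "possible_jump \<omega> i j n = (if i \<noteq> j \<and> Q $ i $ j \<noteq> 0 then Z i j n \<omega> else 0)"

definition possible_jump_part :: "real \<Rightarrow> 'w \<Rightarrow> real" where
  "possible_jump_part t \<omega> = jump_sum (state_path \<omega>) t (possible_jump \<omega>)"

abbreviation grid_possible_jumps :: "real \<Rightarrow> nat \<Rightarrow> 'w \<Rightarrow> real" where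
  "grid_possible_jumps t n \<omega> \<equiv> grid_jump_sum (state_path \<omega>) t n (possible_jump \<omega>)"

lemma possible_jump_measurable [measurable]: "1 \<le> n \<Longrightarrow> (\<lambda>\<omega>. possible_jump \<omega> i j n) \<in> borel_measurable M"
  unfolding possible_jump_def by (cases "i \<noteq> j \<and> Q $ i $ j \<noteq> 0") auto

lemma jump_part_eq:
  assumes t: "0 < t"
  shows "AE \<omega> in M. jump_part t \<omega> = possible_jump_part t \<omega>"
proof -
  have "AE \<omega> in M. \<forall>i j. i \<noteq> j \<longrightarrow> Q $ i $ j = 0 \<longrightarrow> jump_sum (state_path \<omega>) t (\<lambda>a b _. of_bool (a = i \<and> b = j))
      = 0"
    unfolding AE_all_countable using no_impossible_jump[OF t] by simp
  then show ?thesis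
  proof (rule AE_mp, intro AE_I2 impI)
    fix \<omega> assume \<omega>: "\<omega> \<in> space M"
      and z: "\<forall>i j. i \<noteq> j \<longrightarrow> Q $ i $ j = 0 \<longrightarrow> jump_sum (state_path \<omega>) t (\<lambda>a b _. of_bool (a = i \<and> b = j)) = 0"
    obtain n where n: "\<And>\<phi>. grid_jump_sum (state_path \<omega>) t n \<phi> = jump_sum (state_path \<omega>) t \<phi>"
      using jump_sum_grid[OF J_cadlag[OF \<omega>] t] by blast
    have "grid_jump_sum (state_path \<omega>) t n (\<lambda>i j n. Z i j n \<omega>) = grid_possible_jumps t n \<omega>"
    proof (rule grid_jump_sum_cong)
      fix i j assume ne: "(\<lambda>n. Z i j n \<omega>) \<noteq> possible_jump \<omega> i j" and ij: "i \<noteq> j"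
      have "Q $ i $ j = 0"
      proof (rule ccontr)
        assume "Q $ i $ j \<noteq> 0"
        then have "(\<lambda>n. Z i j n \<omega>) = possible_jump \<omega> i j" using ij by (auto simp: possible_jump_def)
        with ne show False by simp
      qed
      then show "grid_jump_sum (state_path \<omega>) t n (\<lambda>a b _. of_bool (a = i \<and> b = j)) = 0"
        using z ij n by simp
    qed
    then show "jump_part t \<omega> = possible_jump_part t \<omega>"
      unfolding jump_part_def possible_jump_part_def n .
  qed
qed

lemma grid_possible_jump_measurable [measurable]:
  assumes t: "0 \<le> t"
  shows "(\<lambda>\<omega>. grid_possible_jumps t n \<omega>) \<in> borel_measurable M"
proof -
  have "(\<lambda>\<omega>. \<Sum>q\<in>grid_index n. indicator (step_event t n q) \<omega> * possible_jump \<omega> (fst (snd q))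
      (fst (snd (snd q))) (Suc (snd (snd (snd q))))) \<in> borel_measurable M"
    using step_event_events[OF t] by (intro borel_measurable_sum borel_measurable_times) auto
  then show ?thesis
    by (subst measurable_cong[OF grid_jump_sum_step_event]) (auto simp: case_prod_unfold)
qed

lemma possible_jump_part_limit:
  assumes "0 < t" "\<omega> \<in> space M"
  shows "\<forall>\<^sub>F n in sequentially. grid_possible_jumps t n \<omega> = possible_jump_part t \<omega> \<and>
     grid_count t n \<omega> = jump_count t \<omega>"
  using grid_jump_sum_limit[OF assms] unfolding possible_jump_part_def jump_count_def grid_count_def
  by eventually_elim simp

lemma possible_jump_part_measurable [measurable]: "0 < t \<Longrightarrow> possible_jump_part t \<in> borel_measurable M"
proof -
  assume t: "0 < t"
  have "(\<lambda>\<omega>. possible_jump_part t \<omega>) \<in> borel_measurable M"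
  proof (rule borel_measurable_LIMSEQ_real)
    show "(\<lambda>\<omega>. grid_possible_jumps t n \<omega>) \<in> borel_measurable M" for n
      using t by (intro grid_possible_jump_measurable) simp
    fix \<omega> assume "\<omega> \<in> space M"
    from possible_jump_part_limit[OF t this]
    have "\<forall>\<^sub>F n in sequentially. grid_possible_jumps t n \<omega> = possible_jump_part t \<omega>"
      by eventually_elim simp
    then show "(\<lambda>n. grid_possible_jumps t n \<omega>) \<longlonglongrightarrow> possible_jump_part t \<omega>"
      by (rule tendsto_eventually)
  qed
  then show ?thesis .
qed

definition jump_bound :: real where
  "jump_bound = (\<Sum>i\<in>UNIV. \<Sum>j\<in>UNIV. if i \<noteq> j \<and> Q $ i $ j \<noteq> 0 then \<integral>\<omega>. (Z i j 1 \<omega>)\<^sup>2 \<partial>M else 0)"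

lemma jump_bound_nonneg: "0 \<le> jump_bound"
  unfolding jump_bound_def by (intro sum_nonneg) auto

context
  assumes Z_square: "\<And>i j. i \<noteq> j \<Longrightarrow> Q $ i $ j \<noteq> 0 \<Longrightarrow> integrable M (\<lambda>\<omega>. (Z i j 1 \<omega>)\<^sup>2)"
begin

lemma possible_jump_square:
  assumes A: "A \<in> sets chain_sigma" and n: "1 \<le> n"
  shows "(\<integral>\<^sup>+\<omega>. ennreal ((possible_jump \<omega> i j n)\<^sup>2) * indicator A \<omega> \<partial>M) \<le> ennreal jump_bound * emeasure M A"
proof (cases "i \<noteq> j \<and> Q $ i $ j \<noteq> 0")
  case True
  have "(\<integral>\<^sup>+\<omega>. ennreal ((possible_jump \<omega> i j n)\<^sup>2) * indicator A \<omega> \<partial>M) =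
     (\<integral>\<^sup>+\<omega>. ennreal ((Z i j n \<omega>)\<^sup>2) * indicator A \<omega> \<partial>M)"
    using True by (simp add: possible_jump_def)
  also have "\<dots> = emeasure M A * (\<integral>\<^sup>+\<omega>. ennreal ((Z i j 1 \<omega>)\<^sup>2) \<partial>M)"
    using True n by (intro chain_jump_nn_integral[OF A, where g="\<lambda>x. ennreal (x\<^sup>2)"]) auto
  finally have eq: "(\<integral>\<^sup>+\<omega>. ennreal ((possible_jump \<omega> i j n)\<^sup>2) * indicator A \<omega> \<partial>M) =
    emeasure M A * (\<integral>\<^sup>+\<omega>. ennreal ((Z i j 1 \<omega>)\<^sup>2) \<partial>M)" .
  have "(\<integral>\<^sup>+\<omega>. ennreal ((Z i j 1 \<omega>)\<^sup>2) \<partial>M) = ennreal (\<integral>\<omega>. (Z i j 1 \<omega>)\<^sup>2 \<partial>M)"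
    using True Z_square by (intro nn_integral_eq_integral) auto
  also have "\<dots> \<le> ennreal jump_bound"
  proof (rule ennreal_leI)
    let ?v = "\<lambda>i j. if i \<noteq> j \<and> Q $ i $ j \<noteq> 0 then \<integral>\<omega>. (Z i j 1 \<omega>)\<^sup>2 \<partial>M else 0"
    have "(\<integral>\<omega>. (Z i j 1 \<omega>)\<^sup>2 \<partial>M) = ?v i j" using True by simp
    also have "\<dots> \<le> (\<Sum>j\<in>UNIV. ?v i j)" by (rule member_le_sum) auto
    also have "\<dots> \<le> jump_bound"
      unfolding jump_bound_def by (rule member_le_sum[of i UNIV "\<lambda>i. \<Sum>j\<in>UNIV. ?v i j"]) (auto intro: sum_nonneg)
    finally show "(\<integral>\<omega>. (Z i j 1 \<omega>)\<^sup>2 \<partial>M) \<le> jump_bound" .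
  qed
  finally have "emeasure M A * (\<integral>\<^sup>+\<omega>. ennreal ((Z i j 1 \<omega>)\<^sup>2) \<partial>M) \<le> emeasure M A * ennreal jump_bound"
    by (intro mult_left_mono) simp_all
  then show ?thesis unfolding eq by (simp only: mult.commute)
next
  case False
  then have "possible_jump \<omega> i j n = 0" for \<omega> by (auto simp: possible_jump_def)
  then show ?thesis by simp
qed

lemma ennreal_double_sum:
  fixes f :: "'b \<Rightarrow> 'c \<Rightarrow> real"
  assumes "\<And>k q. 0 \<le> f k q"
  shows "ennreal (\<Sum>k\<in>I. \<Sum>q\<in>I'. f k q) * c = (\<Sum>k\<in>I. \<Sum>q\<in>I'. ennreal (f k q) * c)"
  by (simp add: sum_distrib_right[symmetric] sum_nonneg assms)

text \<open>By Cauchy-Schwarz the square is at most the number of changes times the sum of the squared jumps. Expanded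
  over the steps, each squared jump meets an event of the chain alone, and independence replaces it by its
  expectation.\<close>

lemma grid_jump_square:
  assumes A: "A \<in> sets chain_sigma" and t: "0 \<le> t"
  shows "(\<integral>\<^sup>+\<omega>. ennreal ((grid_possible_jumps t n \<omega>)\<^sup>2) * indicator A \<omega> \<partial>M)
    \<le> ennreal jump_bound * (\<integral>\<^sup>+\<omega>. ennreal ((grid_count t n \<omega>)\<^sup>2) * indicator A \<omega> \<partial>M)"
proof -
  let ?z = "\<lambda>\<omega> q. (possible_jump \<omega> (fst (snd q)) (fst (snd (snd q))) (Suc (snd (snd (snd q)))))\<^sup>2"
  let ?E = "\<lambda>k q. A \<inter> change_at t n k \<inter> step_event t n q"
  have AM: "A \<in> events" using chain_sigma_events[OF A] .
  have EM: "?E k q \<in> sets chain_sigma" for k q using A change_at_chain[OF t] step_event_chain[OF t] by auto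
  then have EM': "?E k q \<in> events" for k q by (rule chain_sigma_events)
  have count: "grid_count t n \<omega> = (\<Sum>q\<in>grid_index n. indicator (step_event t n q) \<omega>)" if "\<omega> \<in> space M" for \<omega>
    unfolding grid_count_def grid_jump_sum_step_event[OF that] by (simp add: case_prod_unfold)
  have "(\<integral>\<^sup>+\<omega>. ennreal ((grid_possible_jumps t n \<omega>)\<^sup>2) * indicator A \<omega> \<partial>M)
     \<le> (\<integral>\<^sup>+\<omega>. (\<Sum>k<n. \<Sum>q\<in>grid_index n. ennreal (?z \<omega> q) * indicator (?E k q) \<omega>) \<partial>M)"
  proof (intro nn_integral_mono)
    fix \<omega> assume \<omega>: "\<omega> \<in> space M"
    have "(grid_possible_jumps t n \<omega>)\<^sup>2 \<le>
        grid_count t n \<omega> * grid_jump_sum (state_path \<omega>) t n (\<lambda>i j l. (possible_jump \<omega> i j l)\<^sup>2)"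
      unfolding grid_count_def by (rule grid_jump_sum_square_le)
    also have "\<dots> = (\<Sum>k<n. \<Sum>q\<in>grid_index n. indicator (change_at t n k) \<omega>
        * (indicator (step_event t n q) \<omega> * ?z \<omega> q))"
      unfolding grid_count_sum[OF \<omega>] grid_jump_sum_step_event[OF \<omega>]
          by (simp only: sum_product case_prod_unfold prod.collapse)
    finally have "ennreal ((grid_possible_jumps t n \<omega>)\<^sup>2) * indicator A \<omega> \<le>
       ennreal (\<Sum>k<n. \<Sum>q\<in>grid_index n. indicator (change_at t n k) \<omega>
           * (indicator (step_event t n q) \<omega> * ?z \<omega> q)) * indicator A \<omega>"
      by (intro mult_right_mono ennreal_leI) auto
    also have "\<dots> = (\<Sum>k<n. \<Sum>q\<in>grid_index n. ennreal (indicator (change_at t n k) \<omega>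
        * (indicator (step_event t n q) \<omega> * ?z \<omega> q)) * indicator A \<omega>)"
      by (rule ennreal_double_sum) simp
    also have "\<dots> = (\<Sum>k<n. \<Sum>q\<in>grid_index n. ennreal (?z \<omega> q) * indicator (?E k q) \<omega>)"
      by (intro sum.cong refl) (auto simp: indicator_def)
    finally show "ennreal ((grid_possible_jumps t n \<omega>)\<^sup>2) * indicator A \<omega> \<le>
       (\<Sum>k<n. \<Sum>q\<in>grid_index n. ennreal (?z \<omega> q) * indicator (?E k q) \<omega>)" .
  qed
  also have "\<dots> = (\<Sum>k<n. \<Sum>q\<in>grid_index n. \<integral>\<^sup>+\<omega>. ennreal (?z \<omega> q) * indicator (?E k q) \<omega> \<partial>M)"
  proof -
    note [measurable] = EM'
    show ?thesis by (subst nn_integral_sum, measurable, intro sum.cong refl nn_integral_sum, measurable)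
  qed
  also have "\<dots> \<le> (\<Sum>k<n. \<Sum>q\<in>grid_index n. ennreal jump_bound * emeasure M (?E k q))"
    by (intro sum_mono possible_jump_square EM) simp
  also have "\<dots> = ennreal jump_bound * (\<Sum>k<n. \<Sum>q\<in>grid_index n. emeasure M (?E k q))"
    by (simp add: sum_distrib_left)
  also have "(\<Sum>k<n. \<Sum>q\<in>grid_index n. emeasure M (?E k q))
      = (\<integral>\<^sup>+\<omega>. (\<Sum>k<n. \<Sum>q\<in>grid_index n. indicator (?E k q) \<omega>) \<partial>M)"
  proof -
    note [measurable] = EM'
    have "(\<Sum>k<n. \<Sum>q\<in>grid_index n. emeasure M (?E k q)) =
        (\<Sum>k<n. \<Sum>q\<in>grid_index n. \<integral>\<^sup>+\<omega>. indicator (?E k q) \<omega> \<partial>M)"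
      using EM' by (intro sum.cong refl nn_integral_indicator[symmetric])
    also have "\<dots> = (\<integral>\<^sup>+\<omega>. (\<Sum>k<n. \<Sum>q\<in>grid_index n. indicator (?E k q) \<omega>) \<partial>M)"
      by (subst nn_integral_sum, measurable, intro sum.cong refl nn_integral_sum[symmetric], measurable)
    finally show ?thesis .
  qed
  also have "\<dots> = (\<integral>\<^sup>+\<omega>. ennreal ((grid_count t n \<omega>)\<^sup>2) * indicator A \<omega> \<partial>M)"
  proof (intro nn_integral_cong)
    fix \<omega> assume \<omega>: "\<omega> \<in> space M"
    have "(grid_count t n \<omega>)\<^sup>2 = (\<Sum>k<n. \<Sum>q\<in>grid_index n. indicator (change_at t n k) \<omega>
        * indicator (step_event t n q) \<omega>)"
      unfolding power2_eq_square by (subst grid_count_sum[OF \<omega>], subst count[OF \<omega>]) (simp add: sum_product)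
    then have "ennreal ((grid_count t n \<omega>)\<^sup>2) * indicator A \<omega> =
        ennreal (\<Sum>k<n. \<Sum>q\<in>grid_index n. indicator (change_at t n k) \<omega> * indicator (step_event t n q) \<omega>)
            * indicator A \<omega>"
      by (simp only:)
    also have "\<dots> = (\<Sum>k<n. \<Sum>q\<in>grid_index n. ennreal (indicator (change_at t n k) \<omega>
        * indicator (step_event t n q) \<omega>) * indicator A \<omega>)"
      by (rule ennreal_double_sum) simp
    also have "\<dots> = (\<Sum>k<n. \<Sum>q\<in>grid_index n. indicator (?E k q) \<omega>)"
      by (intro sum.cong refl) (auto simp: indicator_def)
    finally show "(\<Sum>k<n. \<Sum>q\<in>grid_index n. indicator (?E k q) \<omega>) = ennreal ((grid_count t n \<omega>)\<^sup>2)
        * indicator A \<omega>" ..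
  qed
  finally show ?thesis .
qed

lemma jump_part_bound_if_Z_square:
  assumes t: "0 < t"
  shows "(\<integral>\<^sup>+\<omega>. ennreal ((possible_jump_part t \<omega>)\<^sup>2) \<partial>M) \<le> ennreal (jump_bound * (rate * t + (rate * t)\<^sup>2))"
    and "(\<integral>\<^sup>+\<omega>. ennreal ((possible_jump_part t \<omega>)\<^sup>2) * indicator {\<omega>\<in>space M. 2 \<le> jump_count t \<omega>} \<omega> \<partial>M)
      \<le> ennreal (jump_bound * (2 * (rate * t)\<^sup>2))"
proof -
  have t0: "0 \<le> t" using t by simp
  note [measurable] = grid_possible_jump_measurable[OF t0] grid_count_measurable[OF t0]
      grid_count_measurable_chain[OF t0]
    jump_count_measurable[OF t] possible_jump_part_measurable[OF t]
  have r: "0 \<le> rate * t" using rate(1) t by simp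
  show "(\<integral>\<^sup>+\<omega>. ennreal ((possible_jump_part t \<omega>)\<^sup>2) \<partial>M) \<le> ennreal (jump_bound * (rate * t + (rate * t)\<^sup>2))"
  proof (rule nn_integral_le_of_tendsto)
    show "AE \<omega> in M. (\<lambda>n. ennreal ((grid_possible_jumps t n \<omega>)\<^sup>2)) \<longlonglongrightarrow> ennreal ((possible_jump_part t \<omega>)\<^sup>2)"
    proof (intro AE_I2 tendsto_eventually)
      fix \<omega> assume "\<omega> \<in> space M"
      from possible_jump_part_limit[OF t this]
      show "\<forall>\<^sub>F n in sequentially. ennreal ((grid_possible_jumps t n \<omega>)\<^sup>2)
          = ennreal ((possible_jump_part t \<omega>)\<^sup>2)"
        by eventually_elim (simp only:)
    qed
    show "\<forall>\<^sub>F n in sequentially. (\<integral>\<^sup>+\<omega>. ennreal ((grid_possible_jumps t n \<omega>)\<^sup>2) \<partial>M)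
       \<le> ennreal (jump_bound * (rate * t + (rate * t)\<^sup>2))"
      using eventually_gt_at_top[of 0]
    proof eventually_elim
      case (elim n)
      have top: "space M \<in> sets chain_sigma" using sets.top[of chain_sigma] by simp
      have "(\<integral>\<^sup>+\<omega>. ennreal ((grid_possible_jumps t n \<omega>)\<^sup>2) \<partial>M) =
         (\<integral>\<^sup>+\<omega>. ennreal ((grid_possible_jumps t n \<omega>)\<^sup>2) * indicator (space M) \<omega> \<partial>M)"
        by (intro nn_integral_cong) simp
      also have "\<dots> \<le> ennreal jump_bound * (\<integral>\<^sup>+\<omega>. ennreal ((grid_count t n \<omega>)\<^sup>2) * indicator (space M) \<omega> \<partial>M)"
        by (rule grid_jump_square[OF top t0])
      also have "(\<integral>\<^sup>+\<omega>. ennreal ((grid_count t n \<omega>)\<^sup>2) * indicator (space M) \<omega> \<partial>M)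
          = (\<integral>\<^sup>+\<omega>. ennreal ((grid_count t n \<omega>)\<^sup>2) \<partial>M)"
        by (intro nn_integral_cong) simp
      also have "ennreal jump_bound * \<dots> \<le> ennreal jump_bound * ennreal (rate * t + (rate * t)\<^sup>2)"
        by (intro mult_left_mono grid_count_nn_integrals t0 elim) simp
      also have "\<dots> = ennreal (jump_bound * (rate * t + (rate * t)\<^sup>2))"
        using jump_bound_nonneg r by (intro ennreal_mult[symmetric]) auto
      finally show ?case .
    qed
  qed measurable
  let ?B = "{\<omega>\<in>space M. 2 \<le> jump_count t \<omega>}" and ?G = "\<lambda>n. {\<omega>\<in>space M. 2 \<le> grid_count t n \<omega>}"
  show "(\<integral>\<^sup>+\<omega>. ennreal ((possible_jump_part t \<omega>)\<^sup>2) * indicator ?B \<omega> \<partial>M)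
      \<le> ennreal (jump_bound * (2 * (rate * t)\<^sup>2))"
  proof (rule nn_integral_le_of_tendsto)
    show "AE \<omega> in M. (\<lambda>n. ennreal ((grid_possible_jumps t n \<omega>)\<^sup>2) * indicator (?G n) \<omega>)
       \<longlonglongrightarrow> ennreal ((possible_jump_part t \<omega>)\<^sup>2) * indicator ?B \<omega>"
    proof (intro AE_I2 tendsto_eventually)
      fix \<omega> assume "\<omega> \<in> space M"
      from possible_jump_part_limit[OF t this]
      show "\<forall>\<^sub>F n in sequentially. ennreal ((grid_possible_jumps t n \<omega>)\<^sup>2) * indicator (?G n) \<omega>
        = ennreal ((possible_jump_part t \<omega>)\<^sup>2) * indicator ?B \<omega>"
        by eventually_elim (simp only: indicator_def mem_Collect_eq)
    qed
    show "\<forall>\<^sub>F n in sequentially. (\<integral>\<^sup>+\<omega>. ennreal ((grid_possible_jumps t n \<omega>)\<^sup>2) * indicator (?G n) \<omega> \<partial>M)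
       \<le> ennreal (jump_bound * (2 * (rate * t)\<^sup>2))"
      using eventually_gt_at_top[of 0]
    proof eventually_elim
      case (elim n)
      have "{\<omega>\<in>space chain_sigma. 2 \<le> grid_count t n \<omega>} \<in> sets chain_sigma" by measurable
      then have G: "?G n \<in> sets chain_sigma" by simp
      note grid_jump_square[OF G t0]
      also have "ennreal jump_bound * (\<integral>\<^sup>+\<omega>. ennreal ((grid_count t n \<omega>)\<^sup>2) * indicator (?G n) \<omega> \<partial>M) \<le>
          ennreal jump_bound * ennreal (2 * (rate * t)\<^sup>2)"
        by (intro mult_left_mono grid_count_nn_integrals t0 elim) simp
      also have "\<dots> = ennreal (jump_bound * (2 * (rate * t)\<^sup>2))"
        using jump_bound_nonneg r by (intro ennreal_mult[symmetric]) auto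
      finally show ?case .
    qed
  qed measurable
qed

end

abbreviation grid_levy_part :: "real \<Rightarrow> nat \<Rightarrow> 'w \<Rightarrow> real" where
  "grid_levy_part t n \<omega> \<equiv> grid_levy_sum (state_path \<omega>) t n (\<lambda>i s. XL i s \<omega>)"

text \<open>The factor is the number of summands in the Cauchy-Schwarz inequality for the sum over the states.\<close>

definition levy_bound :: "real \<Rightarrow> real" where
  "levy_bound t = real CARD('s) * (\<Sum>i\<in>UNIV. \<integral>\<omega>. (XL i t \<omega>)\<^sup>2 \<partial>M)"

context
  assumes XL_square: "\<And>i. integrable M (\<lambda>\<omega>. (XL i 1 \<omega>)\<^sup>2)"
begin

text \<open>Write the square as a double sum over steps. The chain contributes only indicators, so each term is a
  probability, at most that of \<open>A\<close>, times the nonnegative expectation of a product of two increments; without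
  the indicators these expectations add up to the second moment at time \<open>t\<close>.\<close>

lemma grid_levy_square:
  assumes A: "A \<in> sets chain_sigma" and t: "0 \<le> t" and n: "0 < n"
  shows "(\<integral>\<^sup>+\<omega>. ennreal ((grid_levy_part t n \<omega>)\<^sup>2) * indicator A \<omega> \<partial>M)
     \<le> ennreal (levy_bound t * prob A)"
proof -
  define D where "D i m \<omega> = XL i (grid t n (Suc m)) \<omega> - XL i (grid t n m) \<omega>" for i m \<omega>
  define E where "E i m = state_at (grid t n m) i" for i m
  note g = grid_nonneg[OF t]
  have [measurable]: "D i m \<in> borel_measurable M" for i m
    unfolding D_def using g by measurable
  have Dm: "D i m \<in> borel_measurable (levy_sigma i)" for i m
    unfolding D_def by (intro borel_measurable_diff XL_measurable_levy_sigma g)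
  have AM [measurable]: "A \<in> events" using chain_sigma_events[OF A] .
  have Em: "E i m \<in> sets chain_sigma" for i m
    using measurable_sets[OF J_measurable_chain[OF g], of "{i}" n m]
    unfolding E_def by (simp add: vimage_def Int_def conj_commute)
  then have EM [measurable]: "E i m \<in> events" for i m by (rule chain_sigma_events)
  have gl: "grid_levy_part t n \<omega> = (\<Sum>i\<in>UNIV. \<Sum>m<n. indicator (E i m) \<omega> * D i m \<omega>)"
    if \<omega>: "\<omega> \<in> space M" for \<omega>
  proof -
    have "(\<Sum>i\<in>UNIV. \<Sum>m<n. indicator (E i m) \<omega> * D i m \<omega>) = (\<Sum>m<n. \<Sum>i\<in>UNIV. indicator (E i m) \<omega> * D i m \<omega>)"
      by (rule sum.swap)
    also have "\<dots> = (\<Sum>m<n. \<Sum>i\<in>UNIV. if J (grid t n m) \<omega> = i then D i m \<omega> else 0)"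
      using \<omega> by (intro sum.cong refl) (auto simp: E_def indicator_def)
    also have "\<dots> = grid_levy_part t n \<omega>"
      unfolding grid_levy_sum_def D_def by simp
    finally show ?thesis ..
  qed
  have prods: "integrable M (\<lambda>\<omega>. D i m \<omega> * D i m' \<omega>)" "0 \<le> (\<integral>\<omega>. D i m \<omega> * D i m' \<omega> \<partial>M)" for i m m'
    using levy_grid_products[OF levy XL_square t, where n=n and m=m and m'=m'] unfolding D_def by auto
  have one: "(\<integral>\<^sup>+\<omega>. ennreal ((\<Sum>m<n. indicator (E i m) \<omega> * D i m \<omega>)\<^sup>2) * indicator A \<omega> \<partial>M)
     \<le> ennreal ((\<integral>\<omega>. (XL i t \<omega>)\<^sup>2 \<partial>M) * prob A)" for i
  proof -
    let ?B = "\<lambda>m m'. A \<inter> E i m \<inter> E i m'"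
    have B: "?B m m' \<in> sets chain_sigma" for m m' using A Em by auto
    have pt: "(\<Sum>m<n. indicator (E i m) \<omega> * D i m \<omega>)\<^sup>2 * indicator A \<omega> =
        (\<Sum>m<n. \<Sum>m'<n. (D i m \<omega> * D i m' \<omega>) * indicator (?B m m') \<omega>)" for \<omega>
      unfolding power2_eq_square sum_product
      unfolding sum_distrib_right
      by (intro sum.cong refl) (auto simp: indicator_def)
    have I: "integrable M (\<lambda>\<omega>. (D i m \<omega> * D i m' \<omega>) * indicator (?B m m') \<omega>)" for m m'
      using integrable_mult_indicator[OF chain_sigma_events[OF B] prods(1)[of i m m'], of m m']
          by (simp add: mult.commute)
    have V: "(\<integral>\<omega>. (D i m \<omega> * D i m' \<omega>) * indicator (?B m m') \<omega> \<partial>M) = prob (?B m m')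
        * (\<integral>\<omega>. D i m \<omega> * D i m' \<omega> \<partial>M)" for m m'
      by (rule chain_levy_integral[OF B borel_measurable_times[OF Dm Dm] prods(1)])
    have "(\<integral>\<^sup>+\<omega>. ennreal ((\<Sum>m<n. indicator (E i m) \<omega> * D i m \<omega>)\<^sup>2) * indicator A \<omega> \<partial>M) =
       (\<integral>\<^sup>+\<omega>. ennreal ((\<Sum>m<n. indicator (E i m) \<omega> * D i m \<omega>)\<^sup>2 * indicator A \<omega>) \<partial>M)"
      by (intro nn_integral_cong) (simp add: indicator_def)
    also have "\<dots> = ennreal (\<integral>\<omega>. (\<Sum>m<n. indicator (E i m) \<omega> * D i m \<omega>)\<^sup>2 * indicator A \<omega> \<partial>M)"
    proof (rule nn_integral_eq_integral)
      show "integrable M (\<lambda>\<omega>. (\<Sum>m<n. indicator (E i m) \<omega> * D i m \<omega>)\<^sup>2 * indicator A \<omega>)"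
        unfolding pt by (intro Bochner_Integration.integrable_sum I)
    qed simp
    also have "(\<integral>\<omega>. (\<Sum>m<n. indicator (E i m) \<omega> * D i m \<omega>)\<^sup>2 * indicator A \<omega> \<partial>M) =
       (\<Sum>m<n. \<Sum>m'<n. prob (?B m m') * (\<integral>\<omega>. D i m \<omega> * D i m' \<omega> \<partial>M))"
      unfolding pt V[symmetric]
      by (subst Bochner_Integration.integral_sum, intro Bochner_Integration.integrable_sum I,
          intro sum.cong refl Bochner_Integration.integral_sum I)
    also have "\<dots> \<le> (\<Sum>m<n. \<Sum>m'<n. prob A * (\<integral>\<omega>. D i m \<omega> * D i m' \<omega> \<partial>M))"
      by (intro sum_mono mult_right_mono prods finite_measure_mono) auto
    also have "\<dots> = prob A * (\<integral>\<omega>. (\<Sum>m<n. \<Sum>m'<n. D i m \<omega> * D i m' \<omega>) \<partial>M)"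
    proof -
      have "(\<integral>\<omega>. (\<Sum>m<n. \<Sum>m'<n. D i m \<omega> * D i m' \<omega>) \<partial>M) = (\<Sum>m<n. \<Sum>m'<n. \<integral>\<omega>. D i m \<omega> * D i m' \<omega> \<partial>M)"
        by (subst Bochner_Integration.integral_sum, intro Bochner_Integration.integrable_sum prods,
            intro sum.cong refl Bochner_Integration.integral_sum prods)
      then show ?thesis by (simp only: sum_distrib_left)
    qed
    also have "(\<integral>\<omega>. (\<Sum>m<n. \<Sum>m'<n. D i m \<omega> * D i m' \<omega>) \<partial>M) = (\<integral>\<omega>. (XL i t \<omega>)\<^sup>2 \<partial>M)"
    proof (rule integral_cong_AE)
      show "(\<lambda>\<omega>. \<Sum>m<n. \<Sum>m'<n. D i m \<omega> * D i m' \<omega>) \<in> borel_measurable M" by measurable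
      show "(\<lambda>\<omega>. (XL i t \<omega>)\<^sup>2) \<in> borel_measurable M" using t by measurable
      have tele: "(\<Sum>m<n. D i m \<omega>) = XL i t \<omega> - XL i 0 \<omega>" for \<omega>
        using sum_lessThan_telescope[of "\<lambda>m. XL i (grid t n m) \<omega>" n] n unfolding D_def by simp
      have "(\<Sum>m<n. \<Sum>m'<n. D i m \<omega> * D i m' \<omega>) = (XL i t \<omega> - XL i 0 \<omega>)\<^sup>2" for \<omega>
        unfolding sum_product[symmetric] tele power2_eq_square ..
      then show "AE \<omega> in M. (\<Sum>m<n. \<Sum>m'<n. D i m \<omega> * D i m' \<omega>) = (XL i t \<omega>)\<^sup>2"
        using levy_0[OF levy[of i]] by (auto elim: AE_mp)
    qed
    finally show ?thesis by (simp add: mult.commute ennreal_leI)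
  qed
  have "(\<integral>\<^sup>+\<omega>. ennreal ((grid_levy_part t n \<omega>)\<^sup>2) * indicator A \<omega> \<partial>M) \<le>
    (\<integral>\<^sup>+\<omega>. (\<Sum>i\<in>UNIV. ennreal (real CARD('s)) * (ennreal ((\<Sum>m<n. indicator (E i m) \<omega> * D i m \<omega>)\<^sup>2)
        * indicator A \<omega>)) \<partial>M)"
  proof (intro nn_integral_mono)
    fix \<omega> assume \<omega>: "\<omega> \<in> space M"
    let ?x = "\<lambda>i. \<Sum>m<n. indicator (E i m) \<omega> * D i m \<omega>"
    have "(\<Sum>i\<in>UNIV. 1 * ?x i)\<^sup>2 \<le> (\<Sum>i\<in>(UNIV::'s set). 1\<^sup>2) * (\<Sum>i\<in>UNIV. (?x i)\<^sup>2)"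
      by (rule Cauchy_Schwarz_ineq_sum)
    then have "(\<Sum>i\<in>UNIV. ?x i)\<^sup>2 \<le> (\<Sum>i\<in>UNIV. real CARD('s) * (?x i)\<^sup>2)"
      by (simp add: sum_distrib_left)
    then have "ennreal ((\<Sum>i\<in>UNIV. ?x i)\<^sup>2) * indicator A \<omega> \<le> ennreal (\<Sum>i\<in>UNIV. real CARD('s) * (?x i)\<^sup>2)
        * indicator A \<omega>"
      by (intro mult_right_mono ennreal_leI) auto
    also have "\<dots> = (\<Sum>i\<in>UNIV. ennreal (real CARD('s)) * (ennreal ((?x i)\<^sup>2) * indicator A \<omega>))"
      by (subst sum_ennreal[symmetric]) (simp_all add: sum_distrib_right ennreal_mult' mult.assoc)
    finally show "ennreal ((grid_levy_part t n \<omega>)\<^sup>2) * indicator A \<omega> \<le>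
      (\<Sum>i\<in>UNIV. ennreal (real CARD('s)) * (ennreal ((?x i)\<^sup>2) * indicator A \<omega>))" unfolding gl[OF \<omega>] .
  qed
  also have "\<dots> = (\<Sum>i\<in>UNIV. ennreal (real CARD('s)) * (\<integral>\<^sup>+\<omega>. ennreal ((\<Sum>m<n. indicator (E i m) \<omega> * D i m \<omega>)\<^sup>2)
      * indicator A \<omega> \<partial>M))"
    by (subst nn_integral_sum, measurable, intro sum.cong refl nn_integral_cmult, measurable)
  also have "\<dots> \<le> (\<Sum>i\<in>UNIV. ennreal (real CARD('s)) * ennreal ((\<integral>\<omega>. (XL i t \<omega>)\<^sup>2 \<partial>M) * prob A))"
    by (intro sum_mono mult_left_mono one) auto
  also have "\<dots> = ennreal (levy_bound t * prob A)"
    unfolding levy_bound_def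
  proof -
    have "(\<Sum>i\<in>UNIV. ennreal (real CARD('s)) * ennreal ((\<integral>\<omega>. (XL i t \<omega>)\<^sup>2 \<partial>M) * prob A)) =
        (\<Sum>i\<in>UNIV. ennreal (real CARD('s) * ((\<integral>\<omega>. (XL i t \<omega>)\<^sup>2 \<partial>M) * prob A)))"
      by (intro sum.cong refl ennreal_mult[symmetric]) auto
    also have "\<dots> = ennreal (\<Sum>i\<in>UNIV. real CARD('s) * ((\<integral>\<omega>. (XL i t \<omega>)\<^sup>2 \<partial>M) * prob A))"
      by (rule sum_ennreal) auto
    finally show "(\<Sum>i\<in>UNIV. ennreal (real CARD('s)) * ennreal ((\<integral>\<omega>. (XL i t \<omega>)\<^sup>2 \<partial>M) * prob A)) =
        ennreal (real CARD('s) * (\<Sum>i\<in>UNIV. \<integral>\<omega>. (XL i t \<omega>)\<^sup>2 \<partial>M) * prob A)"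
      by (simp only: sum_distrib_left sum_distrib_right mult.assoc)
  qed
  finally show ?thesis .
qed

lemma grid_levy_sum_measurable:
  assumes t: "0 \<le> t"
  shows "(\<lambda>\<omega>. grid_levy_part t n \<omega>) \<in> borel_measurable M"
proof -
  have "(\<lambda>\<omega>. XL (J (grid t n m) \<omega>) s \<omega>) \<in> borel_measurable M" if "0 \<le> s" for m s
    by (rule measurable_compose_countable[where f="\<lambda>i. XL i s" and g="J (grid t n m)"])
       (rule XL_measurable[OF that], rule J_measurable[OF grid_nonneg[OF t]])
  then show ?thesis
    unfolding grid_levy_sum_def
    by (intro borel_measurable_sum borel_measurable_diff) (simp_all add: grid_nonneg[OF t])
qed

lemma levy_part_measurable_if_XL_square [measurable]:
  assumes t: "0 < t"
  shows "levy_part t \<in> borel_measurable M"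
proof -
  have t0: "0 \<le> t" using t by simp
  have "(\<lambda>\<omega>. levy_part t \<omega>) \<in> borel_measurable M"
  proof (rule borel_measurable_LIMSEQ_real)
    fix \<omega> assume "\<omega> \<in> space M"
    then show "(\<lambda>n. grid_levy_part t n \<omega>) \<longlonglongrightarrow> levy_part t \<omega>"
      unfolding levy_part_def by (intro grid_levy_sum_tendsto J_cadlag t levy_cadlag[OF levy])
  next
    fix n
    show "(\<lambda>\<omega>. grid_levy_part t n \<omega>) \<in> borel_measurable M"
      by (rule grid_levy_sum_measurable[OF t0])
  qed
  then show ?thesis .
qed

lemma levy_part_bound_if_XL_square:
  assumes A: "A \<in> sets chain_sigma" and t: "0 < t"
  shows "(\<integral>\<^sup>+\<omega>. ennreal ((levy_part t \<omega>)\<^sup>2) * indicator A \<omega> \<partial>M) \<le> ennreal (levy_bound t * prob A)"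
proof (rule nn_integral_le_of_tendsto)
  have t0: "0 \<le> t" using t by simp
  have AM: "A \<in> events" using chain_sigma_events[OF A] .
  note [measurable] = grid_levy_sum_measurable[OF t0] AM
  show "(\<lambda>\<omega>. ennreal ((grid_levy_part t n \<omega>)\<^sup>2) * indicator A \<omega>) \<in> borel_measurable M" for n
    by measurable
  show "AE \<omega> in M. (\<lambda>n. ennreal ((grid_levy_part t n \<omega>)\<^sup>2) * indicator A \<omega>) \<longlonglongrightarrow>
     ennreal ((levy_part t \<omega>)\<^sup>2) * indicator A \<omega>"
  proof (intro AE_I2)
    fix \<omega> assume "\<omega> \<in> space M"
    then have "(\<lambda>n. grid_levy_part t n \<omega>) \<longlonglongrightarrow> levy_part t \<omega>"
      unfolding levy_part_def by (intro grid_levy_sum_tendsto J_cadlag t levy_cadlag[OF levy])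
    then have "(\<lambda>n. ennreal ((grid_levy_part t n \<omega>)\<^sup>2)) \<longlonglongrightarrow> ennreal ((levy_part t \<omega>)\<^sup>2)"
      by (intro tendsto_ennrealI tendsto_power)
    then show "(\<lambda>n. ennreal ((grid_levy_part t n \<omega>)\<^sup>2) * indicator A \<omega>) \<longlonglongrightarrow>
     ennreal ((levy_part t \<omega>)\<^sup>2) * indicator A \<omega>"
      by (cases "\<omega> \<in> A") simp_all
  qed
  show "\<forall>\<^sub>F n in sequentially. (\<integral>\<^sup>+\<omega>. ennreal ((grid_levy_part t n \<omega>)\<^sup>2) * indicator A \<omega> \<partial>M)
     \<le> ennreal (levy_bound t * prob A)"
    using eventually_gt_at_top[of 0] by eventually_elim (rule grid_levy_square[OF A t0])
qed

end

section \<open>Finite moments of the Levy processes and of the jumps\<close>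

lemma prob_limit:
  assumes B: "\<And>n. B n \<in> events" "C \<in> events"
    and ev: "\<And>\<omega>. \<omega> \<in> space M \<Longrightarrow> \<forall>\<^sub>F n in sequentially. \<omega> \<in> B n \<longleftrightarrow> \<omega> \<in> C"
  shows "(\<lambda>n. prob (B n)) \<longlonglongrightarrow> prob C"
proof -
  have E: "(\<integral>\<omega>. indicator D \<omega> \<partial>M) = prob D" if "D \<in> events" for D
    using sets.sets_into_space[OF that] by (simp add: Int_absorb2)
  have "(\<lambda>n. \<integral>\<omega>. indicator (B n) \<omega> \<partial>M) \<longlonglongrightarrow> (\<integral>\<omega>. indicator C \<omega> \<partial>M :: real)"
  proof (rule integral_dominated_convergence[where w="\<lambda>_. 1"])
    show "AE \<omega> in M. (\<lambda>n. indicator (B n) \<omega> :: real) \<longlonglongrightarrow> indicator C \<omega>"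
    proof (intro AE_I2 tendsto_eventually)
      fix \<omega> assume "\<omega> \<in> space M"
      from ev[OF this] show "\<forall>\<^sub>F n in sequentially. indicator (B n) \<omega> = (indicator C \<omega> :: real)"
        by eventually_elim (simp add: indicator_def)
    qed
  qed (use B in \<open>auto simp: indicator_def\<close>)
  then show ?thesis by (simp only: E B)
qed

definition no_change :: "real \<Rightarrow> nat \<Rightarrow> nat \<Rightarrow> nat \<Rightarrow> 'w set" where
  "no_change t n k l = {\<omega>\<in>space M. \<forall>m. k \<le> m \<longrightarrow> m < l \<longrightarrow> \<not> grid_change (state_path \<omega>) t n m}"

lemma no_change_Suc: "k \<le> l \<Longrightarrow> no_change t n k (Suc l) = no_change t n k l - change_at t n l"
  by (auto simp: no_change_def change_at_def less_Suc_eq)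

text \<open>Each step without a change costs a factor of at least \<open>1 - rate * (t / n)\<close>.\<close>

lemma no_change_prob:
  assumes t: "0 \<le> t" and r: "rate * (t / real n) \<le> 1" and A: "A \<in> sets (F (grid t n k))" and kl: "k \<le> l"
  shows "A \<inter> no_change t n k l \<in> sets (F (grid t n l)) \<and>
    (1 - rate * (t / real n)) ^ (l - k) * prob A \<le> prob (A \<inter> no_change t n k l)"
  using kl
proof (induction l rule: dec_induct)
  case base
  have "A \<inter> no_change t n k k = A"
    using sets.sets_into_space[OF sets_F[OF grid_nonneg[OF t] A]] by (auto simp: no_change_def)
  then show ?case using A by simp
next
  case (step l)
  let ?r = "1 - rate * (t / real n)"
  let ?B = "A \<inter> no_change t n k l"
  have eq: "A \<inter> no_change t n k (Suc l) = ?B - change_at t n l"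
    using no_change_Suc[OF step.hyps(1)] by auto
  have gl: "grid t n l \<le> grid t n (Suc l)" using t by (simp add: grid_Suc)
  have "?B \<in> sets (F (grid t n (Suc l)))"
    using step.IH filtration_mono[OF grid_nonneg[OF t] gl] by auto
  moreover have "change_at t n l \<in> sets (F (grid t n (Suc l)))" by (rule change_at_F[OF t order_refl])
  ultimately have "?B - change_at t n l \<in> sets (F (grid t n (Suc l)))" by auto
  moreover have "?r ^ (Suc l - k) * prob A \<le> prob (?B - change_at t n l)"
  proof -
    have "?r ^ (Suc l - k) * prob A = ?r * (?r ^ (l - k) * prob A)"
      using step.hyps(1) by (simp add: Suc_diff_le)
    also have "\<dots> \<le> ?r * prob ?B" using step.IH r by (intro mult_left_mono) auto
    also have "\<dots> \<le> prob (?B - change_at t n l)" using step.IH by (intro change_at_prob_given(2)[OF t]) auto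
    finally show ?thesis .
  qed
  ultimately show ?case unfolding eq by simp
qed

lemma rate_small: "\<forall>\<^sub>F n in sequentially. rate * (t / real n) \<le> 1"
proof -
  have "(\<lambda>n. rate * (t / real n)) \<longlonglongrightarrow> rate * (t * 0)"
    unfolding divide_inverse by (intro tendsto_intros lim_inverse_n)
  then have "\<forall>\<^sub>F n in sequentially. rate * (t / real n) < 1" by (intro order_tendstoD) auto
  then show ?thesis by eventually_elim simp
qed

lemma exp_rate_limit: "(\<lambda>n. (1 - rate * (t / real n)) ^ n) \<longlonglongrightarrow> exp (- (rate * t))"
  using tendsto_exp_limit_sequentially[of "- (rate * t)"] by simp

lemma no_change_eq: "no_change t n 0 n = {\<omega>\<in>space M. grid_count t n \<omega> = 0}"
  unfolding no_change_def grid_count_def grid_jump_sum_one by auto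

text \<open>On the grids, staying in \<open>j\<close> has probability at least \<open>(1 - rate * (t / n)) ^ n\<close> times that of starting in
  \<open>j\<close>, and this tends to \<open>exp (- (rate * t))\<close> times that probability.\<close>

lemma no_jump_prob:
  assumes t: "0 < t"
  shows "0 < prob (state_at 0 j \<inter> {\<omega>\<in>space M. jump_count t \<omega> = 0})"
proof -
  have t0: "0 \<le> t" using t by simp
  note [measurable] = grid_count_measurable[OF t0] jump_count_measurable[OF t]
  have "(\<lambda>n. prob (state_at 0 j \<inter> {\<omega>\<in>space M. grid_count t n \<omega> = 0}))
      \<longlonglongrightarrow> prob (state_at 0 j \<inter> {\<omega>\<in>space M. jump_count t \<omega> = 0})"
  proof (rule prob_limit)
    fix \<omega> assume "\<omega> \<in> space M"
    from grid_count_limit[OF t this]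
    show "\<forall>\<^sub>F n in sequentially. \<omega> \<in> state_at 0 j \<inter> {\<omega>\<in>space M. grid_count t n \<omega> = 0} \<longleftrightarrow>
       \<omega> \<in> state_at 0 j \<inter> {\<omega>\<in>space M. jump_count t \<omega> = 0}"
      by eventually_elim simp
  qed (intro sets.Int state_at_events order_refl; measurable)+
  moreover have "(\<lambda>n. (1 - rate * (t / real n)) ^ n * prob (state_at 0 j)) \<longlonglongrightarrow> exp (- (rate * t))
      * prob (state_at 0 j)"
    by (intro tendsto_intros exp_rate_limit)
  moreover have "\<forall>\<^sub>F n in sequentially. (1 - rate * (t / real n)) ^ n * prob (state_at 0 j)
      \<le> prob (state_at 0 j \<inter> {\<omega>\<in>space M. grid_count t n \<omega> = 0})"
    using rate_small[of t]
  proof eventually_elim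
    case (elim n)
    show ?case
      using no_change_prob[OF t0 elim, of "state_at 0 j" 0 n] state_at_F[of 0 0 j] unfolding no_change_eq
          by simp
  qed
  ultimately have "exp (- (rate * t)) * prob (state_at 0 j)
      \<le> prob (state_at 0 j \<inter> {\<omega>\<in>space M. jump_count t \<omega> = 0})"
    by (intro tendsto_le[OF sequentially_bot])
  moreover have "0 < exp (- (rate * t)) * prob (state_at 0 j)" using start_pos[of j] by simp
  ultimately show ?thesis by linarith
qed

text \<open>The event is a disjoint union over the position \<open>m\<close> of the change: no change before \<open>m\<close>, a transition from
  \<open>i\<close> to \<open>j\<close> at step \<open>m\<close>, and no change afterwards.\<close>

lemma one_change_prob:
  assumes t: "0 \<le> t" and n: "0 < n" and r: "rate * (t / real n) \<le> 1" and ij: "i \<noteq> j"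
  shows "(1 - rate * (t / real n)) ^ n * prob (state_at 0 i) * (real n * P (t / real n) i j)
    \<le> prob (state_at 0 i \<inter> state_at t j \<inter> {\<omega>\<in>space M. grid_count t n \<omega> = 1})"
proof -
  let ?r = "1 - rate * (t / real n)"
  have r01: "0 \<le> ?r" "?r \<le> 1" using r rate(1) t by auto
  note g = grid_nonneg[OF t]
  note [measurable] = grid_count_measurable[OF t]
  define B where "B m = state_at 0 i \<inter> no_change t n 0 m \<inter> state_at (grid t n m) i
      \<inter> state_at (grid t n (Suc m)) j" for m
  define E where "E m = B m \<inter> no_change t n (Suc m) n" for m
  have d: "0 \<le> t / real n" using t by simp
  have E: "E m \<in> events \<and> ?r ^ n * prob (state_at 0 i) * P (t / real n) i j \<le> prob (E m)" if m: "m < n" for m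
  proof -
    have A: "state_at 0 i \<inter> no_change t n 0 m \<in> sets (F (grid t n m))"
      "?r ^ m * prob (state_at 0 i) \<le> prob (state_at 0 i \<inter> no_change t n 0 m)"
      using no_change_prob[OF t r, of "state_at 0 i" 0 m] state_at_F[of 0 0 i] by simp_all
    have Aeq: "state_at 0 i \<inter> no_change t n 0 m \<inter> state_at (grid t n m) i = state_at 0 i \<inter> no_change t n 0 m"
      using grid_const[of 0 m "state_path _" t n] by (auto simp: no_change_def)
    have gl: "grid t n m \<le> grid t n (Suc m)" using t by (simp add: grid_Suc)
    have BF: "B m \<in> sets (F (grid t n (Suc m)))"
      using A(1) filtration_mono[OF g gl] state_at_F[OF g gl, of i] state_at_F[OF g order_refl, of n "Suc m" j]
      unfolding B_def by auto
    have "prob (B m) = prob (state_at 0 i \<inter> no_change t n 0 m) * P (t / real n) i j"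
      using chain_step[OF g d A(1), of i j] unfolding B_def Aeq grid_Suc by simp
    then have Bm: "?r ^ m * prob (state_at 0 i) * P (t / real n) i j \<le> prob (B m)"
      using A(2) P_bounds by (simp add: mult_right_mono)
    have N: "E m \<in> sets (F (grid t n n))" "?r ^ (n - Suc m) * prob (B m) \<le> prob (E m)"
      using no_change_prob[OF t r BF, of n] m unfolding E_def by auto
    have "?r ^ n * prob (state_at 0 i) * P (t / real n) i j \<le> ?r ^ (n - Suc m) * ?r ^ m
        * (prob (state_at 0 i) * P (t / real n) i j)"
    proof -
      have "?r ^ n \<le> ?r ^ ((n - Suc m) + m)" using r01 m by (intro power_decreasing) auto
      then have "?r ^ n \<le> ?r ^ (n - Suc m) * ?r ^ m" by (simp only: power_add)
      then have "?r ^ n * (prob (state_at 0 i) * P (t / real n) i j) \<le> ?r ^ (n - Suc m) * ?r ^ m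
          * (prob (state_at 0 i) * P (t / real n) i j)"
        using P_bounds by (intro mult_right_mono) auto
      then show ?thesis by (simp only: mult.assoc)
    qed
    also have "\<dots> = ?r ^ (n - Suc m) * (?r ^ m * prob (state_at 0 i) * P (t / real n) i j)"
        by (simp only: mult.assoc)
    also have "\<dots> \<le> ?r ^ (n - Suc m) * prob (B m)" using Bm r01 by (intro mult_left_mono) auto
    also have "\<dots> \<le> prob (E m)" by (rule N)
    finally show ?thesis using sets_F[OF g N(1)] by simp
  qed
  have disj: "disjoint_family_on E {..<n}"
  proof -
    have "E m \<inter> E m' = {}" if "m < m'" for m m'
    proof -
      have "\<not> grid_change (state_path \<omega>) t n m" if "\<omega> \<in> E m'" for \<omega>
        using that \<open>m < m'\<close> unfolding E_def B_def no_change_def by auto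
      moreover have "grid_change (state_path \<omega>) t n m" if "\<omega> \<in> E m" for \<omega>
        using that ij unfolding E_def B_def grid_change_def by auto
      ultimately show ?thesis by auto
    qed
    then show ?thesis unfolding disjoint_family_on_def by (metis Int_commute linorder_neqE_nat)
  qed
  have sub: "E m \<subseteq> state_at 0 i \<inter> state_at t j \<inter> {\<omega>\<in>space M. grid_count t n \<omega> = 1}" if m: "m < n" for m
  proof
    fix \<omega> assume \<omega>: "\<omega> \<in> E m"
    then have s: "\<omega> \<in> space M" "J 0 \<omega> = i" "J (grid t n m) \<omega> = i" "J (grid t n (Suc m)) \<omega> = j"
      and nc: "\<And>k. k < m \<Longrightarrow> \<not> grid_change (state_path \<omega>) t n k" "\<And>k. Suc m \<le> k \<Longrightarrow> k < n
          \<Longrightarrow> \<not> grid_change (state_path \<omega>) t n k"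
      unfolding E_def B_def no_change_def by auto
    have c: "grid_change (state_path \<omega>) t n m" using s ij by (simp add: grid_change_def)
    have "{k. k < n \<and> grid_change (state_path \<omega>) t n k} = {m}"
      using nc c m by (auto simp: not_less_eq_eq) (metis Suc_leI linorder_neqE_nat)
    then have "grid_count t n \<omega> = 1" unfolding grid_count_def grid_jump_sum_one by simp
    moreover have "J (grid t n n) \<omega> = J (grid t n (Suc m)) \<omega>"
      using grid_const[of "Suc m" n "state_path \<omega>" t n] nc m by auto
    ultimately show "\<omega> \<in> state_at 0 i \<inter> state_at t j \<inter> {\<omega>\<in>space M. grid_count t n \<omega> = 1}"
      using s n by simp
  qed
  have "?r ^ n * prob (state_at 0 i) * (real n * P (t / real n) i j) = (\<Sum>m<n. ?r ^ n * prob (state_at 0 i)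
      * P (t / real n) i j)"
    by simp
  also have "\<dots> \<le> (\<Sum>m<n. prob (E m))" using E by (intro sum_mono) auto
  also have "\<dots> = prob (\<Union>m\<in>{..<n}. E m)"
    using E disj by (intro finite_measure_finite_Union[symmetric]) auto
  also have "\<dots> \<le> prob (state_at 0 i \<inter> state_at t j \<inter> {\<omega>\<in>space M. grid_count t n \<omega> = 1})"
  proof (rule finite_measure_mono)
    show "(\<Union>m\<in>{..<n}. E m) \<subseteq> state_at 0 i \<inter> state_at t j \<inter> {\<omega>\<in>space M. grid_count t n \<omega> = 1}" using sub by auto
    have "{\<omega>\<in>space M. grid_count t n \<omega> = 1} \<in> events" by measurable
    then show "state_at 0 i \<inter> state_at t j \<inter> {\<omega>\<in>space M. grid_count t n \<omega> = 1} \<in> events"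
      using t by (intro sets.Int state_at_events) auto
  qed
  finally show ?thesis .
qed

lemma one_jump_prob:
  assumes t: "0 < t" and ij: "i \<noteq> j" "Q $ i $ j \<noteq> 0"
  shows "0 < prob (state_at 0 i \<inter> state_at t j \<inter> {\<omega>\<in>space M. jump_count t \<omega> = 1})"
proof -
  have t0: "0 \<le> t" using t by simp
  note [measurable] = grid_count_measurable[OF t0] jump_count_measurable[OF t]
  have q: "0 < Q $ i $ j" using intensity ij unfolding intensity_matrix_def by (metis order_le_less)
  have "(\<lambda>n. prob (state_at 0 i \<inter> state_at t j \<inter> {\<omega>\<in>space M. grid_count t n \<omega> = 1})) \<longlonglongrightarrow>
      prob (state_at 0 i \<inter> state_at t j \<inter> {\<omega>\<in>space M. jump_count t \<omega> = 1})"
  proof (rule prob_limit)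
    fix \<omega> assume "\<omega> \<in> space M"
    from grid_count_limit[OF t this]
    show "\<forall>\<^sub>F n in sequentially. \<omega> \<in> state_at 0 i \<inter> state_at t j \<inter> {\<omega>\<in>space M. grid_count t n \<omega> = 1} \<longleftrightarrow>
       \<omega> \<in> state_at 0 i \<inter> state_at t j \<inter> {\<omega>\<in>space M. jump_count t \<omega> = 1}"
      by eventually_elim simp
  qed (intro sets.Int state_at_events order_refl t0; measurable)+
  moreover have "(\<lambda>n. (1 - rate * (t / real n)) ^ n * prob (state_at 0 i) * (real n * P (t / real n) i j)) \<longlonglongrightarrow>
      exp (- (rate * t)) * prob (state_at 0 i) * (t * Q $ i $ j)"
    by (intro tendsto_intros exp_rate_limit jump_rate_limit t ij)
  moreover have "\<forall>\<^sub>F n in sequentially. (1 - rate * (t / real n)) ^ n * prob (state_at 0 i)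
      * (real n * P (t / real n) i j)
      \<le> prob (state_at 0 i \<inter> state_at t j \<inter> {\<omega>\<in>space M. grid_count t n \<omega> = 1})"
    using rate_small[of t] eventually_gt_at_top[of 0]
    by eventually_elim (rule one_change_prob[OF t0 _ _ ij(1)])
  ultimately have "exp (- (rate * t)) * prob (state_at 0 i) * (t * Q $ i $ j)
      \<le> prob (state_at 0 i \<inter> state_at t j \<inter> {\<omega>\<in>space M. jump_count t \<omega> = 1})"
    by (intro tendsto_le[OF sequentially_bot])
  moreover have "0 < exp (- (rate * t)) * prob (state_at 0 i) * (t * Q $ i $ j)"
    using start_pos[of i] q t by simp
  ultimately show ?thesis by linarith
qed

lemma X_1_square_integrable: "integrable M (\<lambda>\<omega>. (X 1 \<omega>)\<^sup>2)"
proof -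
  have "integrable M (\<lambda>\<omega>. \<Sum>i\<in>UNIV. indicator (state_at 0 i) \<omega> * (X 1 \<omega>)\<^sup>2)"
    using square_integrable_1 by (intro Bochner_Integration.integrable_sum) (simp add: integrable_given_start)
  moreover have "(\<Sum>i\<in>UNIV. indicator (state_at 0 i) \<omega> * (X 1 \<omega>)\<^sup>2) = (X 1 \<omega>)\<^sup>2" if "\<omega> \<in> space M" for \<omega>
  proof -
    have "(\<Sum>i\<in>UNIV. indicator (state_at 0 i) \<omega> * (X 1 \<omega>)\<^sup>2) = (\<Sum>i\<in>UNIV. if J 0 \<omega> = i then (X 1 \<omega>)\<^sup>2 else 0)"
      using that by (intro sum.cong) (auto simp: indicator_def)
    then show ?thesis by simp
  qed
  ultimately show ?thesis by (simp cong: Bochner_Integration.integrable_cong)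
qed

lemma state_at_chain: "0 \<le> t \<Longrightarrow> state_at t i \<in> sets chain_sigma"
  using measurable_sets[OF J_measurable_chain, of t "{i}"]
  by (simp add: vimage_def Int_def conj_commute)

lemma jump_count_chain:
  assumes "0 < t" "Measurable.pred borel R"
  shows "{\<omega>\<in>space M. R (jump_count t \<omega>)} \<in> sets chain_sigma"
proof -
  note [measurable] = jump_count_measurable_chain[OF assms(1)] assms(2)
  have "{\<omega>\<in>space chain_sigma. R (jump_count t \<omega>)} \<in> sets chain_sigma" by measurable
  then show ?thesis by simp
qed

lemma X_no_jump:
  assumes t: "0 < t"
  shows "AE \<omega> in M. jump_count t \<omega> = 0 \<longrightarrow> X t \<omega> = XL (J 0 \<omega>) t \<omega>"
proof -
  have "AE \<omega> in M. \<forall>i. XL i 0 \<omega> = 0"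
    unfolding AE_all_countable using levy_0[OF levy] by simp
  with X_decomposition AE_space show ?thesis
  proof (eventually_elim, intro impI)
    fix \<omega> assume d: "\<forall>t\<ge>0. X t \<omega> = levy_part t \<omega> + jump_part t \<omega>" and z: "\<forall>i. XL i 0 \<omega> = 0"
      and \<omega>: "\<omega> \<in> space M" and c: "jump_count t \<omega> = 0"
    note c' = c[unfolded jump_count_def]
    have "jump_part t \<omega> = 0"
      unfolding jump_part_def by (rule no_jump(1)[OF J_cadlag[OF \<omega>] t c'])
    moreover have "levy_part t \<omega> = XL (J 0 \<omega>) t \<omega> - XL (J 0 \<omega>) 0 \<omega>"
      unfolding levy_part_def
      by (rule no_jump_levy_integral[OF J_cadlag[OF \<omega>] t c']) (rule levy_cadlag[OF levy \<omega>])
    ultimately show "X t \<omega> = XL (J 0 \<omega>) t \<omega>" using d z t by simp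
  qed
qed

lemma X_decomposition_possible_jumps:
  assumes t: "0 < t"
  shows "AE \<omega> in M. X t \<omega> = levy_part t \<omega> + possible_jump_part t \<omega>"
  using X_decomposition jump_part_eq[OF t] by eventually_elim (use t in auto)

lemma one_jump_part:
  assumes "0 < t" "\<omega> \<in> space M" "jump_count t \<omega> = 1"
  shows "possible_jump_part t \<omega> = possible_jump \<omega> (J 0 \<omega>) (J t \<omega>) 1" "J t \<omega> \<noteq> J 0 \<omega>"
  using one_jump[OF J_cadlag[OF assms(2)] assms(1) assms(3)[unfolded jump_count_def]]
  unfolding possible_jump_part_def by auto

lemma no_jump_state:
  assumes "0 < t" "\<omega> \<in> space M" "jump_count t \<omega> = 0"
  shows "J t \<omega> = J 0 \<omega>"
  by (rule no_jump(2)[OF J_cadlag[OF assms(2)] assms(1) assms(3)[unfolded jump_count_def]])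

text \<open>Without a jump up to time \<open>1\<close> and started in \<open>j\<close>, the process \<open>X\<close> coincides with \<open>XL j\<close> at time \<open>1\<close>. This
  event has positive probability and is independent of \<open>XL j\<close>.\<close>

lemma XL_square: "integrable M (\<lambda>\<omega>. (XL j 1 \<omega>)\<^sup>2)"
proof -
  define A where "A = state_at 0 j \<inter> {\<omega>\<in>space M. jump_count 1 \<omega> = 0}"
  have Ac: "A \<in> sets chain_sigma"
    unfolding A_def by (intro sets.Int state_at_chain jump_count_chain) auto
  have [measurable]: "A \<in> events" by (rule chain_sigma_events[OF Ac])
  have pos: "0 < prob A" unfolding A_def by (rule no_jump_prob) simp
  have [measurable]: "XL j 1 \<in> borel_measurable M" "X 1 \<in> borel_measurable M" by auto
  have "emeasure M A * (\<integral>\<^sup>+\<omega>. ennreal ((XL j 1 \<omega>)\<^sup>2) \<partial>M) = (\<integral>\<^sup>+\<omega>. ennreal ((XL j 1 \<omega>)\<^sup>2) * indicator A \<omega> \<partial>M)"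
  proof (rule chain_levy_nn_integral[OF Ac, symmetric])
    have "XL j 1 \<in> borel_measurable (levy_sigma j)" by (rule XL_measurable_levy_sigma) simp
    then show "(\<lambda>\<omega>. ennreal ((XL j 1 \<omega>)\<^sup>2)) \<in> borel_measurable (levy_sigma j)" by measurable
  qed
  also have "\<dots> \<le> (\<integral>\<^sup>+\<omega>. ennreal ((X 1 \<omega>)\<^sup>2) \<partial>M)"
  proof (rule nn_integral_mono_AE)
    show "AE \<omega> in M. ennreal ((XL j 1 \<omega>)\<^sup>2) * indicator A \<omega> \<le> ennreal ((X 1 \<omega>)\<^sup>2)"
      using X_no_jump[of 1] by (auto simp: A_def indicator_def elim!: eventually_mono)
  qed
  also have "\<dots> < \<infinity>"
    using X_1_square_integrable by (subst nn_integral_eq_integral) auto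
  finally have "(\<integral>\<^sup>+\<omega>. ennreal ((XL j 1 \<omega>)\<^sup>2) \<partial>M) < \<infinity>"
    using pos by (auto simp: ennreal_mult_less_top emeasure_eq_measure)
  then show ?thesis by (intro integrableI_bounded) auto
qed

lemmas levy_part_measurable [measurable] = levy_part_measurable_if_XL_square[OF XL_square]
lemmas levy_part_bound = levy_part_bound_if_XL_square[OF XL_square]

lemma levy_part_square_integrable:
  assumes t: "0 < t"
  shows "integrable M (\<lambda>\<omega>. (levy_part t \<omega>)\<^sup>2)"
proof (rule integrableI_bounded)
  note [measurable] = levy_part_measurable[OF t]
  show "(\<lambda>\<omega>. (levy_part t \<omega>)\<^sup>2) \<in> borel_measurable M" by measurable
  have top: "space M \<in> sets chain_sigma" using sets.top[of chain_sigma] by simp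
  have "(\<integral>\<^sup>+\<omega>. ennreal (norm ((levy_part t \<omega>)\<^sup>2)) \<partial>M) = (\<integral>\<^sup>+\<omega>. ennreal ((levy_part t \<omega>)\<^sup>2)
      * indicator (space M) \<omega> \<partial>M)"
    by (intro nn_integral_cong) simp
  also have "\<dots> \<le> ennreal (levy_bound t * prob (space M))" by (rule levy_part_bound[OF top t])
  also have "\<dots> < \<infinity>" by simp
  finally show "(\<integral>\<^sup>+\<omega>. ennreal (norm ((levy_part t \<omega>)\<^sup>2)) \<partial>M) < \<infinity>" .
qed

text \<open>With exactly one jump up to time \<open>1\<close>, from \<open>i\<close> to \<open>j\<close>, the variable \<open>Z i j 1\<close> is the difference of \<open>X 1\<close> and
  the Levy part, both of which are square integrable.\<close>

lemma Z_square:
  assumes ij: "i \<noteq> j" "Q $ i $ j \<noteq> 0"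
  shows "integrable M (\<lambda>\<omega>. (Z i j 1 \<omega>)\<^sup>2)"
proof -
  define A where "A = state_at 0 i \<inter> state_at 1 j \<inter> {\<omega>\<in>space M. jump_count 1 \<omega> = 1}"
  have Ac: "A \<in> sets chain_sigma"
    unfolding A_def by (intro sets.Int state_at_chain jump_count_chain) auto
  have [measurable]: "A \<in> events" by (rule chain_sigma_events[OF Ac])
  have pos: "0 < prob A" unfolding A_def by (rule one_jump_prob[OF _ ij]) simp
  have [measurable]: "Z i j 1 \<in> borel_measurable M" "X 1 \<in> borel_measurable M"
      "levy_part 1 \<in> borel_measurable M"
    using ij levy_part_measurable[of 1] by auto
  have "emeasure M A * (\<integral>\<^sup>+\<omega>. ennreal ((Z i j 1 \<omega>)\<^sup>2) \<partial>M) = (\<integral>\<^sup>+\<omega>. ennreal ((Z i j 1 \<omega>)\<^sup>2) * indicator A \<omega> \<partial>M)"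
    using ij by (intro chain_jump_nn_integral[OF Ac, where g="\<lambda>x. ennreal (x\<^sup>2)", symmetric]) auto
  also have "\<dots> \<le> (\<integral>\<^sup>+\<omega>. ennreal (2 * (X 1 \<omega>)\<^sup>2 + 2 * (levy_part 1 \<omega>)\<^sup>2) \<partial>M)"
  proof (rule nn_integral_mono_AE)
    have dec: "AE \<omega> in M. X 1 \<omega> = levy_part 1 \<omega> + possible_jump_part 1 \<omega>"
        by (rule X_decomposition_possible_jumps) simp
    show "AE \<omega> in M. ennreal ((Z i j 1 \<omega>)\<^sup>2) * indicator A \<omega> \<le> ennreal (2 * (X 1 \<omega>)\<^sup>2 + 2 * (levy_part 1 \<omega>)\<^sup>2)"
      using dec AE_space
    proof eventually_elim
      case (elim \<omega>)
      show ?case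
      proof (cases "\<omega> \<in> A")
        case True
        then have "possible_jump_part 1 \<omega> = Z i j 1 \<omega>"
          using one_jump_part(1)[of 1 \<omega>] ij elim(2) by (simp add: A_def possible_jump_def)
        then have "(Z i j 1 \<omega>)\<^sup>2 = (X 1 \<omega> + (- levy_part 1 \<omega>))\<^sup>2" using elim(1) by simp
        also have "\<dots> \<le> 2 * (X 1 \<omega>)\<^sup>2 + 2 * (- levy_part 1 \<omega>)\<^sup>2" by (rule square_add_le)
        finally show ?thesis using True by (simp add: ennreal_leI del: ennreal_plus)
      qed simp
    qed
  qed
  also have "\<dots> < \<infinity>"
    using X_1_square_integrable levy_part_square_integrable[of 1] by (subst nn_integral_eq_integral) auto
  finally have "(\<integral>\<^sup>+\<omega>. ennreal ((Z i j 1 \<omega>)\<^sup>2) \<partial>M) < \<infinity>"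
    using pos by (auto simp: ennreal_mult_less_top emeasure_eq_measure)
  then show ?thesis by (intro integrableI_bounded) (auto simp del: One_nat_def)
qed

lemma jump_part_bound:
  assumes t: "0 < t"
  shows "(\<integral>\<^sup>+\<omega>. ennreal ((possible_jump_part t \<omega>)\<^sup>2) \<partial>M) \<le> ennreal (jump_bound * (rate * t + (rate * t)\<^sup>2))"
    and "(\<integral>\<^sup>+\<omega>. ennreal ((possible_jump_part t \<omega>)\<^sup>2) * indicator {\<omega>\<in>space M. 2 \<le> jump_count t \<omega>} \<omega> \<partial>M)
      \<le> ennreal (jump_bound * (2 * (rate * t)\<^sup>2))"
  by (rule jump_part_bound_if_Z_square[OF _ t], rule Z_square; assumption)+

lemma possible_jump_part_square_integrable:
  assumes t: "0 < t"
  shows "integrable M (\<lambda>\<omega>. (possible_jump_part t \<omega>)\<^sup>2)"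
proof (rule integrableI_bounded)
  note [measurable] = possible_jump_part_measurable[OF t]
  show "(\<lambda>\<omega>. (possible_jump_part t \<omega>)\<^sup>2) \<in> borel_measurable M" by measurable
  show "(\<integral>\<^sup>+\<omega>. ennreal (norm ((possible_jump_part t \<omega>)\<^sup>2)) \<partial>M) < \<infinity>"
    using jump_part_bound(1)[OF t] by (simp add: le_less_trans[OF _ ennreal_less_top])
qed

lemma X_square_integrable:
  assumes t: "0 \<le> t"
  shows "integrable M (\<lambda>\<omega>. (X t \<omega>)\<^sup>2)"
proof (cases "t = 0")
  case True
  have "integrable M (\<lambda>\<omega>. 0 :: real)" by simp
  then show ?thesis unfolding True by (simp add: X_0 cong: Bochner_Integration.integrable_cong)
next
  case False
  then have t': "0 < t" using t by simp
  note [measurable] = levy_part_measurable[OF t'] possible_jump_part_measurable[OF t'] X_measurable[OF t]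
  have "integrable M (\<lambda>\<omega>. (levy_part t \<omega> + possible_jump_part t \<omega>)\<^sup>2)"
    by (intro integrable_square_add levy_part_square_integrable possible_jump_part_square_integrable t')
        measurable
  then show ?thesis
  proof (rule integrable_cong_AE_imp)
    show "AE \<omega> in M. (levy_part t \<omega> + possible_jump_part t \<omega>)\<^sup>2 = (X t \<omega>)\<^sup>2"
      using X_decomposition_possible_jumps[OF t'] by eventually_elim simp
  qed measurable
qed

end

section \<open>Moments at small times\<close>

lemma integral_le_of_nn_integral:
  fixes f :: "'a \<Rightarrow> real"
  assumes "f \<in> borel_measurable M" "\<And>\<omega>. 0 \<le> f \<omega>" "(\<integral>\<^sup>+\<omega>. ennreal (f \<omega>) \<partial>M) \<le> ennreal c" "0 \<le> c"
  shows "(\<integral>\<omega>. f \<omega> \<partial>M) \<le> c"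
  using assms by (subst integral_eq_nn_integral) (auto intro: enn2real_leI)

text \<open>The error terms at small times are all of the order of \<open>h * sqrt h\<close>, hence negligible against \<open>h\<close>.\<close>

lemma rate_limit_of_bound:
  fixes f g :: "real \<Rightarrow> real"
  assumes g: "((\<lambda>h. g h / h) \<longlongrightarrow> L) (at_right 0)"
    and b: "\<And>h. 0 < h \<Longrightarrow> h \<le> 1 \<Longrightarrow> \<bar>f h - g h\<bar> \<le> C * (h * sqrt h)"
  shows "((\<lambda>h. f h / h) \<longlongrightarrow> L) (at_right 0)"
proof -
  have "((\<lambda>h. f h / h - g h / h) \<longlongrightarrow> 0) (at_right 0)"
  proof (rule Lim_null_comparison)
    show "\<forall>\<^sub>F h in at_right 0. norm (f h / h - g h / h) \<le> C * sqrt h"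
      unfolding eventually_at_right_field
    proof (intro exI[of _ 1] conjI allI impI)
      fix h :: real assume h: "0 < h" "h < 1"
      have "norm (f h / h - g h / h) = \<bar>f h - g h\<bar> / h"
        using h by (simp add: diff_divide_distrib[symmetric])
      also have "\<dots> \<le> C * (h * sqrt h) / h" using b[of h] h by (intro divide_right_mono) auto
      finally show "norm (f h / h - g h / h) \<le> C * sqrt h" using h by simp
    qed simp
    have "((\<lambda>h. C * sqrt h) \<longlongrightarrow> C * sqrt 0) (at_right 0)" by (intro tendsto_intros)
    then show "((\<lambda>h. C * sqrt h) \<longlongrightarrow> 0) (at_right 0)" by simp
  qed
  from tendsto_add[OF this g] show ?thesis by simp
qed

lemma weighted_product_bound:
  fixes a b e :: real
  assumes "0 < e"
  shows "2 * \<bar>a * b\<bar> \<le> a\<^sup>2 / e + e * b\<^sup>2"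
proof -
  have "2 * \<bar>a / sqrt e\<bar> * \<bar>sqrt e * b\<bar> \<le> \<bar>a / sqrt e\<bar>\<^sup>2 + \<bar>sqrt e * b\<bar>\<^sup>2"
    by (rule sum_squares_bound)
  then show ?thesis using assms by (simp add: abs_mult power_divide power_mult_distrib)
qed

context map_setting
begin

definition levy_const :: real where
  "levy_const = real CARD('s) * (\<Sum>i\<in>UNIV. variance (XL i 1) + (expectation (XL i 1))\<^sup>2)"

lemma levy_const_nonneg: "0 \<le> levy_const"
  unfolding levy_const_def by (intro mult_nonneg_nonneg sum_nonneg add_nonneg_nonneg variance_positive) auto

lemma XL_second_moment: "0 \<le> h \<Longrightarrow> (\<integral>\<omega>. (XL i h \<omega>)\<^sup>2 \<partial>M) = h * variance (XL i 1) + h\<^sup>2 * (expectation (XL i 1))\<^sup>2"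
  by (rule levy_second_moment[OF levy XL_square])

lemma levy_bound_small:
  assumes h: "0 < h" "h \<le> 1"
  shows "levy_bound h \<le> levy_const * h"
proof -
  have "(\<Sum>i\<in>UNIV. \<integral>\<omega>. (XL i h \<omega>)\<^sup>2 \<partial>M) \<le> (\<Sum>i\<in>UNIV. (variance (XL i 1) + (expectation (XL i 1))\<^sup>2) * h)"
  proof (rule sum_mono)
    fix i
    have "h\<^sup>2 \<le> h" using h by (simp add: power2_eq_square mult_left_le)
    then have "h\<^sup>2 * (expectation (XL i 1))\<^sup>2 \<le> h * (expectation (XL i 1))\<^sup>2" by (rule mult_right_mono) simp
    then show "(\<integral>\<omega>. (XL i h \<omega>)\<^sup>2 \<partial>M) \<le> (variance (XL i 1) + (expectation (XL i 1))\<^sup>2) * h"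
      using h by (simp add: XL_second_moment algebra_simps)
  qed
  then show ?thesis
    unfolding levy_bound_def levy_const_def
    by (simp add: sum_distrib_right[symmetric] mult.assoc mult_left_mono)
qed

lemma levy_part_small:
  assumes h: "0 < h" "h \<le> 1" and A: "A \<in> sets chain_sigma"
  shows "integrable M (\<lambda>\<omega>. (levy_part h \<omega>)\<^sup>2 * indicator A \<omega>)"
    "(\<integral>\<omega>. (levy_part h \<omega>)\<^sup>2 * indicator A \<omega> \<partial>M) \<le> levy_const * h * prob A"
proof -
  have [measurable]: "A \<in> events" using chain_sigma_events[OF A] .
  note [measurable] = levy_part_measurable[OF h(1)]
  show "integrable M (\<lambda>\<omega>. (levy_part h \<omega>)\<^sup>2 * indicator A \<omega>)"
    using integrable_mult_indicator[of A M "\<lambda>\<omega>. (levy_part h \<omega>)\<^sup>2"] levy_part_square_integrable[OF h(1)]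
        by (simp add: mult.commute)
  show "(\<integral>\<omega>. (levy_part h \<omega>)\<^sup>2 * indicator A \<omega> \<partial>M) \<le> levy_const * h * prob A"
  proof (rule integral_le_of_nn_integral)
    have "(\<integral>\<^sup>+\<omega>. ennreal ((levy_part h \<omega>)\<^sup>2 * indicator A \<omega>) \<partial>M) = (\<integral>\<^sup>+\<omega>. ennreal ((levy_part h \<omega>)\<^sup>2)
        * indicator A \<omega> \<partial>M)"
      by (intro nn_integral_cong) (simp add: indicator_def)
    also have "\<dots> \<le> ennreal (levy_bound h * prob A)" by (rule levy_part_bound[OF A h(1)])
    also have "\<dots> \<le> ennreal (levy_const * h * prob A)"
      by (intro ennreal_leI mult_right_mono levy_bound_small h) simp
    finally show "(\<integral>\<^sup>+\<omega>. ennreal ((levy_part h \<omega>)\<^sup>2 * indicator A \<omega>) \<partial>M) \<le> ennreal (levy_const * h * prob A)" .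
    show "0 \<le> levy_const * h * prob A" using levy_const_nonneg h by simp
  qed auto
qed

abbreviation many_jumps :: "real \<Rightarrow> 'w set" where
  "many_jumps h \<equiv> {\<omega>\<in>space M. 2 \<le> jump_count h \<omega>}"

definition many_const :: real where
  "many_const = 2 * levy_const * rate\<^sup>2 + 4 * jump_bound * rate\<^sup>2 + rate\<^sup>2"

lemma many_const_nonneg: "0 \<le> many_const"
  unfolding many_const_def using levy_const_nonneg jump_bound_nonneg
      by (intro add_nonneg_nonneg mult_nonneg_nonneg) auto

text \<open>On the event of two or more jumps \<open>1 + X\<^sup>2\<close> dominates both the absolute value of \<open>X\<close> and
  \<open>X\<^sup>2\<close>, so one bound serves the
  first and the second moment.\<close>

lemma many_jumps_small:
  assumes h: "0 < h" "h \<le> 1"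
  shows "(\<integral>\<omega>. (1 + (X h \<omega>)\<^sup>2) * indicator (many_jumps h) \<omega> \<partial>M) \<le> many_const * h\<^sup>2"
proof -
  note [measurable] = levy_part_measurable[OF h(1)] possible_jump_part_measurable[OF h(1)]
      X_measurable[OF less_imp_le[OF h(1)]]
    jump_count_measurable[OF h(1)]
  have Ac: "many_jumps h \<in> sets chain_sigma" by (rule jump_count_chain[OF h(1)]) simp
  have AM [measurable]: "many_jumps h \<in> events" by measurable
  have p: "prob (many_jumps h) \<le> rate\<^sup>2 * h\<^sup>2"
    using jump_count_prob(2)[OF h(1)] by (simp add: power_mult_distrib)
  have Wi: "integrable M (\<lambda>\<omega>. (possible_jump_part h \<omega>)\<^sup>2 * indicator (many_jumps h) \<omega>)"
    using integrable_mult_indicator[OF AM possible_jump_part_square_integrable[OF h(1)]]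
        by (simp add: mult.commute)
  have W: "(\<integral>\<omega>. (possible_jump_part h \<omega>)\<^sup>2 * indicator (many_jumps h) \<omega> \<partial>M) \<le> jump_bound * (2 * (rate * h)\<^sup>2)"
  proof (rule integral_le_of_nn_integral)
    have "(\<integral>\<^sup>+\<omega>. ennreal ((possible_jump_part h \<omega>)\<^sup>2 * indicator (many_jumps h) \<omega>) \<partial>M) =
       (\<integral>\<^sup>+\<omega>. ennreal ((possible_jump_part h \<omega>)\<^sup>2) * indicator (many_jumps h) \<omega> \<partial>M)"
      by (intro nn_integral_cong) (simp add: indicator_def)
    then show "(\<integral>\<^sup>+\<omega>. ennreal ((possible_jump_part h \<omega>)\<^sup>2 * indicator (many_jumps h) \<omega>) \<partial>M)
        \<le> ennreal (jump_bound * (2 * (rate * h)\<^sup>2))"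
      using jump_part_bound(2)[OF h(1)] by simp
  qed (use jump_bound_nonneg in auto)
  note Y = levy_part_small[OF h Ac]
  have I1: "integrable M (\<lambda>\<omega>. indicator (many_jumps h) \<omega> :: real)" by (simp add: emeasure_eq_measure)
  have E1: "(\<integral>\<omega>. indicator (many_jumps h) \<omega> \<partial>M) = prob (many_jumps h)"
    using sets.sets_into_space[OF AM] by (simp add: Int_absorb2)
  have IX: "integrable M (\<lambda>\<omega>. (1 + (X h \<omega>)\<^sup>2) * indicator (many_jumps h) \<omega>)"
    using integrable_mult_indicator[OF AM, of "\<lambda>\<omega>. 1 + (X h \<omega>)\<^sup>2"] X_square_integrable[of h] h
        by (simp add: mult.commute)
  have "(\<integral>\<omega>. (1 + (X h \<omega>)\<^sup>2) * indicator (many_jumps h) \<omega> \<partial>M) \<le>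
     (\<integral>\<omega>. indicator (many_jumps h) \<omega> + 2 * ((levy_part h \<omega>)\<^sup>2 * indicator (many_jumps h) \<omega>)
        + 2 * ((possible_jump_part h \<omega>)\<^sup>2 * indicator (many_jumps h) \<omega>) \<partial>M)"
  proof (rule integral_mono_AE[OF IX])
    show "integrable M (\<lambda>\<omega>. indicator (many_jumps h) \<omega> + 2 * ((levy_part h \<omega>)\<^sup>2 * indicator (many_jumps h) \<omega>)
        + 2 * ((possible_jump_part h \<omega>)\<^sup>2 * indicator (many_jumps h) \<omega>))"
      by (intro Bochner_Integration.integrable_add integrable_mult_right I1 Y Wi)
    show "AE \<omega> in M. (1 + (X h \<omega>)\<^sup>2) * indicator (many_jumps h) \<omega> \<le> indicator (many_jumps h) \<omega> +
        2 * ((levy_part h \<omega>)\<^sup>2 * indicator (many_jumps h) \<omega>) + 2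
            * ((possible_jump_part h \<omega>)\<^sup>2 * indicator (many_jumps h) \<omega>)"
      using X_decomposition_possible_jumps[OF h(1)]
    proof eventually_elim
      case (elim \<omega>)
      show ?case unfolding elim using square_add_le[of "levy_part h \<omega>" "possible_jump_part h \<omega>"]
          by (simp add: indicator_def)
    qed
  qed
  also have "\<dots> = prob (many_jumps h) + 2 * (\<integral>\<omega>. (levy_part h \<omega>)\<^sup>2 * indicator (many_jumps h) \<omega> \<partial>M)
      + 2 * (\<integral>\<omega>. (possible_jump_part h \<omega>)\<^sup>2 * indicator (many_jumps h) \<omega> \<partial>M)"
    unfolding E1[symmetric]
    by (subst Bochner_Integration.integral_add, intro Bochner_Integration.integrable_add integrable_mult_right
        I1 Y,
        intro integrable_mult_right Wi, subst Bochner_Integration.integral_add, intro I1, intro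
            integrable_mult_right Y, simp only: Bochner_Integration.integral_mult_right_zero)
  also have "\<dots> \<le> rate\<^sup>2 * h\<^sup>2 + 2 * (levy_const * 1 * (rate\<^sup>2 * h\<^sup>2)) + 2 * (jump_bound * (2 * (rate * h)\<^sup>2))"
  proof (intro add_mono mult_left_mono W p)
    have "levy_const * h * prob (many_jumps h) \<le> levy_const * 1 * (rate\<^sup>2 * h\<^sup>2)"
      using p h levy_const_nonneg by (intro mult_mono) auto
    with Y(2) show "(\<integral>\<omega>. (levy_part h \<omega>)\<^sup>2 * indicator (many_jumps h) \<omega> \<partial>M) \<le> levy_const * 1 * (rate\<^sup>2 * h\<^sup>2)"
        by linarith
  qed auto
  also have "\<dots> = many_const * h\<^sup>2" by (simp add: many_const_def power_mult_distrib algebra_simps)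
  finally show ?thesis .
qed

lemma possible_jump_integral:
  assumes A: "A \<in> sets chain_sigma" and p: "p = 1 \<or> p = 2"
  shows "integrable M (\<lambda>\<omega>. (possible_jump \<omega> i j 1) ^ p)"
    "(\<integral>\<omega>. (possible_jump \<omega> i j 1) ^ p * indicator A \<omega> \<partial>M) = prob A * (\<integral>\<omega>. (possible_jump \<omega> i j 1) ^ p \<partial>M)"
proof -
  have "integrable M (\<lambda>\<omega>. (possible_jump \<omega> i j 1) ^ p) \<and>
    (\<integral>\<omega>. (possible_jump \<omega> i j 1) ^ p * indicator A \<omega> \<partial>M) = prob A * (\<integral>\<omega>. (possible_jump \<omega> i j 1) ^ p \<partial>M)"
  proof (cases "i \<noteq> j \<and> Q $ i $ j \<noteq> 0")
    case True
    then have ij: "i \<noteq> j" "Q $ i $ j \<noteq> 0" by auto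
    have eq: "possible_jump \<omega> i j 1 = Z i j 1 \<omega>" for \<omega> using ij by (simp add: possible_jump_def)
    have "integrable M (Z i j 1)"
      by (rule integrable_of_square[OF Z_measurable[OF ij(1) order_refl] Z_square[OF ij]])
    then have int: "integrable M (\<lambda>\<omega>. (Z i j 1 \<omega>) ^ p)" using p Z_square[OF ij] by auto
    have "(\<integral>\<omega>. (Z i j 1 \<omega>) ^ p * indicator A \<omega> \<partial>M) = prob A * (\<integral>\<omega>. (Z i j 1 \<omega>) ^ p \<partial>M)"
      by (rule indep_integral[where H="vimage_algebra (space M) (Z i j 1) borel", OF chain_sigma_events[OF A] _
            Z_vimage_events[OF ij(1) order_refl] chain_jump_indep[OF A _ ij(1) order_refl] _ int])
         (auto intro!: borel_measurable_power measurable_vimage_algebra1)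
    with int show ?thesis unfolding eq by simp
  next
    case False
    then have "possible_jump \<omega> i j 1 = 0" for \<omega> by (auto simp: possible_jump_def)
    then show ?thesis using p by auto
  qed
  then show "integrable M (\<lambda>\<omega>. (possible_jump \<omega> i j 1) ^ p)"
    "(\<integral>\<omega>. (possible_jump \<omega> i j 1) ^ p * indicator A \<omega> \<partial>M) = prob A * (\<integral>\<omega>. (possible_jump \<omega> i j 1) ^ p \<partial>M)"
        by auto
qed

context
  fixes l k :: 's
begin

text \<open>The events of starting in \<open>l\<close> and being in \<open>k\<close> at time \<open>h\<close>, without restriction and with no jump, one jump or
  more jumps in between.\<close>

definition B :: "real \<Rightarrow> 'w set" where "B h = state_at 0 l \<inter> state_at h k"
definition B0 :: "real \<Rightarrow> 'w set" where "B0 h = B h \<inter> {\<omega>\<in>space M. jump_count h \<omega> = 0}"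
definition B1 :: "real \<Rightarrow> 'w set" where "B1 h = B h \<inter> {\<omega>\<in>space M. jump_count h \<omega> = 1}"
definition B2 :: "real \<Rightarrow> 'w set" where "B2 h = B h \<inter> many_jumps h"

lemma B_chain: "0 < h \<Longrightarrow> B h \<in> sets chain_sigma" "0 < h \<Longrightarrow> B0 h \<in> sets chain_sigma"
  "0 < h \<Longrightarrow> B1 h \<in> sets chain_sigma" "0 < h \<Longrightarrow> B2 h \<in> sets chain_sigma"
  unfolding B_def B0_def B1_def B2_def by (intro sets.Int state_at_chain jump_count_chain; simp)+

lemma B_events: "0 < h \<Longrightarrow> B h \<in> events" "0 < h \<Longrightarrow> B0 h \<in> events"
  "0 < h \<Longrightarrow> B1 h \<in> events" "0 < h \<Longrightarrow> B2 h \<in> events"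
  using B_chain chain_sigma_events by blast+

lemma prob_B: "0 < h \<Longrightarrow> prob (B h) = prob (state_at 0 l) * P h l k"
  using chain_step[of 0 h "space M" l k] sets.top[of "F 0"]
  by (simp add: B_def Int_absorb1 subset_eq)

lemma prob_B_split: "0 < h \<Longrightarrow> prob (B h) = prob (B0 h) + prob (B1 h) + prob (B2 h)"
proof -
  assume h: "0 < h"
  have "B h = (B0 h \<union> B1 h) \<union> B2 h"
    using jump_count_cases[OF h] by (auto simp: B0_def B1_def B2_def B_def)
  then have "prob (B h) = prob ((B0 h \<union> B1 h) \<union> B2 h)" by simp
  also have "\<dots> = prob (B0 h \<union> B1 h) + prob (B2 h)"
    using B_events[OF h] by (intro finite_measure_Union) (auto simp: B0_def B1_def B2_def)
  also have "prob (B0 h \<union> B1 h) = prob (B0 h) + prob (B1 h)"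
    using B_events[OF h] by (intro finite_measure_Union) (auto simp: B0_def B1_def)
  finally show ?thesis .
qed

lemma B0_empty: "0 < h \<Longrightarrow> k \<noteq> l \<Longrightarrow> B0 h = {}"
  unfolding B0_def B_def using no_jump_state[of h] by auto

lemma B1_empty: "0 < h \<Longrightarrow> k = l \<Longrightarrow> B1 h = {}"
  unfolding B1_def B_def using one_jump_part(2)[of h] by auto

lemma prob_B2: "0 < h \<Longrightarrow> prob (B2 h) \<le> rate\<^sup>2 * h\<^sup>2"
proof -
  assume h: "0 < h"
  have "prob (B2 h) \<le> prob (many_jumps h)"
    using chain_sigma_events[OF jump_count_chain[OF h, of "\<lambda>x. 2 \<le> x"]]
    by (intro finite_measure_mono) (auto simp: B2_def)
  then show ?thesis using jump_count_prob(2)[OF h] by (simp add: power_mult_distrib)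
qed

lemma prob_B1: "0 < h \<Longrightarrow> prob (B1 h) \<le> rate * h"
proof -
  assume h: "0 < h"
  have "prob (B1 h) \<le> prob {\<omega>\<in>space M. jump_count h \<omega> \<noteq> 0}"
    using chain_sigma_events[OF jump_count_chain[OF h, of "\<lambda>x. x \<noteq> 0"]]
    by (intro finite_measure_mono) (auto simp: B1_def)
  then show ?thesis using jump_count_prob(1)[OF h] by simp
qed

lemma prob_B2_rate: "((\<lambda>h. prob (B2 h) / h) \<longlongrightarrow> 0) (at_right 0)"
proof (rule Lim_null_comparison)
  show "\<forall>\<^sub>F h in at_right 0. norm (prob (B2 h) / h) \<le> rate\<^sup>2 * h"
    unfolding eventually_at_right_field
  proof (intro exI[of _ 1] conjI allI impI)
    fix h :: real assume h: "0 < h"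
    then show "norm (prob (B2 h) / h) \<le> rate\<^sup>2 * h"
      using prob_B2[OF h] by (simp add: divide_le_eq power2_eq_square mult.assoc)
  qed simp
  have "((\<lambda>h. rate\<^sup>2 * h) \<longlongrightarrow> rate\<^sup>2 * 0) (at_right 0)" by (intro tendsto_intros)
  then show "((\<lambda>h. rate\<^sup>2 * h) \<longlongrightarrow> 0) (at_right 0)" by simp
qed

lemma eventually_at_right_0I: "(\<And>h. 0 < h \<Longrightarrow> R h) \<Longrightarrow> \<forall>\<^sub>F h in at_right (0::real). R h"
  unfolding eventually_at_right_field by (intro exI[of _ 1]) auto

lemma prob_B1_rate:
  assumes kl: "k \<noteq> l"
  shows "((\<lambda>h. prob (B1 h) / h) \<longlongrightarrow> prob (state_at 0 l) * Q $ l $ k) (at_right 0)"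
proof -
  have "((\<lambda>h. prob (state_at 0 l) * ((P h l k - P 0 l k) / h) - prob (B2 h) / h) \<longlongrightarrow> prob (state_at 0 l)
      * Q $ l $ k - 0) (at_right 0)"
    by (intro tendsto_intros P_derivative prob_B2_rate)
  then have "((\<lambda>h. prob (state_at 0 l) * ((P h l k - P 0 l k) / h) - prob (B2 h) / h) \<longlongrightarrow> prob (state_at 0 l)
      * Q $ l $ k) (at_right 0)"
    by simp
  then show ?thesis
  proof (rule Lim_transform_eventually, intro eventually_at_right_0I)
    fix h :: real assume h: "0 < h"
    have "prob (B1 h) = prob (state_at 0 l) * P h l k - prob (B2 h)"
      using prob_B[OF h] prob_B_split[OF h] B0_empty[OF h kl] by simp
    then show "prob (state_at 0 l) * ((P h l k - P 0 l k) / h) - prob (B2 h) / h = prob (B1 h) / h"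
      using kl by (simp add: P_0 diff_divide_distrib)
  qed
qed

lemma prob_B0_limit:
  assumes kl: "k = l"
  shows "((\<lambda>h. prob (B0 h)) \<longlongrightarrow> prob (state_at 0 l)) (at_right 0)"
proof -
  have id0: "((\<lambda>h. h) \<longlongrightarrow> 0) (at_right (0::real))" by (rule tendsto_ident_at)
  have "((\<lambda>h. prob (state_at 0 l) * (P 0 l k + h * ((P h l k - P 0 l k) / h)) - h * (prob (B2 h) / h)) \<longlongrightarrow>
     prob (state_at 0 l) * (P 0 l k + 0 * Q $ l $ k) - 0 * 0) (at_right 0)"
    by (intro tendsto_intros P_derivative prob_B2_rate id0)
  then have "((\<lambda>h. prob (state_at 0 l) * (P 0 l k + h * ((P h l k - P 0 l k) / h)) - h * (prob (B2 h) / h))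
      \<longlongrightarrow> prob (state_at 0 l)) (at_right 0)"
    using kl by (simp add: P_0)
  then show ?thesis
  proof (rule Lim_transform_eventually, intro eventually_at_right_0I)
    fix h :: real assume h: "0 < h"
    show "prob (state_at 0 l) * (P 0 l k + h * ((P h l k - P 0 l k) / h)) - h * (prob (B2 h) / h) = prob (B0 h)"
      using prob_B[OF h] prob_B_split[OF h] B1_empty[OF h kl] h by simp
  qed
qed

lemma many_jumps_remainder:
  assumes h: "0 < h" "h \<le> 1" and p: "p = 1 \<or> p = 2"
  shows "integrable M (\<lambda>\<omega>. (X h \<omega>) ^ p * indicator (B2 h) \<omega>)"
    "\<bar>\<integral>\<omega>. (X h \<omega>) ^ p * indicator (B2 h) \<omega> \<partial>M\<bar> \<le> many_const * (h * sqrt h)"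
proof -
  note [measurable] = B_events(4)[OF h(1)] X_measurable[OF less_imp_le[OF h(1)]] jump_count_measurable[OF h(1)]
  have pb: "\<bar>x ^ p\<bar> \<le> 1 + x\<^sup>2" for x :: real
    using p sum_squares_bound[of "\<bar>x\<bar>" 1] by auto
  have bound: "\<bar>(X h \<omega>) ^ p * indicator (B2 h) \<omega>\<bar> \<le> (1 + (X h \<omega>)\<^sup>2) * indicator (many_jumps h) \<omega>" for \<omega>
    using pb[of "X h \<omega>"] by (auto simp: indicator_def B2_def B_def)
  have AM: "many_jumps h \<in> events" by measurable
  have IX: "integrable M (\<lambda>\<omega>. (1 + (X h \<omega>)\<^sup>2) * indicator (many_jumps h) \<omega>)"
    using integrable_mult_indicator[OF AM, of "\<lambda>\<omega>. 1 + (X h \<omega>)\<^sup>2"] X_square_integrable[of h] h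
        by (simp add: mult.commute)
  show I: "integrable M (\<lambda>\<omega>. (X h \<omega>) ^ p * indicator (B2 h) \<omega>)"
    using bound by (intro Bochner_Integration.integrable_bound[OF IX])
        (auto intro!: AE_I2 order_trans[OF _ abs_ge_self])
  have "\<bar>\<integral>\<omega>. (X h \<omega>) ^ p * indicator (B2 h) \<omega> \<partial>M\<bar> \<le> (\<integral>\<omega>. \<bar>(X h \<omega>) ^ p * indicator (B2 h) \<omega>\<bar> \<partial>M)"
    by (rule integral_abs_bound)
  also have "\<dots> \<le> (\<integral>\<omega>. (1 + (X h \<omega>)\<^sup>2) * indicator (many_jumps h) \<omega> \<partial>M)"
    using bound I IX by (intro integral_mono) auto
  also have "\<dots> \<le> many_const * h\<^sup>2" by (rule many_jumps_small[OF h])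
  also have "\<dots> \<le> many_const * (h * sqrt h)"
  proof (rule mult_left_mono[OF _ many_const_nonneg])
    have "h \<le> sqrt h" using h by (intro real_le_rsqrt) (simp add: power2_eq_square mult_left_le)
    then show "h\<^sup>2 \<le> h * sqrt h" using h by (simp add: power2_eq_square mult_left_mono)
  qed
  finally show "\<bar>\<integral>\<omega>. (X h \<omega>) ^ p * indicator (B2 h) \<omega> \<partial>M\<bar> \<le> many_const * (h * sqrt h)" .
qed

text \<open>One jump cannot lead back to the initial state. So up to the event of two or more jumps, which is
  negligible, \<open>X h\<close> is \<open>XL l h\<close> on the event of no jump, and that event is independent of \<open>XL l\<close>.\<close>

lemma diagonal_rate:
  assumes kl: "k = l" and p: "p = 1 \<or> p = 2"
  shows "((\<lambda>h. (\<integral>\<omega>. (X h \<omega>) ^ p * indicator (B h) \<omega> \<partial>M) / h) \<longlongrightarrow>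
     prob (state_at 0 l) * (if p = 1 then expectation (XL l 1) else variance (XL l 1))) (at_right 0)"
proof (rule rate_limit_of_bound)
  define e where "e h = (\<integral>\<omega>. (XL l h \<omega>) ^ p \<partial>M)" for h
  have e: "((\<lambda>h. e h / h) \<longlongrightarrow> (if p = 1 then expectation (XL l 1) else variance (XL l 1))) (at_right 0)"
  proof (cases "p = 1")
    case True
    have "\<forall>\<^sub>F h in at_right 0. expectation (XL l 1) = e h / h"
    proof (rule eventually_at_right_0I)
      fix h :: real assume h: "0 < h"
      show "expectation (XL l 1) = e h / h"
        using h True levy_mean[OF levy XL_square, of h l] by (simp add: e_def)
    qed
    then show ?thesis using True Lim_transform_eventually[OF tendsto_const] by auto
  next
    case False
    then have p2: "p = 2" using p by simp
    have id0: "((\<lambda>h. h) \<longlongrightarrow> 0) (at_right (0::real))" by (rule tendsto_ident_at)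
    have "((\<lambda>h. variance (XL l 1) + h * (expectation (XL l 1))\<^sup>2) \<longlongrightarrow> variance (XL l 1) + 0
        * (expectation (XL l 1))\<^sup>2) (at_right 0)"
      by (intro tendsto_intros id0)
    then have "((\<lambda>h. variance (XL l 1) + h * (expectation (XL l 1))\<^sup>2) \<longlongrightarrow> variance (XL l 1)) (at_right 0)"
        by simp
    then have "((\<lambda>h. e h / h) \<longlongrightarrow> variance (XL l 1)) (at_right 0)"
    proof (rule Lim_transform_eventually, intro eventually_at_right_0I)
      fix h :: real assume h: "0 < h"
      have "e h = h * variance (XL l 1) + h\<^sup>2 * (expectation (XL l 1))\<^sup>2"
        unfolding e_def p2 using h by (intro XL_second_moment) simp
      then show "variance (XL l 1) + h * (expectation (XL l 1))\<^sup>2 = e h / h"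
        using h by (simp add: add_divide_distrib power2_eq_square)
    qed
    then show ?thesis using p2 by simp
  qed
  have "((\<lambda>h. prob (B0 h) * (e h / h)) \<longlongrightarrow> prob (state_at 0 l)
      * (if p = 1 then expectation (XL l 1) else variance (XL l 1))) (at_right 0)"
    by (intro tendsto_mult prob_B0_limit kl e)
  then show "((\<lambda>h. prob (B0 h) * e h / h) \<longlongrightarrow> prob (state_at 0 l)
      * (if p = 1 then expectation (XL l 1) else variance (XL l 1))) (at_right 0)"
    by simp
  fix h :: real assume h: "0 < h" "h \<le> 1"
  have h0: "0 \<le> h" using h by simp
  note [measurable] = B_events[OF h(1)] X_measurable[OF h0] XL_measurable[OF h0]
  have int: "integrable M (\<lambda>\<omega>. (XL l h \<omega>) ^ p)"
    using p levy_integrable[OF levy XL_square h0, of l] levy_square_integrable[OF levy XL_square h0, of l]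
        by auto
  have I0: "integrable M (\<lambda>\<omega>. (XL l h \<omega>) ^ p * indicator (B0 h) \<omega>)"
    using integrable_mult_indicator[OF B_events(2)[OF h(1)] int] by (simp add: mult.commute)
  have V0: "(\<integral>\<omega>. (XL l h \<omega>) ^ p * indicator (B0 h) \<omega> \<partial>M) = prob (B0 h) * e h"
    unfolding e_def
    by (rule chain_levy_integral[where i=l, OF B_chain(2)[OF h(1)] _ int])
        (intro borel_measurable_power XL_measurable_levy_sigma h0)
  have "(\<integral>\<omega>. (X h \<omega>) ^ p * indicator (B h) \<omega> \<partial>M) =
     (\<integral>\<omega>. (XL l h \<omega>) ^ p * indicator (B0 h) \<omega> + (X h \<omega>) ^ p * indicator (B2 h) \<omega> \<partial>M)"
  proof (rule integral_cong_AE)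
    show "AE \<omega> in M. (X h \<omega>) ^ p * indicator (B h) \<omega> = (XL l h \<omega>) ^ p * indicator (B0 h) \<omega> + (X h \<omega>) ^ p
        * indicator (B2 h) \<omega>"
      using X_no_jump[OF h(1)] AE_space
    proof eventually_elim
      case (elim \<omega>)
      show ?case
      proof (cases "\<omega> \<in> B h")
        case True
        then have J: "J 0 \<omega> = l" by (simp add: B_def)
        consider "jump_count h \<omega> = 0" | "jump_count h \<omega> = 1" | "2 \<le> jump_count h \<omega>"
          using jump_count_cases[OF h(1) elim(2)] by auto
        then show ?thesis
        proof cases
          case 1 then show ?thesis using True elim J by (simp add: B0_def B2_def)
        next
          case 2 then have "\<omega> \<in> B1 h" using True elim(2) by (simp add: B1_def)
          then show ?thesis using B1_empty[OF h(1) kl] by simp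
        next
          case 3 then show ?thesis using True elim(2) by (simp add: B0_def B2_def)
        qed
      qed (simp add: B0_def B2_def)
    qed
  qed measurable
  also have "\<dots> = prob (B0 h) * e h + (\<integral>\<omega>. (X h \<omega>) ^ p * indicator (B2 h) \<omega> \<partial>M)"
    unfolding V0[symmetric] by (rule Bochner_Integration.integral_add[OF I0 many_jumps_remainder(1)[OF h p]])
  finally show "\<bar>(\<integral>\<omega>. (X h \<omega>) ^ p * indicator (B h) \<omega> \<partial>M) - prob (B0 h) * e h\<bar> \<le> many_const * (h * sqrt h)"
    using many_jumps_remainder(2)[OF h p] by simp
qed

text \<open>Reaching another state takes a jump. On the event of one jump \<open>X h\<close> is the sum of the Levy part and of the
  jump, and the terms that involve the Levy part are of the order of \<open>sqrt h\<close> times the probability of this event.\<close>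

lemma offdiagonal_rate:
  assumes kl: "k \<noteq> l" and p: "p = 1 \<or> p = 2"
  shows "((\<lambda>h. (\<integral>\<omega>. (X h \<omega>) ^ p * indicator (B h) \<omega> \<partial>M) / h) \<longlongrightarrow>
     prob (state_at 0 l) * (Q $ l $ k * (\<integral>\<omega>. (possible_jump \<omega> l k 1) ^ p \<partial>M))) (at_right 0)"
proof (rule rate_limit_of_bound)
  define z where "z = (\<integral>\<omega>. (possible_jump \<omega> l k 1) ^ p \<partial>M)"
  define z2 where "z2 = (\<integral>\<omega>. (possible_jump \<omega> l k 1)\<^sup>2 \<partial>M)"
  have z2: "0 \<le> z2" unfolding z2_def by simp
  have "((\<lambda>h. prob (B1 h) / h * z) \<longlongrightarrow> prob (state_at 0 l) * Q $ l $ k * z) (at_right 0)"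
    by (intro tendsto_intros prob_B1_rate kl)
  then show "((\<lambda>h. prob (B1 h) * z / h) \<longlongrightarrow> prob (state_at 0 l)
      * (Q $ l $ k * (\<integral>\<omega>. (possible_jump \<omega> l k 1) ^ p \<partial>M))) (at_right 0)"
    unfolding z_def by (simp add: mult.assoc)
  fix h :: real assume h: "0 < h" "h \<le> 1"
  have h0: "0 \<le> h" using h by simp
  have sh: "0 < sqrt h" "sqrt h * sqrt h = h" "h \<le> sqrt h"
    using h by (auto intro!: real_le_rsqrt simp: power2_eq_square mult_left_le)
  note [measurable] = B_events[OF h(1)] X_measurable[OF h0] levy_part_measurable[OF h(1)]
  have [measurable]: "(\<lambda>\<omega>. possible_jump \<omega> l k 1) \<in> borel_measurable M" by (rule possible_jump_measurable) simp
  define R where "R \<omega> = (X h \<omega>) ^ p * indicator (B1 h) \<omega> - (possible_jump \<omega> l k 1) ^ p * indicator (B1 h) \<omega>"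
      for \<omega>
  have on_B1: "AE \<omega> in M. \<omega> \<in> B1 h \<longrightarrow> X h \<omega> = levy_part h \<omega> + possible_jump \<omega> l k 1"
    using X_decomposition_possible_jumps[OF h(1)] AE_space
  proof eventually_elim
    case (elim \<omega>)
    then show ?case using one_jump_part(1)[OF h(1) elim(2)] by (auto simp: B1_def B_def)
  qed
  \<comment> \<open>The weights \<open>1 / sqrt h\<close> and \<open>sqrt h\<close> in the product bound balance the squared Levy part, of mean order \<open>h\<close>,
    against terms of order \<open>1\<close>.\<close>
  let ?Y = "\<lambda>\<omega>. (levy_part h \<omega>)\<^sup>2 * indicator (B1 h) \<omega>"
  let ?U = "\<lambda>\<omega>. (2 / sqrt h) * ?Y \<omega> + sqrt h * indicator (B1 h) \<omega> + sqrt h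
      * ((possible_jump \<omega> l k 1)\<^sup>2 * indicator (B1 h) \<omega>)"
  have Rb: "AE \<omega> in M. \<bar>R \<omega>\<bar> \<le> ?U \<omega>"
    using on_B1
  proof eventually_elim
    case (elim \<omega>)
    show ?case
    proof (cases "\<omega> \<in> B1 h")
      case True
      let ?y = "levy_part h \<omega>" and ?z = "possible_jump \<omega> l k 1"
      have X: "X h \<omega> = ?y + ?z" using elim True by simp
      have zz: "0 \<le> sqrt h * ?z\<^sup>2" "0 \<le> sqrt h" "0 \<le> ?y\<^sup>2 / sqrt h" using h0 by auto
      from p have "\<bar>R \<omega>\<bar> \<le> 2 * (?y\<^sup>2 / sqrt h) + sqrt h + sqrt h * ?z\<^sup>2"
      proof
        assume "p = 1"
        then have "\<bar>R \<omega>\<bar> = \<bar>?y * 1\<bar>" using True X by (simp add: R_def)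
        also have "\<dots> \<le> ?y\<^sup>2 / sqrt h + sqrt h"
          using weighted_product_bound[OF sh(1), of ?y 1] by simp
        finally show ?thesis using zz by linarith
      next
        assume "p = 2"
        then have "R \<omega> = ?y\<^sup>2 + 2 * (?y * ?z)" using True X by (simp add: R_def power2_sum)
        then have "\<bar>R \<omega>\<bar> \<le> ?y\<^sup>2 + 2 * \<bar>?y * ?z\<bar>"
          using abs_triangle_ineq[of "?y\<^sup>2" "2 * (?y * ?z)"] by (simp add: abs_mult)
        also have "\<dots> \<le> ?y\<^sup>2 + (?y\<^sup>2 / sqrt h + sqrt h * ?z\<^sup>2)"
          using weighted_product_bound[OF sh(1), of ?y ?z] by simp
        finally have "\<bar>R \<omega>\<bar> \<le> ?y\<^sup>2 + (?y\<^sup>2 / sqrt h + sqrt h * ?z\<^sup>2)" .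
        moreover have "?y\<^sup>2 \<le> ?y\<^sup>2 / sqrt h"
          using h sh(1) by (simp add: le_divide_eq mult_left_le)
        ultimately show ?thesis using zz by linarith
      qed
      then show ?thesis using True by simp
    qed (simp add: R_def)
  qed
  note Yi = levy_part_small[OF h B_chain(3)[OF h(1)]]
  have I1: "integrable M (\<lambda>\<omega>. indicator (B1 h) \<omega> :: real)" using B_events(3)[OF h(1)]
      by (simp add: emeasure_eq_measure)
  have E1: "(\<integral>\<omega>. indicator (B1 h) \<omega> \<partial>M) = prob (B1 h)"
    using sets.sets_into_space[OF B_events(3)[OF h(1)]] by (simp add: Int_absorb2)
  have Iz2: "integrable M (\<lambda>\<omega>. (possible_jump \<omega> l k 1)\<^sup>2 * indicator (B1 h) \<omega>)"
    using integrable_mult_indicator[OF B_events(3)[OF h(1)] possible_jump_integral(1)[OF B_chain(3)[OF h(1)],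
        of 2 l k]]
    by (simp add: mult.commute)
  have Ez2: "(\<integral>\<omega>. (possible_jump \<omega> l k 1)\<^sup>2 * indicator (B1 h) \<omega> \<partial>M) = prob (B1 h) * z2"
    unfolding z2_def by (rule possible_jump_integral(2)[OF B_chain(3)[OF h(1)]]) simp
  have Iz: "integrable M (\<lambda>\<omega>. (possible_jump \<omega> l k 1) ^ p * indicator (B1 h) \<omega>)"
    using integrable_mult_indicator[OF B_events(3)[OF h(1)] possible_jump_integral(1)[OF B_chain(3)[OF h(1)]
        p, of l k]]
    by (simp add: mult.commute)
  have Ez: "(\<integral>\<omega>. (possible_jump \<omega> l k 1) ^ p * indicator (B1 h) \<omega> \<partial>M) = prob (B1 h) * z"
    unfolding z_def by (rule possible_jump_integral(2)[OF B_chain(3)[OF h(1)] p])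
  have IU: "integrable M ?U"
    by (intro Bochner_Integration.integrable_add integrable_mult_right Yi I1 Iz2)
  have Rm: "R \<in> borel_measurable M" unfolding R_def[abs_def] by measurable
  have IR: "integrable M R"
    using Rb by (intro Bochner_Integration.integrable_bound[OF IU Rm]) (auto elim!: eventually_mono intro:
        order_trans[OF _ abs_ge_self])
  have "\<bar>\<integral>\<omega>. R \<omega> \<partial>M\<bar> \<le> (\<integral>\<omega>. \<bar>R \<omega>\<bar> \<partial>M)" by (rule integral_abs_bound)
  also have "\<dots> \<le> (\<integral>\<omega>. ?U \<omega> \<partial>M)" using IR IU Rb by (intro integral_mono_AE) auto
  also have "\<dots> = (2 / sqrt h) * (\<integral>\<omega>. ?Y \<omega> \<partial>M) + sqrt h * prob (B1 h) + sqrt h * (prob (B1 h) * z2)"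
    unfolding Ez2[symmetric]
    unfolding E1[symmetric]
    by (subst Bochner_Integration.integral_add, intro Bochner_Integration.integrable_add integrable_mult_right
        I1 Yi,
        intro integrable_mult_right Iz2, subst Bochner_Integration.integral_add, intro integrable_mult_right
            Yi, intro integrable_mult_right I1,
        simp only: Bochner_Integration.integral_mult_right_zero)
  also have "\<dots> \<le> (2 / sqrt h) * (levy_const * h * prob (B1 h)) + sqrt h * prob (B1 h) + sqrt h
      * (prob (B1 h) * z2)"
    using Yi(2) sh(1) by (intro add_right_mono mult_left_mono) auto
  also have "\<dots> = (2 * levy_const + 1 + z2) * sqrt h * prob (B1 h)"
  proof -
    have "2 / sqrt h * (levy_const * h * prob (B1 h)) = 2 * levy_const * (h / sqrt h) * prob (B1 h)" by simp
    also have "h / sqrt h = sqrt h" by (rule real_div_sqrt[OF h0])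
    finally show ?thesis by (simp add: algebra_simps)
  qed
  also have "\<dots> \<le> (2 * levy_const + 1 + z2) * sqrt h * (rate * h)"
    using prob_B1[OF h(1)] levy_const_nonneg z2 h0 by (intro mult_left_mono) auto
  finally have Rint: "\<bar>\<integral>\<omega>. R \<omega> \<partial>M\<bar> \<le> (2 * levy_const + 1 + z2) * rate * (h * sqrt h)" by (simp add: mult_ac)
  have "(\<integral>\<omega>. (X h \<omega>) ^ p * indicator (B h) \<omega> \<partial>M) =
     (\<integral>\<omega>. (R \<omega> + (possible_jump \<omega> l k 1) ^ p * indicator (B1 h) \<omega>) + (X h \<omega>) ^ p * indicator (B2 h) \<omega> \<partial>M)"
  proof (rule Bochner_Integration.integral_cong[OF refl])
    fix \<omega> assume \<omega>: "\<omega> \<in> space M"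
    have "\<omega> \<in> B h \<Longrightarrow> jump_count h \<omega> \<noteq> 0" using B0_empty[OF h(1) kl] \<omega> by (auto simp: B0_def)
    then show "(X h \<omega>) ^ p * indicator (B h) \<omega> = (R \<omega> + (possible_jump \<omega> l k 1) ^ p * indicator (B1 h) \<omega>)
        + (X h \<omega>) ^ p * indicator (B2 h) \<omega>"
      using jump_count_cases[OF h(1) \<omega>] \<omega> by (auto simp: R_def B1_def B2_def indicator_def)
  qed
  also have "\<dots> = ((\<integral>\<omega>. R \<omega> \<partial>M) + prob (B1 h) * z) + (\<integral>\<omega>. (X h \<omega>) ^ p * indicator (B2 h) \<omega> \<partial>M)"
    unfolding Ez[symmetric]
    by (subst Bochner_Integration.integral_add, intro Bochner_Integration.integrable_add IR Iz, rule
        many_jumps_remainder(1)[OF h p],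
        subst Bochner_Integration.integral_add, rule IR, rule Iz, rule refl)
  finally have "\<bar>(\<integral>\<omega>. (X h \<omega>) ^ p * indicator (B h) \<omega> \<partial>M) - prob (B1 h) * z\<bar> \<le>
      \<bar>\<integral>\<omega>. R \<omega> \<partial>M\<bar> + \<bar>\<integral>\<omega>. (X h \<omega>) ^ p * indicator (B2 h) \<omega> \<partial>M\<bar>" by simp
  also have "\<dots> \<le> (2 * levy_const + 1 + z2) * rate * (h * sqrt h) + many_const * (h * sqrt h)"
    by (intro add_mono Rint many_jumps_remainder(2)[OF h p])
  finally show "\<bar>(\<integral>\<omega>. (X h \<omega>) ^ p * indicator (B h) \<omega> \<partial>M) - prob (B1 h) * z\<bar> \<le>
     ((2 * levy_const + 1 + z2) * rate + many_const) * (h * sqrt h)" by (simp add: distrib_right)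
qed

end

end

section \<open>The semigroup of moments\<close>

lemma clip_tendsto: "(\<lambda>n. max (- real n) (min (real n) x)) \<longlonglongrightarrow> x"
proof (rule tendsto_eventually)
  obtain N :: nat where N: "\<bar>x\<bar> \<le> real N" using real_arch_simple by blast
  show "\<forall>\<^sub>F n in sequentially. max (- real n) (min (real n) x) = x"
    unfolding eventually_sequentially
  proof (intro exI[of _ N] allI impI)
    fix n assume "N \<le> n"
    then have "\<bar>x\<bar> \<le> real n" using N by simp
    then show "max (- real n) (min (real n) x) = x" by (simp add: max_def min_def) linarith
  qed
qed

lemma clip_bounds: "\<bar>max (- real n) (min (real n) x)\<bar> \<le> real n" "\<bar>max (- real n) (min (real n) x)\<bar> \<le> \<bar>x\<bar>"
  by (auto simp: max_def min_def)

context map_setting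
begin

text \<open>The Markov additive property for unbounded \<open>V\<close> and \<open>f\<close>, by truncation and dominated convergence.\<close>

lemma map_product:
  fixes V :: "'w \<Rightarrow> real" and f :: "real \<Rightarrow> real" and g :: "'s \<Rightarrow> real"
  assumes st: "0 \<le> s" "0 \<le> t" and V: "V \<in> borel_measurable (F s)" "integrable M V"
    and f: "f \<in> borel_measurable borel" "integrable M (\<lambda>\<omega>. f (X t \<omega>))"
    and Vf: "integrable M (\<lambda>\<omega>. V \<omega> * f (X (s + t) \<omega> - X s \<omega>))"
  shows "(\<integral>\<omega>. V \<omega> * (f (X (s + t) \<omega> - X s \<omega>) * g (J (s + t) \<omega>)) \<partial>M) =
     (\<Sum>l\<in>UNIV. (\<integral>\<omega>. V \<omega> * indicator (state_at s l) \<omega> \<partial>M) * (\<integral>\<omega>. f (X t \<omega>) * g (J t \<omega>) \<partial>given_start M J l))"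
proof -
  define c where "c n x = max (- real n) (min (real n) x)" for n and x :: real
  have cm [measurable]: "c n \<in> borel_measurable borel" for n unfolding c_def by measurable
  have clim: "(\<lambda>n. c n x) \<longlonglongrightarrow> x" for x unfolding c_def by (rule clip_tendsto)
  have cb: "\<bar>c n x\<bar> \<le> real n" "\<bar>c n x\<bar> \<le> \<bar>x\<bar>" for n x unfolding c_def by (rule clip_bounds)+
  have st': "0 \<le> s + t" using st by simp
  have VM [measurable]: "V \<in> borel_measurable M" using V(2) by simp
  note [measurable] = f(1)
  have Xm [measurable]: "X (s + t) \<in> borel_measurable M" "X s \<in> borel_measurable M" "X t \<in> borel_measurable M"
    using st st' by auto
  have Jm: "(\<lambda>\<omega>. g (J u \<omega>)) \<in> borel_measurable M" if "0 \<le> u" for u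
    by (rule measurable_compose[OF J_measurable[OF that]]) simp
  note [measurable] = Jm[OF st'] Jm[OF st(2)] state_at_events[OF st(1)]
  define G where "G = (\<Sum>i\<in>UNIV. \<bar>g i\<bar>)"
  have G: "\<bar>g i\<bar> \<le> G" for i unfolding G_def by (rule member_le_sum) auto
  have eq: "(\<integral>\<omega>. c n (V \<omega>) * (c n (f (X (s + t) \<omega> - X s \<omega>)) * g (J (s + t) \<omega>)) \<partial>M) =
     (\<Sum>l\<in>UNIV. (\<integral>\<omega>. c n (V \<omega>) * indicator (state_at s l) \<omega> \<partial>M)
         * (\<integral>\<omega>. c n (f (X t \<omega>)) * g (J t \<omega>) \<partial>given_start M J l))" for n
  proof (rule map_integral[OF st, where f="\<lambda>x. c n (f x)" and L="real n"])
    show "(\<lambda>\<omega>. c n (V \<omega>)) \<in> borel_measurable (F s)" using V(1) by measurable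
    show "\<bar>c n (V \<omega>)\<bar> \<le> real n" for \<omega> by (rule cb)
    show "bounded (range (\<lambda>x. c n (f x)))" using cb(1) by (auto simp: bounded_iff)
  qed measurable
  have left: "(\<lambda>n. \<integral>\<omega>. c n (V \<omega>) * (c n (f (X (s + t) \<omega> - X s \<omega>)) * g (J (s + t) \<omega>)) \<partial>M) \<longlonglongrightarrow>
     (\<integral>\<omega>. V \<omega> * (f (X (s + t) \<omega> - X s \<omega>) * g (J (s + t) \<omega>)) \<partial>M)"
  proof (rule integral_dominated_convergence[where w="\<lambda>\<omega>. \<bar>V \<omega> * f (X (s + t) \<omega> - X s \<omega>)\<bar> * G"])
    show "AE \<omega> in M. (\<lambda>n. c n (V \<omega>) * (c n (f (X (s + t) \<omega> - X s \<omega>)) * g (J (s + t) \<omega>))) \<longlonglongrightarrow>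
       V \<omega> * (f (X (s + t) \<omega> - X s \<omega>) * g (J (s + t) \<omega>))"
      by (intro AE_I2 tendsto_intros clim)
    show "AE \<omega> in M. norm (c n (V \<omega>) * (c n (f (X (s + t) \<omega> - X s \<omega>)) * g (J (s + t) \<omega>))) \<le> \<bar>V \<omega>
        * f (X (s + t) \<omega> - X s \<omega>)\<bar> * G" for n
    proof (intro AE_I2)
      fix \<omega>
      have "\<bar>c n (V \<omega>)\<bar> * (\<bar>c n (f (X (s + t) \<omega> - X s \<omega>))\<bar> * \<bar>g (J (s + t) \<omega>)\<bar>) \<le> \<bar>V \<omega>\<bar>
          * (\<bar>f (X (s + t) \<omega> - X s \<omega>)\<bar> * G)"
        using cb(2) G by (intro mult_mono) auto
      then show "norm (c n (V \<omega>) * (c n (f (X (s + t) \<omega> - X s \<omega>)) * g (J (s + t) \<omega>))) \<le> \<bar>V \<omega>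
          * f (X (s + t) \<omega> - X s \<omega>)\<bar> * G"
        by (simp add: abs_mult mult.assoc)
    qed
    show "integrable M (\<lambda>\<omega>. \<bar>V \<omega> * f (X (s + t) \<omega> - X s \<omega>)\<bar> * G)"
      using Vf by (intro integrable_mult_left integrable_abs)
  qed measurable
  have right1: "(\<lambda>n. \<integral>\<omega>. c n (V \<omega>) * indicator (state_at s l) \<omega> \<partial>M)
      \<longlonglongrightarrow> (\<integral>\<omega>. V \<omega> * indicator (state_at s l) \<omega> \<partial>M)" for l
  proof (rule integral_dominated_convergence[where w="\<lambda>\<omega>. \<bar>V \<omega>\<bar>"])
    show "AE \<omega> in M. norm (c n (V \<omega>) * indicator (state_at s l) \<omega>) \<le> \<bar>V \<omega>\<bar>" for n
      using cb(2) by (intro AE_I2) (simp add: indicator_def)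
  qed (use V(2) in \<open>auto intro!: AE_I2 tendsto_intros clim\<close>)
  have right2: "(\<lambda>n. \<integral>\<omega>. c n (f (X t \<omega>)) * g (J t \<omega>) \<partial>given_start M J l)
      \<longlonglongrightarrow> (\<integral>\<omega>. f (X t \<omega>) * g (J t \<omega>) \<partial>given_start M J l)" for l
  proof (rule integral_dominated_convergence[where w="\<lambda>\<omega>. \<bar>f (X t \<omega>)\<bar> * G"])
    have "integrable M (\<lambda>\<omega>. indicator (state_at 0 l) \<omega> * f (X t \<omega>))"
      using integrable_mult_indicator[OF state_at_events[OF order_refl] f(2)] by simp
    then have "integrable (given_start M J l) (\<lambda>\<omega>. f (X t \<omega>))"
      by (subst integrable_given_start) measurable
    then show "integrable (given_start M J l) (\<lambda>\<omega>. \<bar>f (X t \<omega>)\<bar> * G)" by simp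
    show "AE \<omega> in given_start M J l. norm (c n (f (X t \<omega>)) * g (J t \<omega>)) \<le> \<bar>f (X t \<omega>)\<bar> * G" for n
      using cb(2) G by (intro AE_I2) (simp add: abs_mult mult_mono)
  qed (auto intro!: AE_I2 tendsto_intros clim)
  have "(\<lambda>n. \<Sum>l\<in>UNIV. (\<integral>\<omega>. c n (V \<omega>) * indicator (state_at s l) \<omega> \<partial>M)
      * (\<integral>\<omega>. c n (f (X t \<omega>)) * g (J t \<omega>) \<partial>given_start M J l)) \<longlonglongrightarrow>
     (\<Sum>l\<in>UNIV. (\<integral>\<omega>. V \<omega> * indicator (state_at s l) \<omega> \<partial>M) * (\<integral>\<omega>. f (X t \<omega>) * g (J t \<omega>) \<partial>given_start M J l))"
    by (intro tendsto_intros right1 right2)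
  from LIMSEQ_unique[OF left this[folded eq]] show ?thesis .
qed

definition moment :: "nat \<Rightarrow> real \<Rightarrow> real^'s^'s" where
  "moment p t = (\<chi> k l. \<integral>\<omega>. (X t \<omega>) ^ p * of_bool (J t \<omega> = k) \<partial>given_start M J l)"

lemma X_power_integrable:
  assumes "0 \<le> t" "p \<le> 2" shows "integrable M (\<lambda>\<omega>. (X t \<omega>) ^ p)"
proof -
  have "integrable M (X t)"
      by (rule integrable_of_square[OF X_measurable[OF assms(1)] X_square_integrable[OF assms(1)]])
  moreover have "p = 0 \<or> p = 1 \<or> p = 2" using assms(2) by auto
  ultimately show ?thesis using X_square_integrable[OF assms(1)] by auto
qed

lemma moment_measurable: "0 \<le> t \<Longrightarrow> (\<lambda>\<omega>. (X t \<omega>) ^ p * of_bool (J t \<omega> = k)) \<in> borel_measurable M"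
  by (intro borel_measurable_times borel_measurable_power X_measurable measurable_compose[OF J_measurable])
      simp_all

lemma moment_nth:
  assumes t: "0 \<le> t"
  shows "moment p t $ k $ l = (\<integral>\<omega>. (X t \<omega>) ^ p * indicator (state_at 0 l \<inter> state_at t k) \<omega> \<partial>M) / prob
      (state_at 0 l)"
proof -
  have "moment p t $ k $ l = (\<integral>\<omega>. indicator (state_at 0 l) \<omega> * ((X t \<omega>) ^ p * of_bool (J t \<omega> = k)) \<partial>M) / prob
      (state_at 0 l)"
    unfolding moment_def using integral_given_start[OF moment_measurable[OF t]] by simp
  also have "(\<integral>\<omega>. indicator (state_at 0 l) \<omega> * ((X t \<omega>) ^ p * of_bool (J t \<omega> = k)) \<partial>M) =
     (\<integral>\<omega>. (X t \<omega>) ^ p * indicator (state_at 0 l \<inter> state_at t k) \<omega> \<partial>M)"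
    by (intro Bochner_Integration.integral_cong) (auto simp: indicator_def)
  finally show ?thesis .
qed

lemma moment_0_nth: "0 \<le> t \<Longrightarrow> moment 0 t $ k $ l = P t l k"
proof -
  assume t: "0 \<le> t"
  have "state_at 0 l \<inter> state_at t k \<inter> space M = state_at 0 l \<inter> state_at t k" by auto
  then show ?thesis
    using t by (simp add: moment_nth transition_prob_def measure_given_start)
qed

text \<open>The product of matrices is the sum over the state at time \<open>s\<close>.\<close>

lemma mixed_moment:
  assumes st: "0 \<le> s" "0 \<le> t" and ab: "a + b \<le> 2"
  shows "integrable M (\<lambda>\<omega>. (X s \<omega>) ^ a * (X (s + t) \<omega> - X s \<omega>) ^ b
      * indicator (state_at 0 i \<inter> state_at (s + t) k) \<omega>)"
    and "(\<integral>\<omega>. (X s \<omega>) ^ a * (X (s + t) \<omega> - X s \<omega>) ^ b * indicator (state_at 0 i \<inter> state_at (s + t) k) \<omega> \<partial>M) /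
        prob (state_at 0 i) =
      (moment b t ** moment a s) $ k $ i"
proof -
  have st': "0 \<le> s + t" using st by simp
  note [measurable] = X_measurable[OF st(1)] X_measurable[OF st']
  let ?D = "\<lambda>\<omega>. X (s + t) \<omega> - X s \<omega>"
  let ?V = "\<lambda>\<omega>. indicator (state_at 0 i) \<omega> * (X s \<omega>) ^ a"
  have D2: "integrable M (\<lambda>\<omega>. (?D \<omega>)\<^sup>2)"
  proof -
    have "integrable M (\<lambda>\<omega>. (X (s + t) \<omega> + (- X s \<omega>))\<^sup>2)"
      using X_square_integrable[OF st(1)] X_square_integrable[OF st'] by (intro integrable_square_add) auto
    then show ?thesis by simp
  qed
  have XD: "integrable M (\<lambda>\<omega>. (X s \<omega>) ^ a * (?D \<omega>) ^ b)"
  proof -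
    have D1: "integrable M ?D" by (rule integrable_of_square[OF _ D2]) measurable
    have XD1: "integrable M (\<lambda>\<omega>. X s \<omega> * ?D \<omega>)"
      by (rule integrable_mult_squares[OF _ _ X_square_integrable[OF st(1)] D2]) measurable
    have "a = 0 \<and> b = 0 \<or> a = 0 \<and> b = 1 \<or> a = 0 \<and> b = 2 \<or> a = 1 \<and> b = 0 \<or> a = 1 \<and> b = 1 \<or> a = 2 \<and> b = 0"
      using ab by auto
    then show ?thesis
      using D1 D2 XD1 X_power_integrable[OF st(1), of 1] X_square_integrable[OF st(1)]
      by (elim disjE conjE) simp_all
  qed
  have JJ: "state_at 0 i \<inter> state_at (s + t) k \<in> events" using st' by (intro sets.Int state_at_events) auto
  show "integrable M (\<lambda>\<omega>. (X s \<omega>) ^ a * (?D \<omega>) ^ b * indicator (state_at 0 i \<inter> state_at (s + t) k) \<omega>)"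
    using integrable_mult_indicator[OF JJ XD] by (simp add: mult.commute)
  have Vf: "integrable M (\<lambda>\<omega>. ?V \<omega> * (?D \<omega>) ^ b)"
    using integrable_mult_indicator[OF state_at_events[OF order_refl] XD, of i] by (simp add: mult.assoc)
  have Vi: "integrable M ?V"
    using integrable_mult_indicator[OF state_at_events[OF order_refl] X_power_integrable[OF st(1)], of a i] ab
        by simp
  have VF: "?V \<in> borel_measurable (F s)"
    by (intro borel_measurable_times borel_measurable_power borel_measurable_indicator state_at_F
        X_measurable_F order_refl st)
  have "(\<integral>\<omega>. (X s \<omega>) ^ a * (?D \<omega>) ^ b * indicator (state_at 0 i \<inter> state_at (s + t) k) \<omega> \<partial>M) =
     (\<integral>\<omega>. ?V \<omega> * ((?D \<omega>) ^ b * of_bool (J (s + t) \<omega> = k)) \<partial>M)"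
    by (intro Bochner_Integration.integral_cong) (auto simp: indicator_def)
  also have "\<dots> = (\<Sum>l\<in>UNIV. (\<integral>\<omega>. ?V \<omega> * indicator (state_at s l) \<omega> \<partial>M)
      * (\<integral>\<omega>. (X t \<omega>) ^ b * of_bool (J t \<omega> = k) \<partial>given_start M J l))"
    by (rule map_product[OF st VF Vi _ X_power_integrable[OF st(2)] Vf]) (use ab in auto)
  also have "\<dots> = (\<Sum>l\<in>UNIV. (moment a s $ l $ i * prob (state_at 0 i)) * moment b t $ k $ l)"
  proof (intro sum.cong refl arg_cong2[where f="(*)"])
    fix l
    have "(\<integral>\<omega>. ?V \<omega> * indicator (state_at s l) \<omega> \<partial>M)
        = (\<integral>\<omega>. (X s \<omega>) ^ a * indicator (state_at 0 i \<inter> state_at s l) \<omega> \<partial>M)"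
      by (intro Bochner_Integration.integral_cong) (auto simp: indicator_def)
    then show "(\<integral>\<omega>. ?V \<omega> * indicator (state_at s l) \<omega> \<partial>M) = moment a s $ l $ i * prob (state_at 0 i)"
      using start_pos[of i] by (simp add: moment_nth[OF st(1)])
  qed (simp add: moment_def)
  finally show "(\<integral>\<omega>. (X s \<omega>) ^ a * (?D \<omega>) ^ b * indicator (state_at 0 i \<inter> state_at (s + t) k) \<omega> \<partial>M) / prob
      (state_at 0 i) =
      (moment b t ** moment a s) $ k $ i"
    using start_pos[of i] by (simp add: matrix_matrix_mult_def sum_divide_distrib mult_ac)
qed

lemma moment_add:
  assumes st: "0 \<le> s" "0 \<le> t"
  shows "moment 0 (s + t) = moment 0 t ** moment 0 s"
    and "moment 1 (s + t) = moment 0 t ** moment 1 s + moment 1 t ** moment 0 s"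
    and "moment 2 (s + t) = moment 0 t ** moment 2 s + 2 *\<^sub>R (moment 1 t ** moment 1 s) + moment 2 t
        ** moment 0 s"
proof -
  have st': "0 \<le> s + t" using st by simp
  define I where "I a b i k \<omega> = (X s \<omega>) ^ a * (X (s + t) \<omega> - X s \<omega>) ^ b
      * indicator (state_at 0 i \<inter> state_at (s + t) k) \<omega>" for a b i k \<omega>
  have I: "integrable M (I a b i k)" "(\<integral>\<omega>. I a b i k \<omega> \<partial>M) / prob (state_at 0 i) = (moment b t ** moment a s)
      $ k $ i"
    if "a + b \<le> 2" for a b i k
    using mixed_moment[OF st that] unfolding I_def by auto
  have e0: "(X (s + t) \<omega>) ^ 0 * indicator (state_at 0 i \<inter> state_at (s + t) k) \<omega> = I 0 0 i k \<omega>" for \<omega> i k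
      by (simp add: I_def)
  have e1: "(X (s + t) \<omega>) ^ 1 * indicator (state_at 0 i \<inter> state_at (s + t) k) \<omega> = I 1 0 i k \<omega> + I 0 1 i k \<omega>"
      for \<omega> i k
    by (simp add: I_def distrib_right[symmetric])
  have e2: "(X (s + t) \<omega>) ^ 2 * indicator (state_at 0 i \<inter> state_at (s + t) k) \<omega> = I 2 0 i k \<omega> + 2
      * I 1 1 i k \<omega> + I 0 2 i k \<omega>" for \<omega> i k
    unfolding I_def by (simp add: power2_eq_square algebra_simps)
  show "moment 0 (s + t) = moment 0 t ** moment 0 s"
    unfolding vec_eq_iff using moment_nth[OF st', of 0] I(2)[of 0 0] by (simp only: e0) simp
  show "moment 1 (s + t) = moment 0 t ** moment 1 s + moment 1 t ** moment 0 s"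
    unfolding vec_eq_iff
  proof (intro allI)
    fix k i
    have "moment 1 (s + t) $ k $ i = (\<integral>\<omega>. I 1 0 i k \<omega> + I 0 1 i k \<omega> \<partial>M) / prob (state_at 0 i)"
      unfolding moment_nth[OF st'] e1 ..
    also have "\<dots> = (\<integral>\<omega>. I 1 0 i k \<omega> \<partial>M) / prob (state_at 0 i) + (\<integral>\<omega>. I 0 1 i k \<omega> \<partial>M) / prob (state_at 0 i)"
      using I(1)[of 1 0 i k] I(1)[of 0 1 i k] by (simp add: add_divide_distrib)
    also have "\<dots> = (moment 0 t ** moment 1 s + moment 1 t ** moment 0 s) $ k $ i"
      using I(2)[of 1 0 i k] I(2)[of 0 1 i k] by simp
    finally show "moment 1 (s + t) $ k $ i = (moment 0 t ** moment 1 s + moment 1 t ** moment 0 s) $ k $ i" .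
  qed
  show "moment 2 (s + t) = moment 0 t ** moment 2 s + 2 *\<^sub>R (moment 1 t ** moment 1 s) + moment 2 t
      ** moment 0 s"
    unfolding vec_eq_iff
  proof (intro allI)
    fix k i
    have "moment 2 (s + t) $ k $ i = (\<integral>\<omega>. I 2 0 i k \<omega> + 2 * I 1 1 i k \<omega> + I 0 2 i k \<omega> \<partial>M) / prob (state_at 0 i)"
      unfolding moment_nth[OF st'] e2 ..
    also have "\<dots> = (\<integral>\<omega>. I 2 0 i k \<omega> \<partial>M) / prob (state_at 0 i) + 2 * ((\<integral>\<omega>. I 1 1 i k \<omega> \<partial>M) / prob (state_at 0 i))
        + (\<integral>\<omega>. I 0 2 i k \<omega> \<partial>M) / prob (state_at 0 i)"
      using I(1)[of 2 0 i k] I(1)[of 1 1 i k] I(1)[of 0 2 i k] by (simp add: add_divide_distrib)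
    also have "\<dots> = (moment 0 t ** moment 2 s + 2 *\<^sub>R (moment 1 t ** moment 1 s) + moment 2 t ** moment 0 s) $
        k $ i"
      using I(2)[of 2 0 i k] I(2)[of 1 1 i k] I(2)[of 0 2 i k] by simp
    finally show "moment 2 (s + t) $ k $ i =
      (moment 0 t ** moment 2 s + 2 *\<^sub>R (moment 1 t ** moment 1 s) + moment 2 t ** moment 0 s) $ k $ i" .
  qed
qed

lemma moment_start: "moment 0 0 = mat 1" "moment 1 0 = 0" "moment 2 0 = 0"
proof -
  show "moment 0 0 = mat 1" by (auto simp: vec_eq_iff moment_0_nth P_0 mat_def)
  have "moment p 0 = 0" if "0 < p" for p
  proof -
    have "(\<integral>\<omega>. (X 0 \<omega>) ^ p * indicator (state_at 0 l \<inter> state_at 0 k) \<omega> \<partial>M) = (\<integral>\<omega>. 0 \<partial>M)" for l k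
      using that by (intro Bochner_Integration.integral_cong) (auto simp: X_0)
    then show ?thesis by (simp add: vec_eq_iff moment_nth)
  qed
  then show "moment 1 0 = 0" "moment 2 0 = 0" by simp_all
qed

lemma moment_rate:
  assumes p: "p = 1 \<or> p = 2"
  shows "((\<lambda>h. (1 / h) *\<^sub>R moment p h) \<longlongrightarrow> (if p = 1 then eps_X M Q XL Z else eps_XX M Q XL Z)) (at_right 0)"
proof (intro vec_tendstoI)
  fix k l
  define I where "I h = (\<integral>\<omega>. (X h \<omega>) ^ p * indicator (state_at 0 l \<inter> state_at h k) \<omega> \<partial>M)" for h
  let ?e = "if p = 1 then eps_X M Q XL Z else eps_XX M Q XL Z"
  have "((\<lambda>h. I h / h) \<longlongrightarrow> prob (state_at 0 l) * ?e $ k $ l) (at_right 0)"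
  proof (cases "k = l")
    case True
    have "?e $ k $ l = (if p = 1 then expectation (XL l 1) else variance (XL l 1))"
      using True p by (auto simp: eps_X_def eps_XX_def diag_matrix_def jump_moment_def transpose_def)
    then show ?thesis using diagonal_rate[OF True p] unfolding I_def B_def by simp
  next
    case False
    have "?e $ k $ l = Q $ l $ k * (\<integral>\<omega>. (possible_jump \<omega> l k 1) ^ p \<partial>M)"
    \<comment> \<open>If the rate vanishes, the expectation in \<open>jump_moment\<close> may be a default value, but it is multiplied by \<open>0\<close>.\<close>
    proof (cases "Q $ l $ k = 0")
      case True
      then show ?thesis using False by (auto simp: eps_X_def eps_XX_def diag_matrix_def transpose_def)
    next
      case q: False
      have "possible_jump \<omega> l k 1 = Z l k 1 \<omega>" for \<omega> using q False by (simp add: possible_jump_def)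
      then show ?thesis using False p
          by (auto simp: eps_X_def eps_XX_def diag_matrix_def jump_moment_def transpose_def)
    qed
    then show ?thesis using offdiagonal_rate[OF False p] unfolding I_def B_def by simp
  qed
  then have "((\<lambda>h. I h / h / prob (state_at 0 l)) \<longlongrightarrow> prob (state_at 0 l) * ?e $ k $ l / prob (state_at 0 l))
      (at_right 0)"
    using start_pos[of l] by (intro tendsto_intros) auto
  then have "((\<lambda>h. I h / h / prob (state_at 0 l)) \<longlongrightarrow> ?e $ k $ l) (at_right 0)" using start_pos[of l] by simp
  then show "((\<lambda>h. ((1 / h) *\<^sub>R moment p h) $ k $ l) \<longlongrightarrow> ?e $ k $ l) (at_right 0)"
    by (rule Lim_transform_eventually) (auto intro!: eventually_at_right_0I simp: moment_nth I_def)
qed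

lemma moment_0_rate: "((\<lambda>h. (1 / h) *\<^sub>R (moment 0 h - mat 1)) \<longlongrightarrow> transpose Q) (at_right 0)"
proof (intro vec_tendstoI)
  fix k l
  have "((\<lambda>h. (P h l k - P 0 l k) / h) \<longlongrightarrow> transpose Q $ k $ l) (at_right 0)"
    using P_derivative[of l k] by (simp add: transpose_def)
  then show "((\<lambda>h. ((1 / h) *\<^sub>R (moment 0 h - mat 1)) $ k $ l) \<longlongrightarrow> transpose Q $ k $ l) (at_right 0)"
    by (rule Lim_transform_eventually) (auto intro!: eventually_at_right_0I simp: moment_0_nth P_0 mat_def)
qed

text \<open>The triple of moment matrices is an orbit of the linear maps \<open>T h\<close>, and \<open>G\<close> collects their derivatives at
  \<open>0\<close>.\<close>

lemma moment_derivatives: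
  assumes s: "0 \<le> s"
  shows "(moment 0 has_vector_derivative (transpose Q ** moment 0 s)) (at s within {0..})"
    and "(moment 1 has_vector_derivative (transpose Q ** moment 1 s + eps_X M Q XL Z ** moment 0 s))
        (at s within {0..})"
    and "(moment 2 has_vector_derivative (transpose Q ** moment 2 s +
      (2 *\<^sub>R (eps_X M Q XL Z ** moment 1 s) + eps_XX M Q XL Z ** moment 0 s))) (at s within {0..})"
proof -
  let ?e1 = "eps_X M Q XL Z" and ?e2 = "eps_XX M Q XL Z"
  define T :: "real \<Rightarrow> (real^'s^'s) \<times> (real^'s^'s) \<times> (real^'s^'s) \<Rightarrow> (real^'s^'s) \<times> (real^'s^'s) \<times> (real^'s^'s)"
      where
    "T h = (\<lambda>x. (moment 0 h ** fst x, moment 0 h ** fst (snd x) + moment 1 h ** fst x,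
       moment 0 h ** snd (snd x) + 2 *\<^sub>R (moment 1 h ** fst (snd x)) + moment 2 h ** fst x))" for h
  define G :: "(real^'s^'s) \<times> (real^'s^'s) \<times> (real^'s^'s) \<Rightarrow> (real^'s^'s) \<times> (real^'s^'s) \<times> (real^'s^'s)" where
    "G = (\<lambda>x. (transpose Q ** fst x, transpose Q ** fst (snd x) + ?e1 ** fst x,
       transpose Q ** snd (snd x) + 2 *\<^sub>R (?e1 ** fst (snd x)) + ?e2 ** fst x))"
  note bb = bounded_bilinear_matrix_mult
  have m_add: "A ** (b + c) = A ** b + A ** c" for A b c :: "real^'s^'s" by (rule matrix_add_ldistrib)
  have m_sc: "A ** (r *\<^sub>R b) = r *\<^sub>R (A ** b)" for A b :: "real^'s^'s" and r
      by (rule bounded_bilinear.scaleR_right[OF bb])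
  have lin: "linear (T h)" for h
    unfolding T_def by (intro linearI) (auto simp: m_add m_sc scaleR_add_right)
  have linG: "linear G"
    unfolding G_def by (intro linearI) (auto simp: m_add m_sc scaleR_add_right)
  have gen: "((\<lambda>h. (1 / h) *\<^sub>R (T h x - x)) \<longlongrightarrow> G x) (at_right 0)" for x
  proof -
    obtain a b c where x: "x = (a, b, c)" by (cases x)
    let ?D = "\<lambda>h. (1 / h) *\<^sub>R (moment 0 h - mat 1)" and ?M = "\<lambda>p h. (1 / h) *\<^sub>R moment p h"
    have D: "((\<lambda>h. ?D h ** y) \<longlongrightarrow> transpose Q ** y) (at_right 0)" for y
      by (rule bounded_bilinear.tendsto[OF bb moment_0_rate tendsto_const])
    have M1: "((\<lambda>h. ?M 1 h ** y) \<longlongrightarrow> ?e1 ** y) (at_right 0)" for y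
      using bounded_bilinear.tendsto[OF bb moment_rate[of 1] tendsto_const, of y] by simp
    have M2: "((\<lambda>h. ?M 2 h ** y) \<longlongrightarrow> ?e2 ** y) (at_right 0)" for y
      using bounded_bilinear.tendsto[OF bb moment_rate[of 2] tendsto_const, of y] by simp
    have "((\<lambda>h. (?D h ** a, ?D h ** b + ?M 1 h ** a, ?D h ** c + 2 *\<^sub>R (?M 1 h ** b) + ?M 2 h ** a)) \<longlongrightarrow> G x)
        (at_right 0)"
      unfolding G_def x fst_conv snd_conv
          by (intro tendsto_Pair tendsto_add tendsto_scaleR tendsto_const D M1 M2)
    moreover have "(?D h ** a, ?D h ** b + ?M 1 h ** a, ?D h ** c + 2 *\<^sub>R (?M 1 h ** b) + ?M 2 h ** a)
        = (1 / h) *\<^sub>R (T h x - x)" for h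
      unfolding T_def x
      by (simp add: bounded_bilinear.scaleR_left[OF bb] bounded_bilinear.diff_left[OF bb] scaleR_add_right
          scaleR_diff_right)
    ultimately show ?thesis by simp
  qed
  define f where "f s = (moment 0 s, moment 1 s, moment 2 s)" for s
  have fadd: "f (s + h) = T h (f s)" if "0 \<le> s" "0 \<le> h" for s h
    unfolding f_def T_def by (simp only: moment_add[OF that] fst_conv snd_conv)
  have der: "(f has_vector_derivative G (f s)) (at s within {0..})"
    by (rule semigroup_has_vector_derivative[OF lin linG gen fadd s])
  have fst: "((\<lambda>s. fst (f s)) has_vector_derivative fst (G (f s))) (at s within {0..})"
    by (rule bounded_linear.has_vector_derivative[OF bounded_linear_fst der])
  have snd: "((\<lambda>s. snd (f s)) has_vector_derivative snd (G (f s))) (at s within {0..})"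
    by (rule bounded_linear.has_vector_derivative[OF bounded_linear_snd der])
  have snd1: "((\<lambda>s. fst (snd (f s))) has_vector_derivative fst (snd (G (f s)))) (at s within {0..})"
    by (rule bounded_linear.has_vector_derivative[OF bounded_linear_fst snd])
  have snd2: "((\<lambda>s. snd (snd (f s))) has_vector_derivative snd (snd (G (f s)))) (at s within {0..})"
    by (rule bounded_linear.has_vector_derivative[OF bounded_linear_snd snd])
  show "(moment 0 has_vector_derivative (transpose Q ** moment 0 s)) (at s within {0..})"
    using fst by (simp add: f_def G_def)
  show "(moment 1 has_vector_derivative (transpose Q ** moment 1 s + ?e1 ** moment 0 s)) (at s within {0..})"
    using snd1 by (simp add: f_def G_def)
  show "(moment 2 has_vector_derivative (transpose Q ** moment 2 s + (2 *\<^sub>R (?e1 ** moment 1 s) + ?e2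
      ** moment 0 s))) (at s within {0..})"
    using snd2 by (simp add: f_def G_def add.assoc)
qed

abbreviation E :: "real \<Rightarrow> real^'s^'s" where "E t \<equiv> matrix_exp (t *\<^sub>R transpose Q)"

lemma moment_0: "0 \<le> t \<Longrightarrow> moment 0 t = E t"
proof -
  assume t: "0 \<le> t"
  have "((\<lambda>s. E (t - s) ** 0) has_integral (moment 0 t - E t ** moment 0 0)) {0..t}"
    by (rule variation_of_constants[OF t]) (use moment_derivatives(1) in simp)
  moreover have "E (t - s) ** (0 :: real^'s^'s) = 0" for s
    by (rule bounded_bilinear.zero_right[OF bounded_bilinear_matrix_mult])
  ultimately have "((\<lambda>s. 0 :: real^'s^'s) has_integral (moment 0 t - E t)) {0..t}"
    by (simp add: moment_start)
  then show ?thesis using has_integral_unique[OF _ has_integral_0] by fastforce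
qed

lemma moment_continuous: "continuous_on {0..} (moment 1)"
  by (rule continuous_on_vector_derivative[OF moment_derivatives(2)]) simp

lemma moment_1:
  assumes t: "0 \<le> t"
  shows "moment 1 t = integral {0..t} (\<lambda>s. E (t - s) ** eps_X M Q XL Z ** E s)"
proof -
  have "((\<lambda>s. E (t - s) ** (eps_X M Q XL Z ** moment 0 s)) has_integral (moment 1 t - E t ** moment 1 0))
      {0..t}"
    by (rule variation_of_constants[OF t]) (rule moment_derivatives(2))
  then have "((\<lambda>s. E (t - s) ** (eps_X M Q XL Z ** moment 0 s)) has_integral moment 1 t) {0..t}"
    by (simp add: moment_start bounded_bilinear.zero_right[OF bounded_bilinear_matrix_mult] del: One_nat_def)
  then have "((\<lambda>s. E (t - s) ** eps_X M Q XL Z ** E s) has_integral moment 1 t) {0..t}"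
    by (rule has_integral_eq[rotated]) (simp add: moment_0 matrix_mul_assoc)
  then show ?thesis by (rule integral_unique[symmetric])
qed

lemma matrix_integrals:
  shows "(\<lambda>s. E (t - s) ** A ** moment 1 s) integrable_on {0..t}"
    and "(\<lambda>s. E (t - s) ** A ** E s) integrable_on {0..t}"
    and "E integrable_on {0..t}"
    and "moment 1 integrable_on {0..t}"
proof -
  have m: "continuous_on {0..t} (moment 1)"
    using moment_continuous by (rule continuous_on_subset) auto
  have E: "continuous_on {0..t} E" "continuous_on {0..t} (\<lambda>s. E (t - s))"
    by (intro continuous_on_matrix_exp continuous_intros)+
  note mult = bounded_bilinear.continuous_on[OF bounded_bilinear_matrix_mult]
  show "(\<lambda>s. E (t - s) ** A ** moment 1 s) integrable_on {0..t}"
    and "(\<lambda>s. E (t - s) ** A ** E s) integrable_on {0..t}"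
    and "E integrable_on {0..t}"
    and "moment 1 integrable_on {0..t}"
    by (intro integrable_continuous_real mult E m continuous_on_const)+
qed

lemma moment_2:
  assumes t: "0 \<le> t"
  shows "moment 2 t = 2 *\<^sub>R integral {0..t} (\<lambda>s. E (t - s) ** eps_X M Q XL Z ** moment 1 s) +
    integral {0..t} (\<lambda>s. E (t - s) ** eps_XX M Q XL Z ** E s)"
proof -
  let ?e1 = "eps_X M Q XL Z" and ?e2 = "eps_XX M Q XL Z"
  have "((\<lambda>s. E (t - s) ** (2 *\<^sub>R (?e1 ** moment 1 s) + ?e2 ** moment 0 s)) has_integral (moment 2 t - E t
      ** moment 2 0)) {0..t}"
    by (rule variation_of_constants[OF t]) (rule moment_derivatives(3))
  then have "((\<lambda>s. E (t - s) ** (2 *\<^sub>R (?e1 ** moment 1 s) + ?e2 ** moment 0 s)) has_integral moment 2 t)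
      {0..t}"
    by (simp add: moment_start bounded_bilinear.zero_right[OF bounded_bilinear_matrix_mult] del: One_nat_def)
  then have "((\<lambda>s. 2 *\<^sub>R (E (t - s) ** ?e1 ** moment 1 s) + E (t - s) ** ?e2 ** E s) has_integral moment 2 t)
      {0..t}"
    by (rule has_integral_eq[rotated])
       (simp add: moment_0 matrix_mul_assoc matrix_add_ldistrib
           bounded_bilinear.scaleR_right[OF bounded_bilinear_matrix_mult])
  moreover have "((\<lambda>s. 2 *\<^sub>R (E (t - s) ** ?e1 ** moment 1 s) + E (t - s) ** ?e2 ** E s) has_integral
      2 *\<^sub>R integral {0..t} (\<lambda>s. E (t - s) ** ?e1 ** moment 1 s) + integral {0..t} (\<lambda>s. E (t - s) ** ?e2
          ** E s)) {0..t}"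
    by (intro has_integral_add has_integral_cmul integrable_integral matrix_integrals)
  ultimately show ?thesis by (rule has_integral_unique)
qed

text \<open>The columns of \<open>E t\<close> are transition probabilities.\<close>

lemma column_sums_E: "0 \<le> t \<Longrightarrow> (1 :: real^'s) \<bullet> (E t *v y) = 1 \<bullet> y"
proof -
  assume t: "0 \<le> t"
  have "(\<Sum>k\<in>UNIV. P t l k) = 1" for l
  proof -
    interpret S: prob_space "given_start M J l" by (rule prob_space_given_start)
    have "(\<Sum>k\<in>UNIV. P t l k) = measure (given_start M J l) (\<Union>k\<in>UNIV. state_at t k)"
      unfolding transition_prob_def using state_at_events[OF t]
      by (intro S.finite_measure_finite_Union[symmetric]) (auto simp: disjoint_family_on_def)
    also have "(\<Union>k\<in>UNIV. state_at t k) = space (given_start M J l)" by auto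
    finally show ?thesis using S.prob_space by simp
  qed
  then have cs: "(\<Sum>k\<in>UNIV. E t $ k $ l) = 1" for l
    using moment_0_nth[OF t] by (simp add: moment_0[OF t, symmetric])
  have "(1 :: real^'s) \<bullet> (E t *v y) = (\<Sum>k\<in>UNIV. \<Sum>l\<in>UNIV. E t $ k $ l * y $ l)"
    by (simp add: inner_vec_def matrix_vector_mult_def)
  also have "\<dots> = (\<Sum>l\<in>UNIV. (\<Sum>k\<in>UNIV. E t $ k $ l) * y $ l)"
    by (subst sum.swap) (simp add: sum_distrib_right)
  finally show ?thesis by (simp add: cs inner_vec_def)
qed

end

section \<open>Second moment and variance\<close>

lemma columnvector_mult: "(columnvector x :: real^1^'s) *v w = (w $ 1) *\<^sub>R x"
  by (simp add: vec_eq_iff matrix_vector_mult_def columnvector_def UNIV_1)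

lemma rowvector_mult: "((rowvector y :: real^'s^1) *v v) $ 1 = y \<bullet> v"
  by (simp add: matrix_vector_mult_def rowvector_def inner_vec_def)

lemma inner_one_axis: "(1 :: real^'s) \<bullet> (A *v axis j 1) = (\<Sum>k\<in>UNIV. A $ k $ j)"
  by (simp add: inner_vec_def matrix_vector_mult_basis column_def)

lemma bounded_linear_inner_matrix: "bounded_linear (\<lambda>A :: real^'n^'m. y \<bullet> (A *v v))"
proof -
  have "linear (\<lambda>A :: real^'n^'m. y \<bullet> (A *v v))"
    by (intro linearI) (simp_all add: matrix_vector_mult_add_rdistrib inner_add_right
        scaleR_matrix_vector_assoc[symmetric])
  then show ?thesis by (simp add: linear_conv_bounded_linear)
qed

context map_setting
begin

lemma given_start_power_integrable: "0 \<le> t \<Longrightarrow> p \<le> 2 \<Longrightarrow> integrable (given_start M J j) (\<lambda>\<omega>. (X t \<omega>) ^ p)"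
proof -
  assume t: "0 \<le> t" and p: "p \<le> 2"
  note [measurable] = X_measurable[OF t]
  have "integrable M (\<lambda>\<omega>. indicator (state_at 0 j) \<omega> * (X t \<omega>) ^ p)"
    using integrable_mult_indicator[OF state_at_events[OF order_refl] X_power_integrable[OF t p]] by simp
  then show ?thesis by (subst integrable_given_start) measurable
qed

lemma given_start_state_integrable:
  assumes "0 \<le> t" "p \<le> 2"
  shows "integrable (given_start M J j) (\<lambda>\<omega>. (X t \<omega>) ^ p * of_bool (J t \<omega> = k))"
proof (rule Bochner_Integration.integrable_bound[OF given_start_power_integrable[OF assms]])
  show "(\<lambda>\<omega>. (X t \<omega>) ^ p * of_bool (J t \<omega> = k)) \<in> borel_measurable (given_start M J j)"
    using moment_measurable[OF assms(1), of p k] by (simp add: measurable_def)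
qed (auto intro!: AE_I2)

lemma moment_vector:
  assumes t: "0 \<le> t" and p: "p \<le> 2"
  shows "(\<integral>\<omega>. (X t \<omega>) ^ p *\<^sub>R (axis (J t \<omega>) 1 :: real^'s) \<partial>given_start M J j) = moment p t *v axis j 1"
proof -
  have "(\<integral>\<omega>. (X t \<omega>) ^ p *\<^sub>R (axis (J t \<omega>) 1 :: real^'s) \<partial>given_start M J j) =
    (\<integral>\<omega>. (\<Sum>k\<in>UNIV. ((X t \<omega>) ^ p * of_bool (J t \<omega> = k)) *\<^sub>R (axis k 1 :: real^'s)) \<partial>given_start M J j)"
  proof (intro Bochner_Integration.integral_cong refl)
    fix \<omega>
    have "(\<Sum>k\<in>UNIV. ((X t \<omega>) ^ p * of_bool (J t \<omega> = k)) *\<^sub>R (axis k 1 :: real^'s)) =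
      (\<Sum>k\<in>UNIV. if J t \<omega> = k then (X t \<omega>) ^ p *\<^sub>R axis k 1 else 0)"
      by (intro sum.cong) auto
    then show "(X t \<omega>) ^ p *\<^sub>R (axis (J t \<omega>) 1 :: real^'s) = (\<Sum>k\<in>UNIV. ((X t \<omega>) ^ p * of_bool (J t \<omega> = k))
        *\<^sub>R axis k 1)"
      by simp
  qed
  also have "\<dots> = (\<Sum>k\<in>UNIV. moment p t $ k $ j *\<^sub>R axis k 1)"
    unfolding moment_def vec_lambda_beta
    by (subst Bochner_Integration.integral_sum, intro integrable_scaleR_left given_start_state_integrable t p,
        intro sum.cong refl integral_scaleR_left given_start_state_integrable t p)
  also have "\<dots> = moment p t *v axis j 1"
    unfolding matrix_vector_mult_basis
    by (simp add: vec_eq_iff axis_def column_def if_distrib cong: if_cong)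
  finally show ?thesis .
qed

lemma moment_total:
  assumes t: "0 \<le> t" and p: "p \<le> 2"
  shows "(\<integral>\<omega>. (X t \<omega>) ^ p \<partial>given_start M J j) = 1 \<bullet> (moment p t *v axis j 1)"
proof -
  have "(\<integral>\<omega>. (X t \<omega>) ^ p \<partial>given_start M J j) = (\<integral>\<omega>. (\<Sum>k\<in>UNIV. (X t \<omega>) ^ p * of_bool (J t \<omega> = k)) \<partial>given_start
      M J j)"
    by (intro Bochner_Integration.integral_cong refl) (simp add: of_bool_def if_distrib cong: if_cong)
  also have "\<dots> = (\<Sum>k\<in>UNIV. moment p t $ k $ j)"
    unfolding moment_def vec_lambda_beta
    by (rule Bochner_Integration.integral_sum) (rule given_start_state_integrable[OF t p])
  finally show ?thesis unfolding inner_one_axis .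
qed

text \<open>The outer exponential disappears from the integral, as it preserves sums of entries.\<close>

lemma total_of_moment_1:
  assumes t: "0 \<le> t"
  shows "1 \<bullet> (moment 1 t *v v) = 1 \<bullet> ((eps_X M Q XL Z ** integral {0..t} E) *v v)"
proof -
  let ?e1 = "eps_X M Q XL Z" and ?\<phi> = "\<lambda>A. (1 :: real^'s) \<bullet> (A *v v)"
  have "?\<phi> (moment 1 t) = integral {0..t} (\<lambda>s. ?\<phi> (E (t - s) ** ?e1 ** E s))"
    unfolding moment_1[OF t]
    using integral_linear[OF matrix_integrals(2)[where A="?e1"] bounded_linear_inner_matrix[where y=1 and
        v=v]] by (simp add: o_def)
  also have "\<dots> = integral {0..t} (\<lambda>s. 1 \<bullet> (?e1 *v (E s *v v)))"
    by (intro integral_cong) (simp add: matrix_vector_mul_assoc[symmetric] column_sums_E)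
  also have "\<dots> = integral {0..t} (\<lambda>s. 1 \<bullet> ((?e1 ** E s) *v v))"
    by (simp add: matrix_vector_mul_assoc)
  also have "\<dots> = 1 \<bullet> ((?e1 ** integral {0..t} E) *v v)"
  proof -
    have "bounded_linear (\<lambda>B. 1 \<bullet> ((?e1 ** B) *v v))"
      by (rule bounded_linear_compose[OF bounded_linear_inner_matrix
            bounded_bilinear.bounded_linear_right[OF bounded_bilinear_matrix_mult]])
    from integral_linear[OF matrix_integrals(3) this] show ?thesis by (simp add: o_def)
  qed
  finally show ?thesis .
qed

lemma total_of_moment_2:
  assumes t: "0 \<le> t"
  shows "1 \<bullet> (moment 2 t *v v) = 1 \<bullet> ((eps_X M Q XL Z ** (2 *\<^sub>R integral {0..t} (moment 1))) *v v) +
     1 \<bullet> ((eps_XX M Q XL Z ** integral {0..t} E) *v v)"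
proof -
  let ?e1 = "eps_X M Q XL Z" and ?e2 = "eps_XX M Q XL Z" and ?\<phi> = "\<lambda>A. (1 :: real^'s) \<bullet> (A *v v)"
  have lin: "bounded_linear (\<lambda>B. 1 \<bullet> ((A ** B) *v v))" for A :: "real^'s^'s"
    by (rule bounded_linear_compose[OF bounded_linear_inner_matrix
            bounded_bilinear.bounded_linear_right[OF bounded_bilinear_matrix_mult]])
  have pull: "?\<phi> (integral {0..t} (\<lambda>s. E (t - s) ** A ** B s)) = 1 \<bullet> ((A ** integral {0..t} B) *v v)"
    if i: "(\<lambda>s. E (t - s) ** A ** B s) integrable_on {0..t}" "B integrable_on {0..t}"
    for A :: "real^'s^'s" and B :: "real \<Rightarrow> real^'s^'s"
  proof -
    have "?\<phi> (integral {0..t} (\<lambda>s. E (t - s) ** A ** B s)) = integral {0..t} (\<lambda>s. ?\<phi> (E (t - s) ** A ** B s))"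
      using integral_linear[OF i(1) bounded_linear_inner_matrix[where y=1 and v=v]] by (simp add: o_def)
    also have "\<dots> = integral {0..t} (\<lambda>s. 1 \<bullet> ((A ** B s) *v v))"
      by (intro integral_cong) (simp add: matrix_mul_assoc[symmetric] matrix_vector_mul_assoc[symmetric, of
          "E _"] column_sums_E)
    also have "\<dots> = 1 \<bullet> ((A ** integral {0..t} B) *v v)"
      using integral_linear[OF i(2) lin[of A]] by (simp add: o_def)
    finally show ?thesis .
  qed
  have "?\<phi> (moment 2 t) = 2 * ?\<phi> (integral {0..t} (\<lambda>s. E (t - s) ** ?e1 ** moment 1 s)) +
      ?\<phi> (integral {0..t} (\<lambda>s. E (t - s) ** ?e2 ** E s))"
    unfolding moment_2[OF t] by (simp add: matrix_vector_mult_add_rdistrib inner_add_right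
        scaleR_matrix_vector_assoc[symmetric])
  then show ?thesis
    unfolding pull[OF matrix_integrals(1,4)] pull[OF matrix_integrals(2,3)]
    by (simp add: bounded_bilinear.scaleR_right[OF bounded_bilinear_matrix_mult]
        scaleR_matrix_vector_assoc[symmetric])
qed

text \<open>The product with \<open>columnvector\<close> and \<open>rowvector\<close> is the squared mean: \<open>rowvector 1\<close> takes the sum of the
  entries, which is a scalar, and \<open>columnvector (axis j 1)\<close> starts again from state \<open>j\<close>.\<close>

lemma variance_formula:
  assumes t: "0 \<le> t"
  shows "prob_space.variance (given_start M J j) (X t) =
      1 \<bullet> ((eps_X M Q XL Z ** (2 *\<^sub>R integral {0..t} (moment 1) -
             integral {0..t} E ** (columnvector (axis j 1) :: real^1^'s) ** (rowvector 1 :: real^'s^1) **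
             eps_X M Q XL Z ** integral {0..t} E)) *v axis j 1) +
      1 \<bullet> ((eps_XX M Q XL Z ** integral {0..t} E) *v axis j 1)"
proof -
  interpret S: prob_space "given_start M J j" by (rule prob_space_given_start)
  let ?e1 = "eps_X M Q XL Z" and ?I = "integral {0..t} E" and ?v = "axis j 1 :: real^'s"
  let ?col = "columnvector ?v :: real^1^'s" and ?row = "rowvector 1 :: real^'s^1"
  define c where "c = 1 \<bullet> ((?e1 ** ?I) *v ?v)"
  have "integrable (given_start M J j) (X t)" "integrable (given_start M J j) (\<lambda>\<omega>. (X t \<omega>)\<^sup>2)"
    using given_start_power_integrable[OF t, of 1] given_start_power_integrable[OF t, of 2] by simp_all
  then have "S.variance (X t) = S.expectation (\<lambda>\<omega>. (X t \<omega>)\<^sup>2) - (S.expectation (X t))\<^sup>2"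
    by (rule S.variance_eq)
  also have "S.expectation (\<lambda>\<omega>. (X t \<omega>)\<^sup>2) = 1 \<bullet> (moment 2 t *v ?v)" using moment_total[OF t, of 2] by simp
  also have "(S.expectation (X t))\<^sup>2 = c\<^sup>2"
    using moment_total[OF t, of 1 j] total_of_moment_1[OF t] by (simp add: c_def)
  finally have var: "S.variance (X t) = 1 \<bullet> (moment 2 t *v ?v) - c\<^sup>2" .
  have "?I ** ?col ** ?row ** ?e1 ** ?I *v ?v = ?I *v (?col *v (?row *v ((?e1 ** ?I) *v ?v)))"
    by (simp add: matrix_vector_mul_assoc matrix_mul_assoc)
  also have "\<dots> = c *\<^sub>R (?I *v ?v)"
    by (simp add: columnvector_mult rowvector_mult c_def matrix_vector_mult_scaleR)
  finally have "1 \<bullet> ((?e1 ** (?I ** ?col ** ?row ** ?e1 ** ?I)) *v ?v) = 1 \<bullet> (?e1 *v (c *\<^sub>R (?I *v ?v)))"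
    by (simp only: matrix_vector_mul_assoc[symmetric])
  also have "\<dots> = c * (1 \<bullet> (?e1 *v (?I *v ?v)))" by (simp add: matrix_vector_mult_scaleR)
  also have "\<dots> = c\<^sup>2" by (simp add: matrix_vector_mul_assoc c_def power2_eq_square)
  finally have sq: "1 \<bullet> ((?e1 ** (?I ** ?col ** ?row ** ?e1 ** ?I)) *v ?v) = c\<^sup>2" .
  have "1 \<bullet> ((?e1 ** (2 *\<^sub>R integral {0..t} (moment 1) - ?I ** ?col ** ?row ** ?e1 ** ?I)) *v ?v) =
    1 \<bullet> ((?e1 ** (2 *\<^sub>R integral {0..t} (moment 1))) *v ?v) - c\<^sup>2"
    unfolding sq[symmetric] bounded_bilinear.diff_right[OF bounded_bilinear_matrix_mult]
    by (simp add: matrix_vector_mult_diff_rdistrib inner_diff_right)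
  then show ?thesis unfolding var total_of_moment_2[OF t] by simp
qed

end

theorem theorem3p10:
  fixes M :: "'w measure" and F :: "real \<Rightarrow> 'w measure"
    and X :: "real \<Rightarrow> 'w \<Rightarrow> real" and J :: "real \<Rightarrow> 'w \<Rightarrow> 's::finite"
    and XL :: "'s \<Rightarrow> real \<Rightarrow> 'w \<Rightarrow> real" and Z :: "'s \<Rightarrow> 's \<Rightarrow> nat \<Rightarrow> 'w \<Rightarrow> real"
    and Q :: "real^'s^'s" and j :: 's and t :: real
  assumes "usual_filtered_prob_space M F"
    and "MAP M F X J"
    and "intensity_matrix M J Q"
    and "irreducible_chain M J"
    and "map_path_structure M F X J XL Z"
    and "\<And>i. integrable (given_start M J i) (\<lambda>\<omega>. \<bar>X 1 \<omega>\<bar>\<^sup>2)"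
    and "0 < t"
  shows "integrable (given_start M J j) (\<lambda>\<omega>. (X t \<omega>)\<^sup>2) \<and>
    integral\<^sup>L (given_start M J j) (\<lambda>\<omega>. (X t \<omega>)\<^sup>2 *\<^sub>R (axis (J t \<omega>) 1 :: real^'s)) =
      (2 *\<^sub>R integral {0..t} (\<lambda>s.
           matrix_exp ((t - s) *\<^sub>R transpose Q) ** eps_X M Q XL Z **
           integral {0..s} (\<lambda>u.
             matrix_exp ((s - u) *\<^sub>R transpose Q) ** eps_X M Q XL Z **
             matrix_exp (u *\<^sub>R transpose Q))) +
       integral {0..t} (\<lambda>s.
           matrix_exp ((t - s) *\<^sub>R transpose Q) ** eps_XX M Q XL Z **
           matrix_exp (s *\<^sub>R transpose Q)))
      *v axis j 1 \<and>
    prob_space.variance (given_start M J j) (X t) =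
      1 \<bullet> ((eps_X M Q XL Z **
            (2 *\<^sub>R integral {0..t} (\<lambda>s. integral {0..s} (\<lambda>u.
                matrix_exp ((s - u) *\<^sub>R transpose Q) ** eps_X M Q XL Z **
                matrix_exp (u *\<^sub>R transpose Q))) -
             integral {0..t} (\<lambda>s. matrix_exp (s *\<^sub>R transpose Q)) **
             (columnvector (axis j 1) :: real^1^'s) ** (rowvector 1 :: real^'s^1) **
             eps_X M Q XL Z **
             integral {0..t} (\<lambda>s. matrix_exp (s *\<^sub>R transpose Q)))) *v axis j 1) +
      1 \<bullet> ((eps_XX M Q XL Z ** integral {0..t} (\<lambda>s. matrix_exp (s *\<^sub>R transpose Q))) *v axis j 1)"
proof -
  interpret U: usual_filtered_prob_space M F by fact
  interpret map_setting M F X J XL Z Q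
    by unfold_locales (fact assms)+
  have t: "0 \<le> t" using \<open>0 < t\<close> by simp
  have inner: "integral {0..t} (\<lambda>s. E (t - s) ** eps_X M Q XL Z
      ** integral {0..s} (\<lambda>u. E (s - u) ** eps_X M Q XL Z ** E u)) =
      integral {0..t} (\<lambda>s. E (t - s) ** eps_X M Q XL Z ** moment 1 s)"
    "integral {0..t} (\<lambda>s. integral {0..s} (\<lambda>u. E (s - u) ** eps_X M Q XL Z ** E u))
        = integral {0..t} (moment 1)"
    by (rule integral_cong, simp add: moment_1 del: One_nat_def)+
  show ?thesis
    unfolding inner
    using given_start_power_integrable[OF t, of 2 j] moment_vector[OF t, of 2 j] moment_2[OF t]
        variance_formula[OF t, of j]
    by simp
qed

end
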